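(* Let $n$ be a positive integer and let $\mathcal{Y}^{\mathbf{a}}$ be the set of self-conjugate Young diagrams that fit inside an $n\times n$ box. The set $\mathcal{Y}^{\mathbf{a}}$ with the operators $$\tilde e_k(Y)=Y^{--}_{k,2n-k},\quad \tilde f_k(Y)=Y^{++}_{k,2n-k}\quad(1\le k\le n-1),\qquad \tilde e_n(Y)=Y^-_n,\quad \tilde f_n(Y)=Y^+_n,$$ $$\mathrm{wt}(Y)=\omega_n-\sum_{i=1}^n\#\{\text{vertices in }Y\text{ of degree }i\}\,\alpha_i,$$ $$\varepsilon_k(Y)=\max\{m\ge0: \tilde e_k^m(Y)\ne0\},\qquad \varphi_k(Y)=\max\{m\ge0:\tilde f_k^m(Y)\neq0\}\qquad(1\le k\le n),$$ where the ghost partition $\nabla$ is identified with $0$, is isomorphic to the crystal of the spin representation of type $B_n$, i.e. to the crystal of the irreducible highest weight representation $V(\omega_n)$ of $\mathfrak{so}_{2n+1}$.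
   Context: $\mathfrak{so}_{2n+1}=\mathfrak{so}_{2n+1}(\mathbb{C})$ is the simple Lie algebra of type $B_n$, with simple roots $\alpha_1,\dots,\alpha_n$ ($\alpha_n$ the short one), coroots $h_1,\dots,h_n$ and fundamental weights $\omega_1,\dots,\omega_n$; thus $\langle h_{n-1},\alpha_n\rangle=-1$ and $\langle h_n,\alpha_{n-1}\rangle=-2$. Let $\mathcal{Y}$ be the set of Young diagrams (partitions) $(n\ge\lambda_1\ge\lambda_2\ge\dots\ge\lambda_n\ge0)$ with at most $n$ rows and all rows of length at most $n$. The conjugate diagram $\tilde Y$ of $Y$ is its reflection in the diagonal; $Y$ is self-conjugate if $\tilde Y=Y$. Each box of $Y$ is called a vertex and has a degree in $\{1,\dots,2n-1\}$: the box in row $r$ and column $s$ has degree $n+s-r$ (so boxes on the main diagonal have degree $n$; replacing this convention by $n+r-s$ makes no difference for self-conjugate diagrams). For $Y\in\mathcal{Y}$, $Y^+_k$ (resp. $Y^-_k$) is the Young diagram in $\mathcal{Y}$ obtained from $Y$ by adding (resp. removing) a vertex of degree $k$ if such a diagram exists, and is the ghost partition $\nabla$ otherwise. Similarly $Y^{++}_{i,j}$ (resp. $Y^{--}_{i,j}$) is the Young diagram in $\mathcal{Y}$ obtained from $Y$ by adding (resp. removing) a vertex of degree $i$ and a vertex of degree $j$ if it exists, and $\nabla$ otherwise. All operators send $0$ to $0$. A crystal isomorphism is a bijection commuting with all $\tilde e_k,\tilde f_k$ (including the value $0$) and preserving $\mathrm{wt},\varepsilon_k,\varphi_k$ (Kashiwara's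 notion of crystal); the crystal of $V(\omega_n)$ is the one associated to the crystal base of the $U_q(\mathfrak{so}_{2n+1})$-module with highest weight $\omega_n$. *)

theory Defs
  imports
    "HOL-Computational_Algebra.Polynomial"
    "HOL-Computational_Algebra.Fraction_Field"
    "HOL-Library.Function_Algebras"
begin

section \<open>Root datum of type B\<close>

text \<open>The index set is \<open>{1..n}\<close>. A weight is given by its coordinates in the basis of
  fundamental weights, so \<open>lam i\<close> is the pairing of \<open>lam\<close> with the coroot \<open>h_i\<close>; the
  coordinates outside \<open>{1..n}\<close> are required to vanish.\<close>

type_synonym weight = "nat \<Rightarrow> int"

definition weight_lattice :: "nat \<Rightarrow> weight set" where
  "weight_lattice n = {lam. \<forall>i. i \<notin> {1..n} \<longrightarrow> lam i = 0}"

text \<open>\<open>cartan n i j\<close> is the pairing of \<open>h_i\<close> with \<open>alpha_j\<close>; the root \<open>alpha_n\<close> is short.\<close>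

definition cartan :: "nat \<Rightarrow> nat \<Rightarrow> nat \<Rightarrow> int" where
  "cartan n i j =
    (if i = j then 2
     else if i = n \<and> Suc j = n then - 2
     else if Suc i = j \<or> Suc j = i then - 1
     else 0)"

definition fundamental_weight :: "nat \<Rightarrow> weight" where
  "fundamental_weight k = (\<lambda>j. if j = k then 1 else 0)"

definition simple_root :: "nat \<Rightarrow> nat \<Rightarrow> weight" where
  "simple_root n i = (\<lambda>j. if j \<in> {1..n} then cartan n j i else 0)"

text \<open>Half the squared length of \<open>alpha_i\<close>, normalised so that short roots have squared
  length 2.\<close>

definition half_norm :: "nat \<Rightarrow> nat \<Rightarrow> nat" where
  "half_norm n i = (if i = n then 1 else 2)"


section \<open>Crystals\<close>

text \<open>The value \<open>0\<close> of the operators is \<open>None\<close>. Only crystals with finite \<open>eps\<close> and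
  \<open>phi\<close> occur here, so the value minus infinity allowed by Kashiwara is not modelled.\<close>

record 'b crystal =
  elements :: "'b set"
  wt :: "'b \<Rightarrow> weight"
  eps :: "nat \<Rightarrow> 'b \<Rightarrow> int"
  phi :: "nat \<Rightarrow> 'b \<Rightarrow> int"
  et :: "nat \<Rightarrow> 'b \<Rightarrow> 'b option"
  ft :: "nat \<Rightarrow> 'b \<Rightarrow> 'b option"

definition is_crystal :: "nat \<Rightarrow> 'b crystal \<Rightarrow> bool" where
  "is_crystal n C \<longleftrightarrow>
    (\<forall>b\<in>elements C. wt C b \<in> weight_lattice n) \<and>
    (\<forall>i\<in>{1..n}. \<forall>b\<in>elements C.
       phi C i b = eps C i b + wt C b i \<and>
       (\<forall>b'. et C i b = Some b' \<longrightarrow>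
          b' \<in> elements C \<and> wt C b' = wt C b + simple_root n i \<and>
          eps C i b' = eps C i b - 1 \<and> phi C i b' = phi C i b + 1) \<and>
       (\<forall>b'. ft C i b = Some b' \<longrightarrow>
          b' \<in> elements C \<and> wt C b' = wt C b - simple_root n i \<and>
          eps C i b' = eps C i b + 1 \<and> phi C i b' = phi C i b - 1) \<and>
       (\<forall>b'\<in>elements C. ft C i b = Some b' \<longleftrightarrow> et C i b' = Some b))"

definition crystal_iso :: "nat \<Rightarrow> 'a crystal \<Rightarrow> 'b crystal \<Rightarrow> ('a \<Rightarrow> 'b) \<Rightarrow> bool" where
  "crystal_iso n C D \<psi> \<longleftrightarrow>
    bij_betw \<psi> (elements C) (elements D) \<and>
    (\<forall>b\<in>elements C. wt D (\<psi> b) = wt C b) \<and>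
    (\<forall>i\<in>{1..n}. \<forall>b\<in>elements C.
       et D i (\<psi> b) = map_option \<psi> (et C i b) \<and>
       ft D i (\<psi> b) = map_option \<psi> (ft C i b) \<and>
       eps D i (\<psi> b) = eps C i b \<and>
       phi D i (\<psi> b) = phi C i b)"

definition crystal_isomorphic :: "nat \<Rightarrow> 'a crystal \<Rightarrow> 'b crystal \<Rightarrow> bool" where
  "crystal_isomorphic n C D \<longleftrightarrow>
    is_crystal n C \<and> is_crystal n D \<and> (\<exists>\<psi>. crystal_iso n C D \<psi>)"

text \<open>The largest \<open>m\<close> such that the \<open>m\<close>-th iterate of \<open>g\<close> at \<open>b\<close> is nonzero.\<close>

definition max_iter :: "('b \<Rightarrow> 'b option) \<Rightarrow> 'b \<Rightarrow> nat" where
  "max_iter g b = Max {m. ((\<lambda>x. Option.bind x g) ^^ m) (Some b) \<noteq> None}"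


section \<open>The crystal of self-conjugate Young diagrams\<close>

text \<open>A diagram is the set of its boxes \<open>(r, s)\<close> (row, column).\<close>

type_synonym diagram = "(nat \<times> nat) set"

definition young_diagrams :: "nat \<Rightarrow> diagram set" where
  "young_diagrams n =
    {{(r, s). r \<in> {1..n} \<and> 1 \<le> s \<and> s \<le> lam r} | lam :: nat \<Rightarrow> nat.
       (\<forall>r\<in>{1..n}. lam r \<le> n) \<and>
       (\<forall>r\<in>{1..n}. \<forall>r'\<in>{1..n}. r \<le> r' \<longrightarrow> lam r' \<le> lam r)}"

definition conjugate :: "diagram \<Rightarrow> diagram" where
  "conjugate Y = {(s, r). (r, s) \<in> Y}"

definition self_conjugate_diagrams :: "nat \<Rightarrow> diagram set" where
  "self_conjugate_diagrams n = {Y \<in> young_diagrams n. conjugate Y = Y}"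

definition box_degree :: "nat \<Rightarrow> nat \<times> nat \<Rightarrow> nat" where
  "box_degree n = (\<lambda>(r, s). n + s - r)"

definition adds_one :: "nat \<Rightarrow> nat \<Rightarrow> diagram \<Rightarrow> diagram \<Rightarrow> bool" where
  "adds_one n k Y Y' \<longleftrightarrow> (\<exists>b. b \<notin> Y \<and> box_degree n b = k \<and> Y' = insert b Y)"

definition adds_two :: "nat \<Rightarrow> nat \<Rightarrow> nat \<Rightarrow> diagram \<Rightarrow> diagram \<Rightarrow> bool" where
  "adds_two n i j Y Y' \<longleftrightarrow>
    (\<exists>b c. b \<notin> Y \<and> c \<notin> Y \<and> b \<noteq> c \<and> box_degree n b = i \<and> box_degree n c = j \<and>
           Y' = insert b (insert c Y))"

text \<open>The ghost partition is \<open>None\<close>. The diagrams below are unique if they exist, because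
  the boxes of a given degree in a Young diagram form an initial segment of a diagonal.\<close>

definition the_diagram :: "nat \<Rightarrow> (diagram \<Rightarrow> bool) \<Rightarrow> diagram option" where
  "the_diagram n P =
    (if \<exists>Y\<in>young_diagrams n. P Y then Some (THE Y. Y \<in> young_diagrams n \<and> P Y) else None)"

definition add_one :: "nat \<Rightarrow> nat \<Rightarrow> diagram \<Rightarrow> diagram option" where
  "add_one n k Y = the_diagram n (\<lambda>Y'. adds_one n k Y Y')"

definition remove_one :: "nat \<Rightarrow> nat \<Rightarrow> diagram \<Rightarrow> diagram option" where
  "remove_one n k Y = the_diagram n (\<lambda>Y'. adds_one n k Y' Y)"

definition add_two :: "nat \<Rightarrow> nat \<Rightarrow> nat \<Rightarrow> diagram \<Rightarrow> diagram option" where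
  "add_two n i j Y = the_diagram n (\<lambda>Y'. adds_two n i j Y Y')"

definition remove_two :: "nat \<Rightarrow> nat \<Rightarrow> nat \<Rightarrow> diagram \<Rightarrow> diagram option" where
  "remove_two n i j Y = the_diagram n (\<lambda>Y'. adds_two n i j Y' Y)"

definition diagram_e :: "nat \<Rightarrow> nat \<Rightarrow> diagram \<Rightarrow> diagram option" where
  "diagram_e n k Y = (if k = n then remove_one n n Y else remove_two n k (2 * n - k) Y)"

definition diagram_f :: "nat \<Rightarrow> nat \<Rightarrow> diagram \<Rightarrow> diagram option" where
  "diagram_f n k Y = (if k = n then add_one n n Y else add_two n k (2 * n - k) Y)"

definition diagram_wt :: "nat \<Rightarrow> diagram \<Rightarrow> weight" where
  "diagram_wt n Y =
    (\<lambda>j. fundamental_weight n j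
         - (\<Sum>i = 1..n. int (card {b \<in> Y. box_degree n b = i}) * simple_root n i j))"

definition diagram_crystal :: "nat \<Rightarrow> diagram crystal" where
  "diagram_crystal n =
    \<lparr> elements = self_conjugate_diagrams n,
      wt = diagram_wt n,
      eps = (\<lambda>k Y. int (max_iter (diagram_e n k) Y)),
      phi = (\<lambda>k Y. int (max_iter (diagram_f n k) Y)),
      et = diagram_e n,
      ft = diagram_f n \<rparr>"


section \<open>Modules over the quantum group\<close>

text \<open>The base field is the field of rational functions in \<open>q\<close> over the rationals.\<close>

type_synonym qfield = "rat poly fract"

definition q :: qfield where
  "q = Fract [:0, 1:] 1"

definition rat_const :: "rat \<Rightarrow> qfield" where
  "rat_const c = Fract [:c:] 1"

text \<open>The local ring of rational functions that are regular at \<open>q = 0\<close>.\<close>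

definition regular_at_0 :: "qfield set" where
  "regular_at_0 = {Fract f g | f g. poly g 0 \<noteq> 0}"

definition q_sub :: "nat \<Rightarrow> nat \<Rightarrow> qfield" where
  "q_sub n i = q ^ half_norm n i"

definition q_int :: "nat \<Rightarrow> nat \<Rightarrow> nat \<Rightarrow> qfield" where
  "q_int n i m =
    (q_sub n i powi int m - q_sub n i powi (- int m)) / (q_sub n i - inverse (q_sub n i))"

definition q_fact :: "nat \<Rightarrow> nat \<Rightarrow> nat \<Rightarrow> qfield" where
  "q_fact n i m = (\<Prod>k = 1..m. q_int n i k)"

text \<open>The data of a module: the underlying space is the subspace \<open>vecs\<close> of a vector space
  with scalar multiplication \<open>smul\<close>, and \<open>E i\<close>, \<open>F i\<close>, \<open>K i\<close>, \<open>Kinv i\<close> are the actions of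
  the generators \<open>e_i\<close>, \<open>f_i\<close>, \<open>q^(h_i)\<close>, \<open>q^(-h_i)\<close>. Only their values on \<open>vecs\<close> and for \<open>i\<close> in
  \<open>{1..n}\<close> are relevant.\<close>

record 'v uq_module =
  vecs :: "'v set"
  smul :: "qfield \<Rightarrow> 'v \<Rightarrow> 'v"
  E :: "nat \<Rightarrow> 'v \<Rightarrow> 'v"
  F :: "nat \<Rightarrow> 'v \<Rightarrow> 'v"
  K :: "nat \<Rightarrow> 'v \<Rightarrow> 'v"
  Kinv :: "nat \<Rightarrow> 'v \<Rightarrow> 'v"

definition endomorphism :: "'v::ab_group_add uq_module \<Rightarrow> ('v \<Rightarrow> 'v) \<Rightarrow> bool" where
  "endomorphism M T \<longleftrightarrow>
    (\<forall>v\<in>vecs M. T v \<in> vecs M) \<and>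
    (\<forall>v\<in>vecs M. \<forall>w\<in>vecs M. T (v + w) = T v + T w) \<and>
    (\<forall>c. \<forall>v\<in>vecs M. T (smul M c v) = smul M c (T v))"

definition divided_E :: "nat \<Rightarrow> 'v uq_module \<Rightarrow> nat \<Rightarrow> nat \<Rightarrow> 'v \<Rightarrow> 'v" where
  "divided_E n M i k v = smul M (inverse (q_fact n i k)) ((E M i ^^ k) v)"

definition divided_F :: "nat \<Rightarrow> 'v uq_module \<Rightarrow> nat \<Rightarrow> nat \<Rightarrow> 'v \<Rightarrow> 'v" where
  "divided_F n M i k v = smul M (inverse (q_fact n i k)) ((F M i ^^ k) v)"

text \<open>A module over the quantized enveloping algebra of type B, which is presented by the
  generators above and the relations below. The element \<open>t_i\<close> of the algebra is the power of
  \<open>q^(h_i)\<close> with exponent \<open>half_norm n i\<close>. The last two lines are the q-Serre relations.\<close>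

definition is_uq_module :: "nat \<Rightarrow> 'v::ab_group_add uq_module \<Rightarrow> bool" where
  "is_uq_module n M \<longleftrightarrow>
    vector_space (smul M) \<and>
    module.subspace (smul M) (vecs M) \<and>
    (\<forall>i\<in>{1..n}. endomorphism M (E M i) \<and> endomorphism M (F M i) \<and>
                endomorphism M (K M i) \<and> endomorphism M (Kinv M i)) \<and>
    (\<forall>i\<in>{1..n}. \<forall>v\<in>vecs M. K M i (Kinv M i v) = v \<and> Kinv M i (K M i v) = v) \<and>
    (\<forall>i\<in>{1..n}. \<forall>j\<in>{1..n}. \<forall>v\<in>vecs M.
       K M i (K M j v) = K M j (K M i v) \<and>
       K M i (E M j v) = smul M (q powi cartan n i j) (E M j (K M i v)) \<and>
       K M i (F M j v) = smul M (q powi (- cartan n i j)) (F M j (K M i v)) \<and>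
       E M i (F M j v) - F M j (E M i v) =
         (if i = j
          then smul M (inverse (q_sub n i - inverse (q_sub n i)))
                 ((K M i ^^ half_norm n i) v - (Kinv M i ^^ half_norm n i) v)
          else 0)) \<and>
    (\<forall>i\<in>{1..n}. \<forall>j\<in>{1..n}. i \<noteq> j \<longrightarrow> (\<forall>v\<in>vecs M. \<forall>b. int b = 1 - cartan n i j \<longrightarrow>
       (\<Sum>k\<le>b. smul M ((- 1) ^ k) (divided_E n M i k (E M j (divided_E n M i (b - k) v)))) = 0 \<and>
       (\<Sum>k\<le>b. smul M ((- 1) ^ k) (divided_F n M i k (F M j (divided_F n M i (b - k) v)))) = 0))"

definition weight_space :: "nat \<Rightarrow> 'v uq_module \<Rightarrow> weight \<Rightarrow> 'v set" where
  "weight_space n M lam =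
    {v \<in> vecs M. \<forall>i\<in>{1..n}. K M i v = smul M (q powi lam i) v}"

definition is_submodule :: "nat \<Rightarrow> 'v::ab_group_add uq_module \<Rightarrow> 'v set \<Rightarrow> bool" where
  "is_submodule n M W \<longleftrightarrow>
    W \<subseteq> vecs M \<and> module.subspace (smul M) W \<and>
    (\<forall>i\<in>{1..n}. \<forall>w\<in>W. E M i w \<in> W \<and> F M i w \<in> W \<and> K M i w \<in> W \<and> Kinv M i w \<in> W)"

definition is_irreducible :: "nat \<Rightarrow> 'v::ab_group_add uq_module \<Rightarrow> bool" where
  "is_irreducible n M \<longleftrightarrow>
    vecs M \<noteq> {0} \<and> (\<forall>W. is_submodule n M W \<longrightarrow> W = {0} \<or> W = vecs M)"

definition has_highest_weight :: "nat \<Rightarrow> 'v::ab_group_add uq_module \<Rightarrow> weight \<Rightarrow> bool" where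
  "has_highest_weight n M lam \<longleftrightarrow>
    (\<exists>v\<in>weight_space n M lam. v \<noteq> 0 \<and> (\<forall>i\<in>{1..n}. E M i v = 0) \<and>
       (\<forall>W. is_submodule n M W \<and> v \<in> W \<longrightarrow> W = vecs M))"

text \<open>\<open>M\<close> is a realization of \<open>V(lam)\<close>.\<close>

definition is_V :: "nat \<Rightarrow> weight \<Rightarrow> 'v::ab_group_add uq_module \<Rightarrow> bool" where
  "is_V n lam M \<longleftrightarrow> is_uq_module n M \<and> is_irreducible n M \<and> has_highest_weight n M lam"


section \<open>Crystal bases\<close>

text \<open>An integrable module is the direct sum of the spaces \<open>f_i^(k) (ker e_i \<inter> M_mu)\<close> with
  \<open>0 \<le> k \<le> mu i\<close>. The following predicate says that \<open>u\<close> is the sum over \<open>(k, mu) \<in> S\<close> of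
  \<open>f_i^(k) (us (k, mu))\<close> in this decomposition.\<close>

definition string_decomposition ::
  "nat \<Rightarrow> 'v::ab_group_add uq_module \<Rightarrow> nat \<Rightarrow> 'v \<Rightarrow> (nat \<times> weight) set \<Rightarrow>
   (nat \<times> weight \<Rightarrow> 'v) \<Rightarrow> bool" where
  "string_decomposition n M i u S us \<longleftrightarrow>
    finite S \<and>
    (\<forall>(k, mu)\<in>S. mu \<in> weight_lattice n \<and> int k \<le> mu i \<and>
       us (k, mu) \<in> weight_space n M mu \<and> E M i (us (k, mu)) = 0) \<and>
    u = (\<Sum>p\<in>S. divided_F n M i (fst p) (us p))"

text \<open>The Kashiwara operators on the module.\<close>

definition kashiwara_e :: "nat \<Rightarrow> 'v::ab_group_add uq_module \<Rightarrow> nat \<Rightarrow> 'v \<Rightarrow> 'v" where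
  "kashiwara_e n M i u =
    (THE w. \<exists>S us. string_decomposition n M i u S us \<and>
       w = (\<Sum>p\<in>S. if fst p = 0 then 0 else divided_F n M i (fst p - 1) (us p)))"

definition kashiwara_f :: "nat \<Rightarrow> 'v::ab_group_add uq_module \<Rightarrow> nat \<Rightarrow> 'v \<Rightarrow> 'v" where
  "kashiwara_f n M i u =
    (THE w. \<exists>S us. string_decomposition n M i u S us \<and>
       w = (\<Sum>p\<in>S. divided_F n M i (fst p + 1) (us p)))"

text \<open>\<open>L\<close> is a free module over the local ring and the field of fractions tensored with \<open>L\<close> is
  the whole module. The latter amounts to \<open>L\<close> spanning the module, since the natural map from
  the tensor product to the module is always injective.\<close>

definition is_lattice :: "'v::ab_group_add uq_module \<Rightarrow> 'v set \<Rightarrow> bool" where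
  "is_lattice M L \<longleftrightarrow>
    (\<exists>X \<subseteq> vecs M.
       L = {\<Sum>x\<in>T. smul M (c x) x | T c.
              finite T \<and> T \<subseteq> X \<and> (\<forall>x\<in>T. c x \<in> regular_at_0)} \<and>
       (\<forall>T c. finite T \<and> T \<subseteq> X \<and> (\<forall>x\<in>T. c x \<in> regular_at_0) \<and> (\<Sum>x\<in>T. smul M (c x) x) = 0
          \<longrightarrow> (\<forall>x\<in>T. c x = 0))) \<and>
    module.span (smul M) L = vecs M"

text \<open>The class of \<open>u\<close> in \<open>L / q L\<close>.\<close>

definition residue :: "'v::ab_group_add uq_module \<Rightarrow> 'v set \<Rightarrow> 'v \<Rightarrow> 'v set" where
  "residue M L u = {u + smul M q w | w. w \<in> L}"

text \<open>\<open>B\<close> is a basis of the vector space \<open>L / q L\<close> over the rationals; linear combinations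
  of classes are expressed through representatives \<open>u b \<in> b\<close>.\<close>

definition is_residue_basis :: "'v::ab_group_add uq_module \<Rightarrow> 'v set \<Rightarrow> 'v set set \<Rightarrow> bool" where
  "is_residue_basis M L B \<longleftrightarrow>
    B \<subseteq> residue M L ` L \<and>
    (\<forall>S c u. finite S \<and> S \<subseteq> B \<and> (\<forall>b\<in>S. u b \<in> b) \<and>
       residue M L (\<Sum>b\<in>S. smul M (rat_const (c b)) (u b)) = residue M L 0
       \<longrightarrow> (\<forall>b\<in>S. c b = 0)) \<and>
    (\<forall>x\<in>L. \<exists>S c u. finite S \<and> S \<subseteq> B \<and> (\<forall>b\<in>S. u b \<in> b) \<and>
       residue M L x = residue M L (\<Sum>b\<in>S. smul M (rat_const (c b)) (u b)))"

text \<open>The map on \<open>L / q L\<close> induced by an additive map \<open>T\<close> preserving \<open>L\<close> and \<open>q L\<close>: all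
  members of the union coincide.\<close>

definition induced ::
  "'v::ab_group_add uq_module \<Rightarrow> 'v set \<Rightarrow> ('v \<Rightarrow> 'v) \<Rightarrow> 'v set \<Rightarrow> 'v set" where
  "induced M L T b = (\<Union>u\<in>b. residue M L (T u))"

text \<open>The decomposition of \<open>L\<close> into weight parts is required in the form of a sum; it is
  automatically direct.\<close>

definition is_crystal_base ::
  "nat \<Rightarrow> 'v::ab_group_add uq_module \<Rightarrow> 'v set \<Rightarrow> 'v set set \<Rightarrow> bool" where
  "is_crystal_base n M L B \<longleftrightarrow>
    is_lattice M L \<and>
    is_residue_basis M L B \<and>
    (\<forall>u\<in>L. \<exists>S c. finite S \<and> S \<subseteq> weight_lattice n \<and>
       (\<forall>lam\<in>S. c lam \<in> L \<inter> weight_space n M lam) \<and> u = (\<Sum>lam\<in>S. c lam)) \<and>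
    (\<forall>b\<in>B. \<exists>lam\<in>weight_lattice n. b \<in> residue M L ` (L \<inter> weight_space n M lam)) \<and>
    (\<forall>i\<in>{1..n}. \<forall>u\<in>L. kashiwara_e n M i u \<in> L \<and> kashiwara_f n M i u \<in> L) \<and>
    (\<forall>i\<in>{1..n}. \<forall>b\<in>B.
       induced M L (kashiwara_e n M i) b \<in> insert (residue M L 0) B \<and>
       induced M L (kashiwara_f n M i) b \<in> insert (residue M L 0) B) \<and>
    (\<forall>i\<in>{1..n}. \<forall>b\<in>B. \<forall>b'\<in>B.
       b' = induced M L (kashiwara_f n M i) b \<longleftrightarrow> b = induced M L (kashiwara_e n M i) b')"

definition nonzero_residue ::
  "'v::ab_group_add uq_module \<Rightarrow> 'v set \<Rightarrow> 'v set \<Rightarrow> 'v set option" where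
  "nonzero_residue M L b = (if b = residue M L 0 then None else Some b)"

definition residue_e ::
  "nat \<Rightarrow> 'v::ab_group_add uq_module \<Rightarrow> 'v set \<Rightarrow> nat \<Rightarrow> 'v set \<Rightarrow> 'v set option" where
  "residue_e n M L i b = nonzero_residue M L (induced M L (kashiwara_e n M i) b)"

definition residue_f ::
  "nat \<Rightarrow> 'v::ab_group_add uq_module \<Rightarrow> 'v set \<Rightarrow> nat \<Rightarrow> 'v set \<Rightarrow> 'v set option" where
  "residue_f n M L i b = nonzero_residue M L (induced M L (kashiwara_f n M i) b)"

text \<open>The crystal associated to a crystal base \<open>(L, B)\<close> of \<open>M\<close>.\<close>

definition base_crystal ::
  "nat \<Rightarrow> 'v::ab_group_add uq_module \<Rightarrow> 'v set \<Rightarrow> 'v set set \<Rightarrow> 'v set crystal" where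
  "base_crystal n M L B =
    \<lparr> elements = B,
      wt = (\<lambda>b. THE lam. lam \<in> weight_lattice n \<and>
                         b \<in> residue M L ` (L \<inter> weight_space n M lam)),
      eps = (\<lambda>i b. int (max_iter (residue_e n M L i) b)),
      phi = (\<lambda>i b. int (max_iter (residue_f n M L i) b)),
      et = residue_e n M L,
      ft = residue_f n M L \<rparr>"

end

theory Submission imports Defs
begin

text \<open>The spin representation is minuscule: its weights are pairwise distinct, and each of them pairs
  with every coroot to \<open>-1\<close>, \<open>0\<close> or \<open>1\<close>. The locale \<open>minuscule_crystal\<close> isolates this
  property of a crystal, and all arguments about modules and crystal bases are made at that level.

  Strings in such a crystal have length at most one, and the quantum integers of \<open>-1\<close>, \<open>0\<close>, \<open>1\<close> are
  \<open>-1\<close>, \<open>0\<close>, \<open>1\<close>. So the crystal operators, extended linearly to the functions on the crystal,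
  already satisfy the relations of the quantum group. The resulting module is irreducible, because
  distinct weights allow a submodule to be cut down to basis vectors and the crystal is connected
  (\<open>minuscule_module_is_V\<close>).

  Conversely, every irreducible module with the highest weight of the crystal has a basis of weight
  vectors on which \<open>e_i\<close> and \<open>f_i\<close> act like the crystal operators (\<open>basis_E_F\<close>). The vectors
  are obtained from a highest weight vector by descending along paths of the crystal. They do not
  depend on the paths: the difference of two candidates is annihilated by all \<open>e_i\<close>, and the only
  weight of such vectors in an irreducible module is the highest one (\<open>singular_weight\<close>).

  On a basis of this kind the operators of Kashiwara are \<open>e_i\<close> and \<open>f_i\<close> themselves
  (\<open>kashiwara\<close>), so its span over the local ring, together with the classes of its members, is a
  crystal base. There are no others up to a scalar: a crystal base contains the class of a multiple
  of some basis vector, and \<open>e_i\<close> and \<open>f_i\<close> carry this class, with the same scalar, to all other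
  basis vectors (\<open>base_is_standard\<close>). Hence every crystal base has the given crystal.

  It remains to see that self-conjugate diagrams form a minuscule crystal. Such a diagram is
  determined by the lengths of its main diagonal and of those to the right of it, which decrease in
  steps of \<open>0\<close> or \<open>1\<close>; the positions of the proper steps form an arbitrary subset \<open>A\<close> of \<open>{1..n}\<close>
  (\<open>hook_diagram_surj\<close>). Adding boxes of degrees \<open>k\<close> and \<open>2 * n - k\<close> lengthens the diagonal with
  number \<open>n - k\<close> by one, that is, it moves the element \<open>n - k\<close> of \<open>A\<close> to \<open>n - k + 1\<close>, or inserts
  \<open>1\<close> into \<open>A\<close> if \<open>k = n\<close>. In these terms the weights and the operators can be compared
  (\<open>diagram_minuscule\<close>).\<close>


section \<open>Rational functions in q\<close>

lemma q_nonzero: "q \<noteq> 0"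
  by (simp add: q_def Zero_fract_def eq_fract)

lemma q_power: "q ^ m = Fract (monom 1 m) 1"
proof (induction m)
  case 0
  then show ?case by (simp add: One_fract_def)
next
  case (Suc m)
  have "[:0, 1:] * monom (1::rat) m = monom 1 (Suc m)"
    by (metis mult_monom monom_Suc monom_0 mult.left_neutral plus_1_eq_Suc monom_0 One_nat_def)
  then have "q * Fract (monom 1 m) 1 = Fract (monom 1 (Suc m)) 1"
    unfolding q_def by (simp only: mult_fract mult_1_right)
  then show ?case by (simp only: power_Suc Suc)
qed

lemma q_power_inject: "q ^ a = q ^ b \<longleftrightarrow> a = b"
  by (auto simp: q_power eq_fract monom_eq_iff')

lemma q_powi_inject: "q powi a = q powi b \<longleftrightarrow> a = b"
proof -
  have *: "a = b" if "q powi a = q powi b" "a \<le> b" for a b :: int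
  proof -
    have "q powi b = q powi a * q ^ nat (b - a)"
      using that(2) power_int_add[of q a "b - a"] q_nonzero by (simp add: power_int_def)
    then have "q powi a * q ^ nat (b - a) = q powi a * q ^ 0"
      using that(1) by simp
    then have "q ^ nat (b - a) = q ^ 0"
      using q_nonzero by (metis mult_left_cancel power_int_eq_0_iff)
    then show "a = b" using that(2) by (simp add: q_power_inject del: power_0)
  qed
  show ?thesis using *[of a b] *[of b a] by (metis linear)
qed

lemma regular_add:
  assumes "x \<in> regular_at_0" "y \<in> regular_at_0"
  shows "x + y \<in> regular_at_0"
proof -
  obtain f g f' g' where *: "x = Fract f g" "poly g 0 \<noteq> 0" "y = Fract f' g'" "poly g' 0 \<noteq> 0"
    using assms unfolding regular_at_0_def by blast
  then have "g \<noteq> 0" "g' \<noteq> 0" by auto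
  then have "x + y = Fract (f * g' + f' * g) (g * g')" "poly (g * g') 0 \<noteq> 0"
    using * by auto
  then show ?thesis unfolding regular_at_0_def by blast
qed

lemma regular_mult:
  assumes "x \<in> regular_at_0" "y \<in> regular_at_0"
  shows "x * y \<in> regular_at_0"
proof -
  obtain f g f' g' where *: "x = Fract f g" "poly g 0 \<noteq> 0" "y = Fract f' g'" "poly g' 0 \<noteq> 0"
    using assms unfolding regular_at_0_def by blast
  then have "x * y = Fract (f * f') (g * g')" "poly (g * g') 0 \<noteq> 0"
    by auto
  then show ?thesis unfolding regular_at_0_def by blast
qed

lemma rat_const_regular: "rat_const c \<in> regular_at_0"
  unfolding regular_at_0_def rat_const_def by (rule CollectI, rule exI[of _ "[:c:]"], rule exI[of _ 1]) auto

lemma rat_const_simps [simp]: "rat_const 0 = 0" "rat_const 1 = 1" "rat_const (a + b) = rat_const a + rat_const b"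
  "rat_const (a * b) = rat_const a * rat_const b" "rat_const (- a) = - rat_const a"
  by (simp_all add: rat_const_def Zero_fract_def One_fract_def one_pCons mult.commute)

lemma rat_const_eq_0_iff [simp]: "rat_const c = 0 \<longleftrightarrow> c = 0"
  by (simp add: rat_const_def Zero_fract_def eq_fract)

lemma regular_0: "0 \<in> regular_at_0" and regular_1: "1 \<in> regular_at_0"
  using rat_const_regular[of 0] rat_const_regular[of 1] by auto

lemma regular_uminus: "x \<in> regular_at_0 \<Longrightarrow> - x \<in> regular_at_0"
  using regular_mult[OF rat_const_regular[of "-1"], of x] by simp

lemma q_regular: "q \<in> regular_at_0"
  unfolding regular_at_0_def q_def by (rule CollectI, rule exI[of _ "[:0,1:]"], rule exI[of _ 1]) auto

text \<open>The local ring is the sum of the constants and its maximal ideal; the constant is the value at \<open>0\<close>.\<close>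

lemma regular_residue:
  assumes "x \<in> regular_at_0"
  obtains c y where "y \<in> regular_at_0" "x = rat_const c + q * y"
proof -
  obtain f g where x: "x = Fract f g" and g: "poly g 0 \<noteq> 0"
    using assms unfolding regular_at_0_def by auto
  define c where "c = poly f 0 / poly g 0"
  have "poly (f - smult c g) 0 = 0" using g by (simp add: c_def)
  then obtain h where h: "f - smult c g = [:0,1:] * h"
    by (metis dvdE minus_zero poly_eq_0_iff_dvd)
  have g0: "g \<noteq> 0" using g by auto
  have "x = Fract (smult c g + [:0,1:] * h) g" using x h by (metis add_diff_cancel_left' diff_add_cancel add.commute)
  also have "\<dots> = rat_const c + q * Fract h g"
    using g0 by (simp add: rat_const_def q_def eq_fract algebra_simps)
  finally show ?thesis using that[of "Fract h g" c] g unfolding regular_at_0_def by blast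
qed

text \<open>Evaluation at \<open>q = 0\<close> separates the constants from the maximal ideal.\<close>

lemma rat_const_eq_q_times:
  assumes "y \<in> regular_at_0" "rat_const c = q * y"
  shows "c = 0"
proof -
  obtain f g where y: "y = Fract f g" and g: "poly g 0 \<noteq> 0"
    using assms unfolding regular_at_0_def by auto
  have g0: "g \<noteq> 0" using g by auto
  have "[:c:] * g = [:0,1:] * f"
    using assms(2) g0 unfolding y q_def rat_const_def by (simp add: eq_fract)
  then have "poly ([:c:] * g) 0 = poly ([:0,1:] * f) 0" by simp
  then show ?thesis using g by simp
qed

text \<open>The local ring is a valuation ring: after cancelling powers of \<open>q\<close>, a function that is not regular has
  \<open>q\<close> in its denominator only, and its inverse lies in the maximal ideal.\<close>

lemma regular_or_inverse:
  assumes "x \<notin> regular_at_0"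
  obtains y where "y \<in> regular_at_0" "x * (q * y) = 1"
proof -
  obtain f g where x: "x = Fract f g" and g: "g \<noteq> 0"
    by (cases x) auto
  have f: "f \<noteq> 0" using assms x regular_0 g by (auto simp: Zero_fract_def[symmetric] fract_collapse)
  obtain f' where f': "f = [:0,1:] ^ order 0 f * f'" "\<not> [:0,1:] dvd f'"
    using order_decomp[OF f, of 0] by auto
  obtain g' where g': "g = [:0,1:] ^ order 0 g * g'" "\<not> [:0,1:] dvd g'"
    using order_decomp[OF g, of 0] by auto
  have nz: "poly f' 0 \<noteq> 0" "poly g' 0 \<noteq> 0" using f'(2) g'(2) by (auto simp: poly_eq_0_iff_dvd)
  then have nz': "f' \<noteq> 0" "g' \<noteq> 0" by auto
  have less: "order 0 f < order 0 g"
  proof (rule ccontr)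
    assume "\<not> ?thesis"
    then have "f = [:0,1:] ^ order 0 g * ([:0,1:] ^ (order 0 f - order 0 g) * f')"
      by (subst f'(1), simp add: mult.assoc[symmetric] power_add[symmetric])
    then have "x = Fract ([:0,1:] ^ (order 0 f - order 0 g) * f') g'"
      using x g'(1) g nz' by (metis mult_fract_cancel mult_zero_left)
    then show False using assms nz unfolding regular_at_0_def by blast
  qed
  define k where "k = order 0 g - order 0 f - 1"
  have gg: "g = [:0,1:] ^ order 0 f * ([:0,1:] * [:0,1:] ^ k * g')"
  proof -
    have "order 0 g = order 0 f + Suc k" using less by (simp add: k_def)
    then show ?thesis by (subst g'(1), simp add: power_add mult.assoc)
  qed
  have "x = Fract f' ([:0,1:] * [:0,1:] ^ k * g')"
    using x f'(1) gg g by (metis mult_fract_cancel mult_zero_left)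
  then have "x * (q * Fract ([:0,1:] ^ k * g') f') = 1"
    using nz' by (simp add: q_def One_fract_def eq_fract algebra_simps)
  moreover have "Fract ([:0,1:] ^ k * g') f' \<in> regular_at_0"
    using nz unfolding regular_at_0_def by blast
  ultimately show ?thesis using that by blast
qed

lemma q_sub_minus_inverse: "q_sub n i - inverse (q_sub n i) \<noteq> 0"
proof
  assume "q_sub n i - inverse (q_sub n i) = 0"
  then have "q powi (int (half_norm n i)) = q powi (- int (half_norm n i))"
    by (simp add: q_sub_def power_int_minus)
  then show False by (simp only: q_powi_inject) (simp add: half_norm_def split: if_splits)
qed

lemma q_fact_0 [simp]: "q_fact n i 0 = 1" by (simp add: q_fact_def)
lemma q_fact_1 [simp]: "q_fact n i (Suc 0) = 1"
  using q_sub_minus_inverse[of n i] by (simp add: q_fact_def q_int_def power_int_minus)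

text \<open>The left-hand side is the quantum integer of \<open>m\<close>, which involves \<open>q\<close> for all other \<open>m\<close>.\<close>

lemma small_quantum_integer:
  assumes "m \<in> {-1, 0, 1 :: int}"
  shows "inverse (q_sub n i - inverse (q_sub n i)) * ((q powi m) ^ half_norm n i - (q powi (-m)) ^ half_norm n i) = of_int m"
proof -
  have "(q powi m) ^ half_norm n i - (q powi (-m)) ^ half_norm n i = of_int m * (q_sub n i - inverse (q_sub n i))"
    using assms by (auto simp: q_sub_def power_int_minus power_inverse)
  then show ?thesis using q_sub_minus_inverse[of n i] by simp
qed


section \<open>The height of a weight\<close>

text \<open>Twice the sum of the coefficients of a weight in the basis of simple roots. It is the
  pairing with the sum of the positive coroots, which is \<open>i * (2 * n + 1 - i)\<close> times \<open>h_i\<close> for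
  \<open>i < n\<close> plus \<open>n * (n + 1) div 2\<close> times \<open>h_n\<close>. What matters is that it has the same positive value on
  all simple roots.\<close>

definition height :: "nat \<Rightarrow> weight \<Rightarrow> int" where
  "height n lam = (\<Sum>i = 1..n. (if i = n then int (n * (n + 1)) div 2 else int (i * (2 * n + 1 - i))) * lam i)"

text \<open>Evaluates sums along a row or a column of the Cartan matrix, which is tridiagonal.\<close>

lemma sum_neighbours:
  fixes h :: "nat \<Rightarrow> int"
  assumes "j \<in> {1..n}" "\<And>i. i \<noteq> j \<Longrightarrow> Suc i \<noteq> j \<Longrightarrow> i \<noteq> Suc j \<Longrightarrow> h i = 0"
  shows "(\<Sum>i = 1..n. h i) = h j + (if j = 1 then 0 else h (j - 1)) + (if j = n then 0 else h (j + 1))"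
proof -
  have "(\<Sum>i = 1..n. h i) = (\<Sum>i\<in>{j} \<union> (if j = 1 then {} else {j - 1}) \<union> (if j = n then {} else {j + 1}). h i)"
  proof (rule sum.mono_neutral_right)
    show "\<forall>i\<in>{1..n} - ({j} \<union> (if j = 1 then {} else {j - 1}) \<union> (if j = n then {} else {j + 1})). h i = 0"
    proof
      fix i assume i: "i \<in> {1..n} - ({j} \<union> (if j = 1 then {} else {j - 1}) \<union> (if j = n then {} else {j + 1}))"
      show "h i = 0" by (rule assms(2)) (use i assms(1) in \<open>auto split: if_splits\<close>)
    qed
  qed (use assms(1) in auto)
  also have "\<dots> = h j + (if j = 1 then 0 else h (j - 1)) + (if j = n then 0 else h (j + 1))"
    using assms(1) by (auto simp: insert_commute)
  finally show ?thesis .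
qed

lemma height_diff: "height n (lam - mu) = height n lam - height n mu"
  by (simp add: height_def algebra_simps sum_subtractf)

lemma height_add: "height n (lam + mu) = height n lam + height n mu"
  by (simp add: height_def algebra_simps sum.distrib)

lemma height_0 [simp]: "height n 0 = 0"
  by (simp add: height_def)

lemma height_simple_root:
  assumes "j \<in> {1..n}"
  shows "height n (simple_root n j) = 2"
proof -
  define c where "c i = int i * (2 * int n + 1 - int i)" for i
  define d where "d i = (if i = n then int (n * (n + 1)) div 2 else int (i * (2 * n + 1 - i)))" for i
  have d: "d i = c i" if "i < n" for i using that by (simp add: d_def c_def of_nat_diff)
  have dn: "2 * d n = c n"
  proof -
    have "2 * d n = int (n * (n + 1))" by (simp add: d_def)
    also have "\<dots> = c n" by (simp add: c_def algebra_simps)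
    finally show ?thesis .
  qed
  have "height n (simple_root n j) = (\<Sum>i = 1..n. d i * cartan n i j)"
    unfolding height_def by (rule sum.cong) (auto simp: simple_root_def d_def)
  also have "\<dots> = d j * cartan n j j + (if j = 1 then 0 else d (j - 1) * cartan n (j - 1) j)
      + (if j = n then 0 else d (j + 1) * cartan n (j + 1) j)"
    by (rule sum_neighbours) (use assms in \<open>auto simp: cartan_def\<close>)
  also have "\<dots> = 2 * c j - (if j = n then c j else c (j + 1)) - c (j - 1)"
  proof -
    have 1: "(if j = 1 then 0 else d (j - 1) * cartan n (j - 1) j) = - c (j - 1)"
    proof (cases "j = 1")
      case True then show ?thesis by (simp add: c_def)
    next
      case False
      then have "cartan n (j - 1) j = -1" "j - 1 < n" using assms by (auto simp: cartan_def)
      then show ?thesis using False by (simp add: d)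
    qed
    have 2: "d j * cartan n j j + (if j = n then 0 else d (j + 1) * cartan n (j + 1) j) 
       = 2 * c j - (if j = n then c j else c (j + 1))"
    proof (cases "j = n")
      case True then show ?thesis using dn by (simp add: cartan_def)
    next
      case False
      then have jn: "j < n" using assms by auto
      show ?thesis
      proof (cases "j + 1 = n")
        case True
        then have "cartan n (j + 1) j = -2" by (auto simp: cartan_def)
        then show ?thesis using True jn dn by (auto simp: cartan_def d)
      next
        case False
        then have "cartan n (j + 1) j = -1" "j + 1 < n" using jn by (auto simp: cartan_def)
        then show ?thesis using jn by (simp add: cartan_def d)
      qed
    qed
    show ?thesis using 1 2 by linarith
  qed
  also have "\<dots> = 2"
    using assms by (auto simp: c_def of_nat_diff algebra_simps)
  finally show ?thesis .
qed


section \<open>Modules over the quantum group\<close>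

lemma cartan_diag [simp]: "cartan n i i = 2" by (simp add: cartan_def)

lemma cartan_off_diag:
  assumes "i \<noteq> j" "i \<in> {1..n}" "j \<in> {1..n}"
  shows "cartan n i j \<in> {0, -1, -2}" "cartan n i j = 0 \<longleftrightarrow> cartan n j i = 0"
  using assms by (auto simp: cartan_def)

lemma simple_root_lattice: "simple_root n i \<in> weight_lattice n"
  by (auto simp: simple_root_def weight_lattice_def)

lemma weight_lattice_add: "lam \<in> weight_lattice n \<Longrightarrow> mu \<in> weight_lattice n \<Longrightarrow> lam + mu \<in> weight_lattice n"
  and weight_lattice_diff: "lam \<in> weight_lattice n \<Longrightarrow> mu \<in> weight_lattice n \<Longrightarrow> lam - mu \<in> weight_lattice n"
  by (auto simp: weight_lattice_def)

lemma weight_lattice_eqI: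
  assumes "lam \<in> weight_lattice n" "mu \<in> weight_lattice n" "\<And>i. i \<in> {1..n} \<Longrightarrow> lam i = mu i"
  shows "lam = mu"
  using assms by (auto simp: weight_lattice_def fun_eq_iff) metis

locale quantum_module =
  fixes n :: nat and M :: "'v::ab_group_add uq_module"
  assumes uq: "is_uq_module n M"
begin

sublocale vs: vector_space "smul M"
  using uq by (simp add: is_uq_module_def)

lemma vecs_subspace: "vs.subspace (vecs M)"
  using uq by (simp add: is_uq_module_def)

lemmas vecs_closed [simp, intro] =
  vs.subspace_0[OF vecs_subspace] vs.subspace_add[OF vecs_subspace]
  vs.subspace_diff[OF vecs_subspace] vs.subspace_scale[OF vecs_subspace]
  vs.subspace_neg[OF vecs_subspace]

lemma endomorphisms:
  assumes "i \<in> {1..n}"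
  shows "endomorphism M (E M i)" "endomorphism M (F M i)" "endomorphism M (K M i)" "endomorphism M (Kinv M i)"
  using uq assms unfolding is_uq_module_def by blast+

lemma K_Kinv:
  assumes "i \<in> {1..n}" "v \<in> vecs M"
  shows "K M i (Kinv M i v) = v" "Kinv M i (K M i v) = v"
  using uq assms unfolding is_uq_module_def by blast+

lemma relations:
  assumes "i \<in> {1..n}" "j \<in> {1..n}" "v \<in> vecs M"
  shows "K M i (E M j v) = smul M (q powi cartan n i j) (E M j (K M i v))"
    "K M i (F M j v) = smul M (q powi (- cartan n i j)) (F M j (K M i v))"
    "E M i (F M j v) - F M j (E M i v) =
         (if i = j
          then smul M (inverse (q_sub n i - inverse (q_sub n i)))
                 ((K M i ^^ half_norm n i) v - (Kinv M i ^^ half_norm n i) v)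
          else 0)"
  using uq assms unfolding is_uq_module_def by blast+

lemma endo_vecs [intro]: "endomorphism M T \<Longrightarrow> v \<in> vecs M \<Longrightarrow> T v \<in> vecs M"
  and endo_add: "endomorphism M T \<Longrightarrow> v \<in> vecs M \<Longrightarrow> w \<in> vecs M \<Longrightarrow> T (v + w) = T v + T w"
  and endo_smul: "endomorphism M T \<Longrightarrow> v \<in> vecs M \<Longrightarrow> T (smul M c v) = smul M c (T v)"
  by (auto simp: endomorphism_def)

lemma endo_0: "endomorphism M T \<Longrightarrow> T 0 = 0"
  using endo_smul[of T 0 0] by auto

lemma endo_sum:
  assumes "endomorphism M T" "\<And>x. x \<in> A \<Longrightarrow> f x \<in> vecs M"
  shows "T (\<Sum>x\<in>A. f x) = (\<Sum>x\<in>A. T (f x))"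
  using assms(2)
proof (induction A rule: infinite_finite_induct)
  case (insert x A)
  then show ?case using endo_add[OF assms(1), of "f x" "sum f A"] vs.subspace_sum[OF vecs_subspace, of A f] by simp
qed (auto simp: endo_0[OF assms(1)])

lemma endo_diff: "endomorphism M T \<Longrightarrow> v \<in> vecs M \<Longrightarrow> w \<in> vecs M \<Longrightarrow> T (v - w) = T v - T w"
  by (metis endo_add add_diff_cancel diff_add_cancel vecs_closed(3))

lemma vecs_sum: "(\<And>x. x \<in> A \<Longrightarrow> f x \<in> vecs M) \<Longrightarrow> (\<Sum>x\<in>A. f x) \<in> vecs M"
  by (rule vs.subspace_sum[OF vecs_subspace])

lemma span_vecs: "X \<subseteq> vecs M \<Longrightarrow> vs.span X \<subseteq> vecs M"
  by (rule vs.span_minimal[OF _ vecs_subspace])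

text \<open>Endomorphisms are linear on the underlying subspace only, so the induction over the span has to
  carry membership in that subspace along.\<close>

lemma endo_span:
  assumes "endomorphism M T" "X \<subseteq> vecs M" "\<And>x. x \<in> X \<Longrightarrow> T x \<in> vs.span X" "u \<in> vs.span X"
  shows "T u \<in> vs.span X"
proof -
  have "u \<in> vecs M \<and> T u \<in> vs.span X"
    using assms(4)
  proof (induction rule: vs.span_induct_alt)
    case base
    then show ?case using endo_0[OF assms(1)] vs.span_zero by simp
  next
    case (step c x y)
    have "T (smul M c x + y) = smul M c (T x) + T y"
      using endo_add[OF assms(1)] endo_smul[OF assms(1)] step assms(2) by auto
    then show ?case using step assms(2,3) by (auto intro: vs.span_add vs.span_scale)
  qed
  then show ?thesis ..
qed


section \<open>Weight vectors\<close>

abbreviation "wspace \<equiv> weight_space n M"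

lemma wspace_subspace: "vs.subspace (wspace lam)"
  unfolding vs.subspace_def weight_space_def
  by (auto simp: endo_0 endo_add endo_smul endomorphisms vs.scale_right_distrib vs.scale_left_commute)

lemmas wspace_closed = vs.subspace_0[OF wspace_subspace] vs.subspace_add[OF wspace_subspace]
  vs.subspace_diff[OF wspace_subspace] vs.subspace_scale[OF wspace_subspace]

lemma wspace_vecs: "v \<in> wspace lam \<Longrightarrow> v \<in> vecs M"
  by (simp add: weight_space_def)

lemma wspace_K: "v \<in> wspace lam \<Longrightarrow> i \<in> {1..n} \<Longrightarrow> K M i v = smul M (q powi lam i) v"
  by (simp add: weight_space_def)

lemma wspace_Kinv:
  assumes "v \<in> wspace lam" "i \<in> {1..n}"
  shows "Kinv M i v = smul M (q powi (- lam i)) v"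
proof -
  have v: "v \<in> vecs M" using assms wspace_vecs by auto
  have "v = Kinv M i (K M i v)" using K_Kinv assms v by simp
  also have "\<dots> = smul M (q powi lam i) (Kinv M i v)"
    using wspace_K[OF assms] endo_smul[OF endomorphisms(4)[OF assms(2)] v] by simp
  finally have "smul M (q powi (- lam i)) v = smul M (q powi (- lam i) * q powi lam i) (Kinv M i v)"
    by (metis vs.scale_scale)
  then show ?thesis using q_nonzero by (simp add: power_int_minus)
qed

lemma wspace_F:
  assumes "v \<in> wspace lam" "j \<in> {1..n}"
  shows "F M j v \<in> wspace (lam - simple_root n j)"
proof -
  have v: "v \<in> vecs M" using assms wspace_vecs by auto
  have "K M i (F M j v) = smul M (q powi (lam - simple_root n j) i) (F M j v)" if i: "i \<in> {1..n}" for i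
  proof -
    have "K M i (F M j v) = smul M (q powi (- cartan n i j)) (F M j (smul M (q powi lam i) v))"
      using relations(2)[OF i assms(2) v] wspace_K[OF assms(1) i] by simp
    also have "\<dots> = smul M (q powi (- cartan n i j) * q powi lam i) (F M j v)"
      using endo_smul[OF endomorphisms(2)[OF assms(2)] v] by simp
    also have "q powi (- cartan n i j) * q powi lam i = q powi (lam - simple_root n j) i"
      using i q_nonzero by (simp add: simple_root_def power_int_add[symmetric])
    finally show ?thesis .
  qed
  then show ?thesis using endo_vecs[OF endomorphisms(2)[OF assms(2)] v] by (simp add: weight_space_def)
qed

lemma wspace_funpow_K:
  assumes "v \<in> wspace lam" "i \<in> {1..n}"
  shows "(K M i ^^ h) v = smul M ((q powi lam i) ^ h) v"
    "(Kinv M i ^^ h) v = smul M ((q powi (- lam i)) ^ h) v"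
proof -
  have v: "v \<in> vecs M" using assms wspace_vecs by auto
  show "(K M i ^^ h) v = smul M ((q powi lam i) ^ h) v"
    by (induction h) (simp_all add: endo_smul[OF endomorphisms(3)[OF assms(2)] v] wspace_K[OF assms] mult.commute)
  show "(Kinv M i ^^ h) v = smul M ((q powi (- lam i)) ^ h) v"
    by (induction h) (simp_all add: endo_smul[OF endomorphisms(4)[OF assms(2)] v] wspace_Kinv[OF assms] mult.commute)
qed

text \<open>With weights of this size the commutator of \<open>e_i\<close> and \<open>f_i\<close> is the same as for the classical Lie
  algebra; this is what makes the operators of a minuscule crystal into a representation.\<close>

lemma commutator_small:
  assumes "v \<in> wspace lam" "i \<in> {1..n}" "j \<in> {1..n}" "i = j \<Longrightarrow> lam i \<in> {-1, 0, 1}"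
  shows "E M i (F M j v) = F M j (E M i v) + (if i = j then smul M (of_int (lam i)) v else 0)"
proof -
  have v: "v \<in> vecs M" using assms wspace_vecs by auto
  have "smul M (inverse (q_sub n i - inverse (q_sub n i)))
      ((K M i ^^ half_norm n i) v - (Kinv M i ^^ half_norm n i) v) = smul M (of_int (lam i)) v"
    if "i = j"
    using small_quantum_integer[OF assms(4)[OF that], of n i] wspace_funpow_K[OF assms(1,2)]
    by (simp flip: vs.scale_left_diff_distrib)
  then show ?thesis using relations(3)[OF assms(2,3) v] by (auto simp: algebra_simps)
qed

text \<open>Distinct weights give distinct eigenvalues because \<open>q\<close> is not a root of unity. Applying
  \<open>K_i\<close> minus its eigenvalue on one of the vectors removes that vector from the relation.\<close>

lemma weight_vectors_independent:
  assumes "finite T" "inj_on mu T" "\<And>t. t \<in> T \<Longrightarrow> mu t \<in> weight_lattice n"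
    "\<And>t. t \<in> T \<Longrightarrow> x t \<in> wspace (mu t)" "(\<Sum>t\<in>T. x t) = 0" "t \<in> T"
  shows "x t = 0"
  using assms
proof (induction T arbitrary: x t rule: finite_induct)
  case (insert a T x t)
  have xv: "x s \<in> vecs M" if "s \<in> insert a T" for s using insert.prems(3)[of s] that wspace_vecs by auto
  have T0: "x s = 0" if s: "s \<in> T" for s
  proof -
    have "mu s \<noteq> mu a" using insert.prems(1) insert.hyps(2) s by (auto simp: inj_on_def)
    then obtain i where i: "i \<in> {1..n}" "mu s i \<noteq> mu a i"
      using weight_lattice_eqI[OF insert.prems(2) insert.prems(2), of s a] s by auto
    \<comment> \<open>The terms of the relation after applying \<open>K_i\<close> minus its eigenvalue on \<open>x a\<close>.\<close>
    define y where "y r = smul M (q powi mu r i - q powi mu a i) (x r)" for r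
    have "0 = K M i (\<Sum>r\<in>insert a T. x r) - smul M (q powi mu a i) (\<Sum>r\<in>insert a T. x r)"
      using insert.prems(4) endo_0[OF endomorphisms(3)[OF i(1)]] by simp
    also have "\<dots> = (\<Sum>r\<in>insert a T. smul M (q powi mu r i) (x r)) - (\<Sum>r\<in>insert a T. smul M (q powi mu a i) (x r))"
      using endo_sum[OF endomorphisms(3)[OF i(1)] xv, of "insert a T" "\<lambda>z. z"] wspace_K[OF insert.prems(3) i(1)]
      by (simp add: vs.scale_sum_right)
    also have "\<dots> = (\<Sum>r\<in>insert a T. y r)"
      by (simp add: y_def sum_subtractf[symmetric] vs.scale_left_diff_distrib)
    also have "\<dots> = (\<Sum>r\<in>T. y r)" using insert.hyps by (simp add: y_def)
    finally have "(\<Sum>r\<in>T. y r) = 0" by simp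
    then have "y s = 0"
      using insert.IH[of y s] insert.prems s by (auto simp: y_def intro: wspace_closed)
    then show ?thesis using i(2) by (auto simp: y_def q_powi_inject)
  qed
  then have "x a = 0" using insert.prems(4) insert.hyps by simp
  then show ?case using T0 insert.prems(5) by blast
qed simp

text \<open>Collecting the terms of each weight writes the vector as a sum of components with weights in \<open>P\<close>. If
  \<open>mu\<close> were not in \<open>P\<close>, the vector itself would be a further summand of a vanishing sum.\<close>

lemma weight_in_span:
  assumes "u \<in> vs.span (\<Union>nu\<in>P. wspace nu)" "P \<subseteq> weight_lattice n"
    "u \<in> wspace mu" "u \<noteq> 0" "mu \<in> weight_lattice n"
  shows "mu \<in> P"
proof (rule ccontr)
  assume mu: "mu \<notin> P"
  obtain S x where S: "finite S" "S \<subseteq> P" "\<And>nu. nu \<in> S \<Longrightarrow> x nu \<in> wspace nu" "u = (\<Sum>nu\<in>S. x nu)"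
  proof -
    have "\<exists>S x. finite S \<and> S \<subseteq> P \<and> (\<forall>nu. x nu \<in> wspace nu) \<and> u = (\<Sum>nu\<in>S. x nu)"
      using assms(1)
    proof (induction rule: vs.span_induct_alt)
      case base
      show ?case by (rule exI[of _ "{}"], rule exI[of _ "\<lambda>_. 0"]) (auto simp: wspace_closed)
    next
      case (step c v u)
      obtain S x where S: "finite S" "S \<subseteq> P" "\<forall>nu. x nu \<in> wspace nu" "u = (\<Sum>nu\<in>S. x nu)"
        using step by blast
      obtain nu where nu: "nu \<in> P" "v \<in> wspace nu" using step by blast
      define y where "y k = (if k \<in> S then x k else 0) + (if k = nu then smul M c v else 0)" for k
      have "(\<Sum>k\<in>insert nu S. y k) = (\<Sum>k\<in>insert nu S. if k \<in> S then x k else 0) + (\<Sum>k\<in>insert nu S. if k = nu then smul M c v else 0)"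
        by (simp add: y_def sum.distrib)
      also have "(\<Sum>k\<in>insert nu S. if k \<in> S then x k else 0) = (\<Sum>k\<in>S. x k)"
        by (rule sum.mono_neutral_cong_right) (use S in auto)
      also have "(\<Sum>k\<in>insert nu S. if k = nu then smul M c v else 0) = smul M c v"
        using S(1) by (simp only: sum.delta finite_insert) simp
      finally have "smul M c v + u = (\<Sum>k\<in>insert nu S. y k)" using S by (simp add: add.commute)
      moreover have "\<forall>k. y k \<in> wspace k" using S(3) nu by (auto simp: y_def wspace_closed)
      ultimately show ?case using S nu by (intro exI[of _ "insert nu S"] exI[of _ y]) auto
    qed
    then show thesis using that by blast
  qed
  define y where "y k = (if k = mu then - u else x k)" for k
  have "mu \<notin> S" using mu S(2) by blast
  then have "(\<Sum>k\<in>S. y k) = u" using S(4) by (auto simp: y_def intro: sum.cong)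
  then have "(\<Sum>k\<in>insert mu S. y k) = 0" using S(1) \<open>mu \<notin> S\<close> by (simp add: y_def)
  moreover have "y k \<in> wspace k" if "k \<in> insert mu S" for k
    using that S(3) assms(3) vs.subspace_neg[OF wspace_subspace] by (auto simp: y_def)
  ultimately have "y mu = 0"
    using weight_vectors_independent[of "insert mu S" "\<lambda>k. k" y mu] S(1,2) assms(2,5) by auto
  then show False using assms(4) by (simp add: y_def)
qed


section \<open>Singular vectors\<close>

definition word :: "nat list \<Rightarrow> 'v \<Rightarrow> 'v" where
  "word is v = foldr (F M) is v"

lemma word_simps [simp]: "word [] v = v" "word (i # is) v = F M i (word is v)"
  by (simp_all add: word_def)

definition root_sum :: "nat list \<Rightarrow> weight" where
  "root_sum is = (\<Sum>i\<leftarrow>is. simple_root n i)"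

lemma root_sum_simps [simp]: "root_sum [] = 0" "root_sum (i # is) = simple_root n i + root_sum is"
  by (simp_all add: root_sum_def)

lemma root_sum_lattice: "root_sum is \<in> weight_lattice n"
proof (induction "is")
  case (Cons a as)
  then show ?case unfolding root_sum_simps by (rule weight_lattice_add[OF simple_root_lattice])
qed (auto simp: weight_lattice_def)

lemma height_root_sum: "set is \<subseteq> {1..n} \<Longrightarrow> height n (root_sum is) = 2 * int (length is)"
  by (induction "is") (auto simp: height_add height_simple_root)

lemma word_weight: "v \<in> wspace mu \<Longrightarrow> set is \<subseteq> {1..n} \<Longrightarrow> word is v \<in> wspace (mu - root_sum is)"
proof (induction "is")
  case (Cons i "is")
  then have "word is v \<in> wspace (mu - root_sum is)" "i \<in> {1..n}"
    by (simp_all del: minus_apply)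
  from wspace_F[OF this] have "F M i (word is v) \<in> wspace (mu - root_sum is - simple_root n i)" .
  moreover have "mu - root_sum is - simple_root n i = mu - root_sum (i # is)" by (simp add: diff_diff_eq add.commute)
  ultimately show ?case by (simp only: word_simps)
qed simp

definition words :: "'v \<Rightarrow> 'v set" where
  "words v = {word is v | is. set is \<subseteq> {1..n}}"

text \<open>Words in the \<open>f_j\<close> applied to \<open>v\<close> are weight vectors, so their span is stable under the \<open>K_i\<close>. By the
  commutation relations \<open>e_i\<close> can be moved to the right through a word until it reaches the singular
  vector, leaving shorter words behind.\<close>

lemma singular_generates:
  assumes v: "v \<in> wspace mu" and sing: "\<And>i. i \<in> {1..n} \<Longrightarrow> E M i v = 0"
  shows "is_submodule n M (vs.span (words v))"
proof -
  have wv: "words v \<subseteq> vecs M" using word_weight[OF v] wspace_vecs by (auto simp: words_def)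
  have Fw: "F M i x \<in> words v" if "i \<in> {1..n}" "x \<in> words v" for i x
    using that unfolding words_def by (smt (verit) insert_subset list.simps(15) mem_Collect_eq word_simps(2))
  have F: "F M i x \<in> vs.span (words v)" if "i \<in> {1..n}" "x \<in> vs.span (words v)" for i x
    using endo_span[OF endomorphisms(2) wv] that Fw vs.span_base by blast
  have K: "K M i x \<in> vs.span (words v)" "Kinv M i x \<in> vs.span (words v)"
    if i: "i \<in> {1..n}" and x: "x \<in> words v" for i x
  proof -
    obtain "is" where "set is \<subseteq> {1..n}" "x = word is v" using x by (auto simp: words_def)
    then have "x \<in> wspace (mu - root_sum is)" using word_weight[OF v] by simp
    then show "K M i x \<in> vs.span (words v)" "Kinv M i x \<in> vs.span (words v)"
      using wspace_K wspace_Kinv i vs.span_scale vs.span_base x by metis+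
  qed
  have Kp: "(K M i ^^ h) x \<in> vs.span (words v)" "(Kinv M i ^^ h) x \<in> vs.span (words v)"
    if i: "i \<in> {1..n}" and x: "x \<in> vs.span (words v)" for i x h
    by (induction h) (use endo_span[OF endomorphisms(3)[OF i] wv K(1)[OF i]] 
      endo_span[OF endomorphisms(4)[OF i] wv K(2)[OF i]] x in auto)
  have Ew: "E M i (word is v) \<in> vs.span (words v)" if i: "i \<in> {1..n}" and "set is \<subseteq> {1..n}" for i "is"
    using that(2)
  proof (induction "is")
    case Nil
    then show ?case using sing[OF i] vs.span_zero by simp
  next
    case (Cons j "is")
    have j: "j \<in> {1..n}" using Cons by auto
    have w: "word is v \<in> words v" using Cons by (auto simp: words_def)
    have "E M i (F M j (word is v)) = F M j (E M i (word is v)) + (if i = j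
          then smul M (inverse (q_sub n i - inverse (q_sub n i)))
                 ((K M i ^^ half_norm n i) (word is v) - (Kinv M i ^^ half_norm n i) (word is v))
          else 0)"
      using relations(3)[OF i j, of "word is v"] w wv by (auto simp: algebra_simps)
    moreover have "F M j (E M i (word is v)) \<in> vs.span (words v)"
      using F[OF j] Cons by auto
    ultimately show ?case
      using Kp[OF i] vs.span_base[OF w] by (auto intro!: vs.span_add vs.span_scale vs.span_diff vs.span_zero)
  qed
  have E: "E M i x \<in> vs.span (words v)" if "i \<in> {1..n}" "x \<in> vs.span (words v)" for i x
    by (rule endo_span[OF endomorphisms(1)[OF that(1)] wv _ that(2)]) (use Ew that(1) in \<open>auto simp: words_def\<close>)
  show ?thesis unfolding is_submodule_def
    using span_vecs[OF wv] E F Kp[of _ _ 1] by auto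
qed

text \<open>In an irreducible module the highest weight is the only weight of singular vectors: either
  of two singular vectors lies in the span of the words applied to the other one, so the
  difference of their weights is both a sum and the negative of a sum of simple roots.\<close>

lemma singular_weight:
  assumes irr: "is_irreducible n M"
    and v: "v \<in> wspace lam" "v \<noteq> 0" "\<And>i. i \<in> {1..n} \<Longrightarrow> E M i v = 0" "lam \<in> weight_lattice n"
    and w: "w \<in> wspace mu" "w \<noteq> 0" "\<And>i. i \<in> {1..n} \<Longrightarrow> E M i w = 0" "mu \<in> weight_lattice n"
  shows "mu = lam"
proof -
  have *: "\<exists>is. set is \<subseteq> {1..n} \<and> nu' = nu - root_sum is"
    if x: "x \<in> wspace nu" "x \<noteq> 0" "\<And>i. i \<in> {1..n} \<Longrightarrow> E M i x = 0" "nu \<in> weight_lattice n"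
      and y: "y \<in> wspace nu'" "y \<noteq> 0" "nu' \<in> weight_lattice n" for x y nu nu'
  proof -
    have "x \<in> words x" unfolding words_def by (rule CollectI, rule exI[of _ "[]"]) simp
    then have "vs.span (words x) \<noteq> {0}" using vs.span_base x(2) by blast
    then have "vs.span (words x) = vecs M"
      using irr singular_generates[OF x(1,3)] unfolding is_irreducible_def by blast
    then have "y \<in> vs.span (words x)" using y wspace_vecs by auto
    moreover have "words x \<subseteq> (\<Union>nu''\<in>{nu - root_sum is | is. set is \<subseteq> {1..n}}. wspace nu'')"
      using word_weight[OF x(1)] unfolding words_def by blast
    ultimately have "y \<in> vs.span (\<Union>nu''\<in>{nu - root_sum is | is. set is \<subseteq> {1..n}}. wspace nu'')"
      using vs.span_mono by blast
    then have "nu' \<in> {nu - root_sum is | is. set is \<subseteq> {1..n}}"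
      by (rule weight_in_span) (use x y root_sum_lattice weight_lattice_diff in auto)
    then show ?thesis by blast
  qed
  obtain a where a: "set a \<subseteq> {1..n}" "mu = lam - root_sum a" using *[OF v w(1,2,4)] by blast
  obtain b where b: "set b \<subseteq> {1..n}" "lam = mu - root_sum b" using *[OF w v(1,2,4)] by blast
  \<comment> \<open>The two sums of simple roots cancel, but both heights are nonnegative.\<close>
  have "height n (root_sum a) + height n (root_sum b) = height n (lam - mu) + height n (mu - lam)"
    using a(2) b(2) by (metis add_diff_cancel_left' diff_add_cancel)
  then have "a = []" using height_root_sum[OF a(1)] height_root_sum[OF b(1)] by (simp add: height_diff flip: length_0_conv)
  then show ?thesis using a by simp
qed

end

section \<open>Minuscule crystals\<close>

text \<open>Crystal operators have values in \<open>option\<close> types; a function into a vector space is extended by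
  sending \<open>None\<close> to \<open>0\<close>.\<close>

definition opt :: "('b \<Rightarrow> 'v::zero) \<Rightarrow> 'b option \<Rightarrow> 'v" where
  "opt f x = (case x of None \<Rightarrow> 0 | Some b \<Rightarrow> f b)"

lemma opt_simps [simp]: "opt f None = 0" "opt f (Some b) = f b"
  by (simp_all add: opt_def)

lemma iterate_None:
  fixes g :: "'b \<Rightarrow> 'b option"
  shows "((\<lambda>x. Option.bind x g) ^^ m) None = None"
  by (induction m) auto

lemma max_iter_at_most_one:
  assumes "\<And>b'. g b = Some b' \<Longrightarrow> g b' = None"
  shows "int (max_iter g b) = (if g b = None then 0 else 1)"
proof -
  have "((\<lambda>x. Option.bind x g) ^^ m) (Some b) \<noteq> None \<longleftrightarrow> m = 0 \<or> m = 1 \<and> g b \<noteq> None" for m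
  proof (cases m)
    case (Suc k)
    then show ?thesis using assms
      by (cases "g b"; cases k) (auto simp: funpow_Suc_right iterate_None simp del: funpow.simps)
  qed simp
  then have "{m. ((\<lambda>x. Option.bind x g) ^^ m) (Some b) \<noteq> None} = (if g b = None then {0} else {0, 1})"
    by auto
  then show ?thesis by (simp add: max_iter_def)
qed

text \<open>The crystals in which all weights are distinct and pair with the coroots to \<open>-1\<close>, \<open>0\<close> or \<open>1\<close>. The
  operators are then dictated by the weights: \<open>f_i\<close> is defined where the pairing is \<open>1\<close>, and \<open>e_i\<close> where
  it is \<open>-1\<close>. By the last assumption \<open>hw\<close> is the only element annihilated by all \<open>e_i\<close>, which makes
  the crystal connected.\<close>

locale minuscule_crystal =
  fixes n :: nat and C :: "'b crystal" and hw :: 'b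
  assumes finite_elements: "finite (elements C)"
    and hw_element: "hw \<in> elements C"
    and wt_lattice: "b \<in> elements C \<Longrightarrow> wt C b \<in> weight_lattice n"
    and wt_inj: "inj_on (wt C) (elements C)"
    and wt_small: "b \<in> elements C \<Longrightarrow> i \<in> {1..n} \<Longrightarrow> wt C b i \<in> {-1, 0, 1}"
    and et_Some: "b \<in> elements C \<Longrightarrow> i \<in> {1..n} \<Longrightarrow> et C i b = Some b' \<Longrightarrow>
      b' \<in> elements C \<and> wt C b' = wt C b + simple_root n i"
    and ft_Some: "b \<in> elements C \<Longrightarrow> i \<in> {1..n} \<Longrightarrow> ft C i b = Some b' \<Longrightarrow>
      b' \<in> elements C \<and> wt C b' = wt C b - simple_root n i"
    and et_None: "b \<in> elements C \<Longrightarrow> i \<in> {1..n} \<Longrightarrow> et C i b = None \<longleftrightarrow> wt C b i \<noteq> -1"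
    and ft_None: "b \<in> elements C \<Longrightarrow> i \<in> {1..n} \<Longrightarrow> ft C i b = None \<longleftrightarrow> wt C b i \<noteq> 1"
    and eps: "b \<in> elements C \<Longrightarrow> i \<in> {1..n} \<Longrightarrow> eps C i b = (if wt C b i = -1 then 1 else 0)"
    and phi: "b \<in> elements C \<Longrightarrow> i \<in> {1..n} \<Longrightarrow> phi C i b = (if wt C b i = 1 then 1 else 0)"
    and hw_unique: "b \<in> elements C \<Longrightarrow> b \<noteq> hw \<Longrightarrow> \<exists>i\<in>{1..n}. wt C b i = -1"
begin

text \<open>The operators \<open>f_i\<close> (for \<open>s = 1\<close>) and \<open>e_i\<close> (for \<open>s = -1\<close>) in one, so that symmetric statements
  are proved once.\<close>

definition step :: "int \<Rightarrow> nat \<Rightarrow> 'b \<Rightarrow> 'b option" where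
  "step s i b = (if s = 1 then ft C i b else et C i b)"

lemma step_ft [simp]: "step 1 = ft C" and step_et [simp]: "step (-1) = et C"
  by (auto simp: step_def fun_eq_iff)

lemma step_None:
  assumes "s \<in> {1, -1}" "b \<in> elements C" "i \<in> {1..n}"
  shows "step s i b = None \<longleftrightarrow> wt C b i \<noteq> s"
  using assms et_None ft_None by (auto simp: step_def)

lemma step_Some:
  assumes "s \<in> {1, -1}" "b \<in> elements C" "i \<in> {1..n}"
  shows "step s i b = Some b' \<longleftrightarrow> b' \<in> elements C \<and> wt C b i = s \<and>
    wt C b' = (\<lambda>j. wt C b j - s * simple_root n i j)"
proof
  assume *: "step s i b = Some b'"
  have "wt C b i = s" using step_None[OF assms] * by auto
  then show "b' \<in> elements C \<and> wt C b i = s \<and> wt C b' = (\<lambda>j. wt C b j - s * simple_root n i j)"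
    using * et_Some[OF assms(2,3)] ft_Some[OF assms(2,3)] assms(1) by (auto simp: step_def fun_eq_iff)
next
  assume *: "b' \<in> elements C \<and> wt C b i = s \<and> wt C b' = (\<lambda>j. wt C b j - s * simple_root n i j)"
  then obtain b'' where b'': "step s i b = Some b''" using step_None[OF assms] by auto
  then have "b'' \<in> elements C" "wt C b'' = wt C b'"
    using * et_Some[OF assms(2,3)] ft_Some[OF assms(2,3)] assms(1) by (auto simp: step_def fun_eq_iff split: if_splits)
  then show "step s i b = Some b'" using b'' wt_inj * by (auto simp: inj_on_def)
qed

lemma step_wt:
  assumes "s \<in> {1, -1}" "b \<in> elements C" "i \<in> {1..n}" "j \<in> {1..n}" "step s i b = Some b'"
  shows "wt C b' j = wt C b j - s * cartan n j i"
  using step_Some[OF assms(1-3), of b'] assms(4,5) by (auto simp: simple_root_def)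

lemma step_inverse:
  assumes "s \<in> {1, -1}" "b \<in> elements C" "b' \<in> elements C" "i \<in> {1..n}"
  shows "step s i b = Some b' \<longleftrightarrow> step (-s) i b' = Some b"
proof -
  have s: "-s \<in> {1, -1}" using assms(1) by auto
  have *: "simple_root n i i = 2" using assms(4) by (simp add: simple_root_def)
  show ?thesis unfolding step_Some[OF assms(1,2,4)] step_Some[OF s assms(3,4)] using assms * by (auto simp: fun_eq_iff)
qed

lemma step_twice:
  assumes "s \<in> {1, -1}" "b \<in> elements C" "i \<in> {1..n}"
  shows "Option.bind (step s i b) (step s i) = None"
proof (cases "step s i b")
  case (Some b')
  then have "b' \<in> elements C" "wt C b' i \<noteq> s"
    using step_wt[OF assms(1-3) assms(3) Some] assms step_Some[OF assms] by auto
  then show ?thesis using Some step_None[OF assms(1) _ assms(3)] by simp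
qed simp

text \<open>For steps of opposite kinds, the first one changes the pairing on which the second one depends by a
  Cartan integer, in the wrong direction. As pairings have absolute value at most one, the second step is
  possible only if that Cartan integer is zero, and then the order is irrelevant.\<close>

lemma step_commute:
  assumes "s \<in> {1, -1}" "t \<in> {1, -1}" "b \<in> elements C" "i \<in> {1..n}" "j \<in> {1..n}" "i \<noteq> j"
    "s \<noteq> t \<or> cartan n i j = 0"
  shows "Option.bind (step s i b) (step t j) = Option.bind (step t j b) (step s i)"
proof -
  have *: "Option.bind (step t j b) (step s i) = Some c" if c: "Option.bind (step s i b) (step t j) = Some c"
    and as: "s \<in> {1, -1}" "t \<in> {1, -1}" "i \<in> {1..n}" "j \<in> {1..n}" "i \<noteq> j"
    "s \<noteq> t \<or> cartan n i j = 0" for s t i j c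
  proof -
    obtain b' where b': "step s i b = Some b'" "step t j b' = Some c" using c by (auto simp: bind_eq_Some_conv)
    have b'B: "b' \<in> elements C" "wt C b i = s" and wb': "wt C b' = (\<lambda>k. wt C b k - s * simple_root n i k)"
      using b'(1) step_Some[OF as(1) assms(3) as(3)] by auto
    have cB: "c \<in> elements C" "wt C b' j = t" and wc: "wt C c = (\<lambda>k. wt C b' k - t * simple_root n j k)"
      using b'(2) step_Some[OF as(2) b'B(1) as(4)] by auto
    have small: "wt C b j \<in> {-1, 0, 1}" using wt_small assms(3) as(4) by auto
    have "wt C b j - s * cartan n j i = t" using cB(2) step_wt[OF as(1) assms(3) as(3,4) b'(1)] by simp
    moreover have "cartan n j i \<in> {0, -1, -2}" using cartan_off_diag(1)[of j i n] as by auto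
    moreover have iff: "cartan n i j = 0 \<longleftrightarrow> cartan n j i = 0" using cartan_off_diag(2)[of i j n] as by auto
    ultimately have zero: "cartan n j i = 0" "wt C b j = t"
      using small as(1,2,6) by auto
    then have zero': "cartan n i j = 0" using iff by simp
    obtain b'' where b'': "step t j b = Some b''" using step_None[OF as(2) assms(3) as(4)] zero by auto
    then have b''B: "b'' \<in> elements C" and wb'': "wt C b'' = (\<lambda>k. wt C b k - t * simple_root n j k)"
      using step_Some[OF as(2) assms(3) as(4)] by auto
    have "wt C b'' i = s" using step_wt[OF as(2) assms(3) as(4,3) b''] b'B zero' by simp
    moreover have "wt C c = (\<lambda>k. wt C b'' k - s * simple_root n i k)"
      unfolding wc wb' wb'' by (simp add: fun_eq_iff)
    ultimately have "step s i b'' = Some c" using step_Some[OF as(1) b''B as(3)] cB by auto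
    then show ?thesis using b'' by simp
  qed
  have ji: "t \<noteq> s \<or> cartan n j i = 0" using assms(7) cartan_off_diag(2)[OF assms(6,4,5)] by auto
  show ?thesis
  proof (cases "Option.bind (step s i b) (step t j)")
    case (Some c)
    then show ?thesis using *[OF Some assms(1,2,4-7)] by simp
  next
    case None
    show ?thesis
    proof (cases "Option.bind (step t j b) (step s i)")
      case (Some c)
      then show ?thesis using *[OF Some assms(2,1,5,4) assms(6)[symmetric] ji] by simp
    qed (simp add: None)
  qed
qed

text \<open>The first step takes the pairing with the \<open>i\<close>-th coroot from \<open>s\<close> to \<open>-s\<close>, and the middle one only to
  \<open>0\<close>, so a second step in direction \<open>i\<close> is impossible.\<close>

lemma step_serre:
  assumes "s \<in> {1, -1}" "b \<in> elements C" "i \<in> {1..n}" "j \<in> {1..n}" "i \<noteq> j" "cartan n i j = -1"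
  shows "Option.bind (Option.bind (step s i b) (step s j)) (step s i) = None"
proof (cases "Option.bind (step s i b) (step s j)")
  case (Some c)
  then obtain b' where b': "step s i b = Some b'" "step s j b' = Some c" by (auto simp: bind_eq_Some_conv)
  have b'B: "b' \<in> elements C" "wt C b i = s" using b'(1) step_Some[OF assms(1-3)] by auto
  have cB: "c \<in> elements C" using b'(2) step_Some[OF assms(1) b'B(1) assms(4)] by auto
  have "wt C c i = wt C b i - s * 2 + s"
    using step_wt[OF assms(1-3,3) b'(1)] step_wt[OF assms(1) b'B(1) assms(4,3) b'(2)] assms(6) by simp
  then have "wt C c i \<noteq> s" using b'B assms(1) by auto
  then show ?thesis using Some step_None[OF assms(1) cB assms(3)] by simp
qed simp

text \<open>An element of maximal height is annihilated by all \<open>e_i\<close>, so it is \<open>hw\<close>.\<close>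

lemma height_hw: "b \<in> elements C \<Longrightarrow> height n (wt C b) \<le> height n (wt C hw)"
proof -
  assume b: "b \<in> elements C"
  have *: "finite ((\<lambda>b. height n (wt C b)) ` elements C)" "(\<lambda>b. height n (wt C b)) ` elements C \<noteq> {}"
    using finite_elements hw_element by auto
  obtain m where m: "m \<in> elements C" "height n (wt C m) = Max ((\<lambda>b. height n (wt C b)) ` elements C)"
    using Max_in[OF *] by auto
  then have max: "height n (wt C b) \<le> height n (wt C m)" if "b \<in> elements C" for b
    using * that by auto
  have "m = hw"
  proof (rule ccontr)
    assume "m \<noteq> hw"
    then obtain i where i: "i \<in> {1..n}" "et C i m \<noteq> None" using hw_unique[OF m(1)] et_None[OF m(1)] by auto
    then obtain b' where b': "et C i m = Some b'" by auto
    then have "b' \<in> elements C" "height n (wt C b') = height n (wt C m) + 2"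
      using et_Some[OF m(1) i(1) b'] by (auto simp: height_add height_simple_root[OF i(1)])
    then show False using max[of b'] by simp
  qed
  then show ?thesis using max[OF b] by simp
qed

text \<open>The number of operators \<open>f_i\<close> on any path from \<open>hw\<close> to \<open>b\<close>.\<close>

definition depth :: "'b \<Rightarrow> nat" where
  "depth b = nat ((height n (wt C hw) - height n (wt C b)) div 2)"

lemma depth_ft:
  assumes "b \<in> elements C" "i \<in> {1..n}" "ft C i b = Some b'"
  shows "depth b' = Suc (depth b)"
proof -
  have *: "b' \<in> elements C" "wt C b' = wt C b - simple_root n i" using ft_Some[OF assms] by auto
  then have "height n (wt C b') = height n (wt C b) - 2"
    by (simp only: height_diff height_simple_root[OF assms(2)])
  then show ?thesis using height_hw[OF assms(1)] by (auto simp: depth_def)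
qed

lemma et_ft:
  assumes "b \<in> elements C" "i \<in> {1..n}" "et C i b = Some b'"
  shows "b' \<in> elements C" "ft C i b' = Some b"
proof -
  show *: "b' \<in> elements C" using et_Some[OF assms] by simp
  show "ft C i b' = Some b" using step_inverse[of "-1", OF _ assms(1) * assms(2)] assms(3) by simp
qed

lemma ft_et:
  assumes "b \<in> elements C" "i \<in> {1..n}" "ft C i b = Some b'"
  shows "b' \<in> elements C" "et C i b' = Some b"
proof -
  show *: "b' \<in> elements C" using ft_Some[OF assms] by simp
  show "et C i b' = Some b" using step_inverse[of 1, OF _ assms(1) * assms(2)] assms(3) by simp
qed

lemma bind_ft_et:
  assumes "b \<in> elements C" "i \<in> {1..n}"
  shows "Option.bind (ft C i b) (et C i) = (if wt C b i = 1 then Some b else None)"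
    "Option.bind (et C i b) (ft C i) = (if wt C b i = -1 then Some b else None)"
  using ft_None[OF assms] ft_et[OF assms] et_None[OF assms] et_ft[OF assms]
  by (cases "ft C i b"; cases "et C i b"; auto)+

lemma depth_et:
  assumes "b \<in> elements C" "i \<in> {1..n}" "et C i b = Some b'"
  shows "depth b = Suc (depth b')"
  using et_ft[OF assms] depth_ft assms(2) by blast

lemma depth_hw: "depth hw = 0" by (simp add: depth_def)

lemma et_hw: "i \<in> {1..n} \<Longrightarrow> et C i hw = None"
  using depth_et[OF hw_element] depth_hw by (cases "et C i hw") auto

lemma parent:
  assumes "b \<in> elements C" "b \<noteq> hw"
  obtains i b' where "i \<in> {1..n}" "et C i b = Some b'" "b' \<in> elements C" "ft C i b' = Some b"
    "depth b = Suc (depth b')"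
proof -
  obtain i where i: "i \<in> {1..n}" "et C i b \<noteq> None" using hw_unique[OF assms] et_None[OF assms(1)] by auto
  then obtain b' where "et C i b = Some b'" by auto
  then show ?thesis using that i(1) et_ft[OF assms(1) i(1)] depth_et[OF assms(1) i(1)] by blast
qed

lemma down_induct [consumes 1, case_names hw ft]:
  assumes "b \<in> elements C" "P hw"
    "\<And>i b b'. i \<in> {1..n} \<Longrightarrow> b \<in> elements C \<Longrightarrow> b' \<in> elements C \<Longrightarrow> ft C i b = Some b' \<Longrightarrow> P b \<Longrightarrow> P b'"
  shows "P b"
  using assms(1)
proof (induction "depth b" arbitrary: b rule: less_induct)
  case less
  show ?case
  proof (cases "b = hw")
    case False
    from parent[OF less.prems this] obtain i b' where
      "i \<in> {1..n}" "b' \<in> elements C" "ft C i b' = Some b" "depth b = Suc (depth b')" by blast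
    moreover from this have "depth b' < depth b" by simp
    ultimately show ?thesis using less.hyps[of b'] less.prems assms(3)[of i b' b] by blast
  qed (use assms(2) in simp)
qed

lemma up_induct:
  assumes "b \<in> elements C" "P b"
    "\<And>i b b'. i \<in> {1..n} \<Longrightarrow> b \<in> elements C \<Longrightarrow> b' \<in> elements C \<Longrightarrow> et C i b = Some b' \<Longrightarrow> P b \<Longrightarrow> P b'"
  shows "P hw"
  using assms(1,2)
proof (induction "depth b" arbitrary: b rule: less_induct)
  case less
  show ?case
  proof (cases "b = hw")
    case False
    from parent[OF less.prems(1) this] obtain i b' where
      "i \<in> {1..n}" "b' \<in> elements C" "et C i b = Some b'" "depth b = Suc (depth b')" by blast
    moreover from this have "depth b' < depth b" by simp
    ultimately show ?thesis using less.hyps[of b'] less.prems assms(3)[of i b b'] by blast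
  qed (use less in simp)
qed

lemma crystal: "is_crystal n C"
proof -
  have 1: "phi C i b = eps C i b + wt C b i" if "i \<in> {1..n}" "b \<in> elements C" for i b
    using wt_small[OF that(2,1)] eps[OF that(2,1)] phi[OF that(2,1)] by auto
  have 2: "b' \<in> elements C" "wt C b' = wt C b + simple_root n i"
     "eps C i b' = eps C i b - 1" "phi C i b' = phi C i b + 1"
    if b: "i \<in> {1..n}" "b \<in> elements C" "et C i b = Some b'" for i b b'
  proof -
    show 3: "b' \<in> elements C" "wt C b' = wt C b + simple_root n i" using et_Some that by auto
    have "wt C b i = -1" using et_None[OF b(2,1)] b(3) by auto
    moreover have "wt C b' i = 1" using 3(2) calculation b(1) by (simp add: simple_root_def)
    ultimately show "eps C i b' = eps C i b - 1" "phi C i b' = phi C i b + 1"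
      using eps[OF b(2,1)] eps[OF 3(1) b(1)] phi[OF b(2,1)] phi[OF 3(1) b(1)] by auto
  qed
  have 3: "b' \<in> elements C" "wt C b' = wt C b - simple_root n i"
     "eps C i b' = eps C i b + 1" "phi C i b' = phi C i b - 1"
    if b: "i \<in> {1..n}" "b \<in> elements C" "ft C i b = Some b'" for i b b'
  proof -
    have b': "b' \<in> elements C" "et C i b' = Some b" using ft_et[OF b(2,1,3)] by auto
    show "b' \<in> elements C" "wt C b' = wt C b - simple_root n i"
     "eps C i b' = eps C i b + 1" "phi C i b' = phi C i b - 1"
      using 2[OF b(1) b'] b' by auto
  qed
  have 4: "(ft C i b = Some b') = (et C i b' = Some b)"
    if b: "i \<in> {1..n}" "b \<in> elements C" "b' \<in> elements C" for i b b'
    using ft_et[OF b(2,1)] et_ft[OF b(3,1)] by blast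
  show ?thesis unfolding is_crystal_def
    by (intro conjI ballI allI impI) (assumption | rule wt_lattice 1 2 3 4)+
qed


section \<open>The module of a minuscule crystal\<close>

text \<open>On functions on the crystal, the linear extension of a crystal operator is composition with the
  inverse operator; so \<open>e_i\<close> acts by \<open>shift 1 i\<close>, which looks up the value at the image under \<open>f_i\<close>.\<close>

definition shift :: "int \<Rightarrow> nat \<Rightarrow> ('b \<Rightarrow> qfield) \<Rightarrow> 'b \<Rightarrow> qfield" where
  "shift s i x = (\<lambda>b. if b \<in> elements C then opt x (step s i b) else 0)"

definition minuscule_module :: "('b \<Rightarrow> qfield) uq_module" where
  "minuscule_module =
    \<lparr> vecs = {x. \<forall>b. b \<notin> elements C \<longrightarrow> x b = 0},
      smul = (\<lambda>c x b. c * x b),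
      E = shift 1,
      F = shift (-1),
      K = (\<lambda>i x b. q powi wt C b i * x b),
      Kinv = (\<lambda>i x b. q powi (- wt C b i) * x b) \<rparr>"

lemma shift_shift:
  assumes "s \<in> {1, -1}" "b \<in> elements C" "i \<in> {1..n}"
  shows "shift s i (shift t j x) b = opt x (Option.bind (step s i b) (step t j))"
  using step_Some[OF assms] assms by (cases "step s i b") (auto simp: shift_def)

lemma shift_outside: "b \<notin> elements C \<Longrightarrow> shift s i x b = 0"
  by (simp add: shift_def)

lemma shift_0: "shift s i (\<lambda>b. 0) = (\<lambda>b. 0)"
  by (auto simp: shift_def opt_def split: option.splits)

lemma shift_twice:
  assumes "s \<in> {1, -1}" "i \<in> {1..n}"
  shows "shift s i (shift s i x) = (\<lambda>b. 0)"
proof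
  fix b show "shift s i (shift s i x) b = 0"
    using shift_shift[OF assms(1) _ assms(2)] step_twice[OF assms(1) _ assms(2)] shift_outside
    by (cases "b \<in> elements C") auto
qed

lemma shift_funpow:
  assumes "s \<in> {1, -1}" "i \<in> {1..n}" "k \<ge> 2"
  shows "(shift s i ^^ k) x = (\<lambda>b. 0)"
proof -
  have "(shift s i ^^ (2 + m)) x = (\<lambda>b. 0)" for m
    by (simp add: shift_twice[OF assms(1,2)])
  from this[of "k - 2"] show ?thesis using assms(3) by (simp only: le_add_diff_inverse)
qed

definition divided :: "int \<Rightarrow> nat \<Rightarrow> nat \<Rightarrow> ('b \<Rightarrow> qfield) \<Rightarrow> 'b \<Rightarrow> qfield" where
  "divided s i k x = (\<lambda>b. inverse (q_fact n i k) * (shift s i ^^ k) x b)"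

lemma divided_simps:
  "divided s i 0 x = x" "divided s i (Suc 0) x = shift s i x"
  "s \<in> {1, -1} \<Longrightarrow> i \<in> {1..n} \<Longrightarrow> k \<ge> 2 \<Longrightarrow> divided s i k x = (\<lambda>b. 0)"
  by (simp_all add: divided_def shift_funpow)

lemma divided_zero: "divided s i k (\<lambda>b. 0) = (\<lambda>b. 0)"
proof -
  have "(shift s i ^^ k) (\<lambda>b. 0) = (\<lambda>b. 0)" by (induction k) (simp_all add: shift_0)
  then show ?thesis by (simp add: divided_def)
qed

text \<open>Squares of the operators vanish. Hence no term survives for the Cartan integer \<open>-2\<close>, and for \<open>-1\<close> at most
  \<open>e_i e_j e_i\<close>, which is zero by \<open>step_serre\<close>; for \<open>0\<close> the relation is commutativity.\<close>

lemma serre: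
  assumes s: "s \<in> {1, -1}" and ij: "i \<in> {1..n}" "j \<in> {1..n}" "i \<noteq> j" and m: "int m = 1 - cartan n i j"
  shows "(\<Sum>k\<le>m. (\<lambda>b. (-1) ^ k * divided s i k (shift s j (divided s i (m - k) x)) b)) = 0"
proof (cases "cartan n i j = 0")
  case True
  then have m1: "m = Suc 0" using m by simp
  have "shift s j (shift s i x) b = shift s i (shift s j x) b" for b
    using shift_shift[OF s, of b j s i x] shift_shift[OF s, of b i s j x] step_commute[OF s s, of b i j] ij True shift_outside
    by (cases "b \<in> elements C") auto
  then show ?thesis by (simp add: m1 divided_simps fun_eq_iff)
next
  case False
  then have m2: "m \<ge> 2" using m cartan_off_diag[OF ij(3,1,2)] by auto
  have "divided s i k (shift s j (divided s i (m - k) x)) = (\<lambda>b. 0)" if "k \<le> m" for k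
  proof -
    consider "k \<ge> 2" | "m - k \<ge> 2" | "k = 1" "m = 2" using m2 that by linarith
    then show ?thesis
    proof cases
      case 3
      then have c: "cartan n i j = -1" using m by simp
      have "shift s i (shift s j (shift s i x)) b = 0" for b
      proof (cases "b \<in> elements C")
        case True
        have "shift s i (shift s j (shift s i x)) b = opt (shift s i x) (Option.bind (step s i b) (step s j))"
          by (rule shift_shift[OF s True ij(1)])
        also have "\<dots> = opt x (Option.bind (Option.bind (step s i b) (step s j)) (step s i))"
        proof (cases "Option.bind (step s i b) (step s j)")
          case (Some c)
          then obtain b' where b': "step s i b = Some b'" "step s j b' = Some c" by (auto simp: bind_eq_Some_conv)
          then have "c \<in> elements C" using step_Some[OF s True ij(1)] step_Some[OF s _ ij(2)] by blast
          then show ?thesis using Some by (simp add: shift_def)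
        qed simp
        finally show ?thesis using step_serre[OF s True ij c] by simp
      qed (simp add: shift_outside)
      then show ?thesis using 3 by (auto simp: divided_simps)
    qed (auto simp: divided_simps(3)[OF s ij(1)] shift_0 divided_zero)
  qed
  then show ?thesis by (simp add: fun_eq_iff)
qed

end

lemma sum_apply: "(\<Sum>a\<in>A. f a) c = (\<Sum>a\<in>A. f a c)"
  by (induction A rule: infinite_finite_induct) auto

context minuscule_crystal begin

lemma minuscule_module_simps [simp]:
  "vecs minuscule_module = {x. \<forall>b. b \<notin> elements C \<longrightarrow> x b = 0}"
  "smul minuscule_module = (\<lambda>c x b. c * x b)"
  "E minuscule_module = shift 1" "F minuscule_module = shift (-1)"
  "K minuscule_module = (\<lambda>i x b. q powi wt C b i * x b)"
  "Kinv minuscule_module = (\<lambda>i x b. q powi (- wt C b i) * x b)"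
  by (simp_all add: minuscule_module_def)

lemma function_vector_space: "vector_space (\<lambda>(c :: qfield) x (b :: 'b). c * x b)"
  by unfold_locales (auto simp: algebra_simps fun_eq_iff)

lemma endomorphism_shift: "endomorphism minuscule_module (shift s i)"
  unfolding endomorphism_def by (auto simp: shift_def opt_def fun_eq_iff split: option.splits)

lemma endomorphism_scale: "endomorphism minuscule_module (\<lambda>x b. f b * x b)"
  unfolding endomorphism_def by (auto simp: algebra_simps fun_eq_iff)

lemma divided_minuscule:
  "divided_E n minuscule_module = (\<lambda>i k. divided 1 i k)"
  "divided_F n minuscule_module = (\<lambda>i k. divided (-1) i k)"
  by (auto simp: divided_E_def divided_F_def divided_def fun_eq_iff)

lemma funpow_scale: "((\<lambda>x b. f b * x b) ^^ h) x = (\<lambda>b. f b ^ h * (x b :: qfield))"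
  by (induction h) (auto simp: mult.assoc)

lemma shift_weight:
  assumes "s \<in> {1, -1}" "i \<in> {1..n}" "j \<in> {1..n}"
  shows "q powi wt C b i * shift s j x b = q powi (s * cartan n i j) * shift s j (\<lambda>b. q powi wt C b i * x b) b"
proof (cases "b \<in> elements C")
  case True
  show ?thesis
  proof (cases "step s j b")
    case (Some b')
    have "wt C b i = s * cartan n i j + wt C b' i" using step_wt[OF assms(1) True assms(3,2) Some] by simp
    then have "q powi wt C b i = q powi (s * cartan n i j) * q powi wt C b' i"
      using q_nonzero by (simp add: power_int_add)
    then show ?thesis using True Some by (simp add: shift_def)
  qed (simp add: shift_def)
qed (simp add: shift_def)

lemma shift_commutator:
  assumes "i \<in> {1..n}" "j \<in> {1..n}" "b \<in> elements C"
  shows "shift 1 i (shift (-1) j x) b - shift (-1) j (shift 1 i x) b = (if i = j then of_int (wt C b i) * x b else 0)"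
proof -
  have *: "shift 1 i (shift (-1) j x) b = opt x (Option.bind (ft C i b) (et C j))"
    "shift (-1) j (shift 1 i x) b = opt x (Option.bind (et C j b) (ft C i))"
    using shift_shift[of 1 b i "-1" j x] shift_shift[of "-1" b j 1 i x] assms by auto
  show ?thesis
  proof (cases "i = j")
    case False
    then have "Option.bind (ft C i b) (et C j) = Option.bind (et C j b) (ft C i)"
      using step_commute[of 1 "-1" b i j] assms by simp
    then show ?thesis using * False by simp
  next
    case True
    show ?thesis unfolding * using True bind_ft_et[OF assms(3,1)] wt_small[OF assms(3,1)] by auto
  qed
qed

lemma minuscule_uq_module: "is_uq_module n minuscule_module"
proof -
  let ?M = minuscule_module
  have Kp: "K ?M i (Kinv ?M i x) = x \<and> Kinv ?M i (K ?M i x) = x" for i x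
    using q_nonzero by (auto simp: power_int_minus fun_eq_iff)
  have KK: "K ?M i (K ?M j x) = K ?M j (K ?M i x)" for i j x
    by (auto simp: fun_eq_iff algebra_simps)
  have KE: "K ?M i (E ?M j x) = smul ?M (q powi cartan n i j) (E ?M j (K ?M i x))"
    and KF: "K ?M i (F ?M j x) = smul ?M (q powi (- cartan n i j)) (F ?M j (K ?M i x))"
    if "i \<in> {1..n}" "j \<in> {1..n}" for i j x
    using shift_weight[of 1 i j] shift_weight[of "-1" i j] that by (auto simp: fun_eq_iff)
  have EF: "E ?M i (F ?M j x) - F ?M j (E ?M i x) =
         (if i = j
          then smul ?M (inverse (q_sub n i - inverse (q_sub n i)))
                 ((K ?M i ^^ half_norm n i) x - (Kinv ?M i ^^ half_norm n i) x)
          else 0)" (is "?l = ?r") if "i \<in> {1..n}" "j \<in> {1..n}" "x \<in> vecs ?M" for i j x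
  proof
    fix b
    show "?l b = ?r b"
    proof (cases "b \<in> elements C")
      case True
      have K0: "((K ?M i ^^ h) x) b = (q powi wt C b i) ^ h * x b" for h
        using funpow_scale[where f = "\<lambda>b. q powi wt C b i" and h = h and x = x] by simp
      have K1: "((Kinv ?M i ^^ h) x) b = (q powi (- wt C b i)) ^ h * x b" for h
        using funpow_scale[where f = "\<lambda>b. q powi (- wt C b i)" and h = h and x = x] by simp
      have "?r b = (if i = j then inverse (q_sub n i - inverse (q_sub n i))
          * (((K ?M i ^^ half_norm n i) x) b - ((Kinv ?M i ^^ half_norm n i) x) b) else 0)"
        by (cases "i = j") (simp_all only: if_True if_False simp_thms minuscule_module_simps(2) minus_apply zero_fun_apply)
      also have "\<dots> = (if i = j then (inverse (q_sub n i - inverse (q_sub n i)) * ((q powi wt C b i) ^ half_norm n i - (q powi (- wt C b i)) ^ half_norm n i)) * x b else 0)"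
        unfolding K0 K1 by (simp add: algebra_simps)
      also have "\<dots> = (if i = j then of_int (wt C b i) * x b else 0)"
        using small_quantum_integer[OF wt_small[OF True that(1)], of n i] by (cases "i = j") simp_all
      also have "\<dots> = ?l b" using shift_commutator[OF that(1,2) True] by simp
      finally show ?thesis ..
    next
      case False
      then show ?thesis using that(3) by (simp add: funpow_scale shift_outside)
    qed
  qed
  have S: "(\<Sum>k\<le>m. smul ?M ((- 1) ^ k) (divided_E n ?M i k (E ?M j (divided_E n ?M i (m - k) x)))) = 0 \<and>
       (\<Sum>k\<le>m. smul ?M ((- 1) ^ k) (divided_F n ?M i k (F ?M j (divided_F n ?M i (m - k) x)))) = 0"
    if "i \<in> {1..n}" "j \<in> {1..n}" "i \<noteq> j" "int m = 1 - cartan n i j" for i j m x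
    using serre[OF _ that, of 1 x] serre[OF _ that, of "-1" x] by (simp add: divided_minuscule)
  have V: "vector_space (smul ?M)" using function_vector_space by simp
  have M: "module (smul ?M)" using V by (simp add: vector_space_def module_def)
  have U: "module.subspace (smul ?M) (vecs ?M)"
    unfolding module.subspace_def[OF M] by auto
  have EN: "endomorphism ?M (E ?M i)" "endomorphism ?M (F ?M i)"
    "endomorphism ?M (K ?M i)" "endomorphism ?M (Kinv ?M i)" for i
    using endomorphism_shift endomorphism_scale by auto
  show ?thesis
    unfolding is_uq_module_def
    apply (intro conjI ballI allI impI)
                   apply (rule V)
                  apply (rule U)
                 apply (rule EN)
                apply (rule EN)
               apply (rule EN)
              apply (rule EN)
             apply (rule Kp[THEN conjunct1])
            apply (rule Kp[THEN conjunct2])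
           apply (rule KK)
          apply (rule KE; assumption)
         apply (rule KF; assumption)
        apply (rule EF; assumption)
       apply (rule S[THEN conjunct1]; assumption)
      apply (rule S[THEN conjunct2]; assumption)
    done
qed

definition delta :: "'b \<Rightarrow> 'b \<Rightarrow> qfield" where
  "delta b = (\<lambda>b'. if b' = b then 1 else 0)"

lemma shift_delta:
  assumes "s \<in> {1, -1}" "i \<in> {1..n}" "b \<in> elements C"
  shows "shift s i (delta b) = opt delta (step (-s) i b)"
proof
  fix b'
  have s: "-s \<in> {1, -1}" using assms(1) by auto
  have *: "step (-s) i b = Some b' \<longleftrightarrow> b' \<in> elements C \<and> step s i b' = Some b"
    using step_inverse[OF s assms(3) _ assms(2), of b'] step_Some[OF s assms(3,2), of b'] by auto
  show "shift s i (delta b) b' = opt delta (step (-s) i b) b'"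
    using * by (cases "step (-s) i b"; cases "step s i b'") (auto simp: shift_def delta_def)
qed

text \<open>Going up from \<open>b\<close> reaches \<open>hw\<close>, and going down from \<open>hw\<close> reaches every element.\<close>

lemma minuscule_submodule_all:
  assumes W: "is_submodule n minuscule_module W" and b: "b \<in> elements C" "delta b \<in> W"
  shows "W = vecs minuscule_module"
proof
  interpret vector_space "\<lambda>(c :: qfield) x (b :: 'b). c * x b" by (rule function_vector_space)
  have sub: "subspace W" using W by (simp add: is_submodule_def)
  have stable: "shift s i x \<in> W" if "s \<in> {1, -1}" "i \<in> {1..n}" "x \<in> W" for s i x
    using W that by (auto simp: is_submodule_def)
  have move: "delta b' \<in> W"
    if "s \<in> {1, -1}" "i \<in> {1..n}" "b \<in> elements C" "delta b \<in> W" "step (-s) i b = Some b'" for s i b b'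
  proof -
    have "delta b' = shift s i (delta b)" unfolding shift_delta[OF that(1-3)] that(5) by simp
    then show ?thesis using stable[OF that(1,2,4)] by simp
  qed
  have up: "delta b' \<in> W" if "i \<in> {1..n}" "b \<in> elements C" "et C i b = Some b'" "delta b \<in> W" for i b b'
    by (rule move[of 1 i b]) (use that in simp_all)
  have down: "delta b' \<in> W" if "i \<in> {1..n}" "b \<in> elements C" "ft C i b = Some b'" "delta b \<in> W" for i b b'
    by (rule move[of "-1" i b]) (use that in simp_all)
  have "delta hw \<in> W"
    using b by (rule up_induct[of b "\<lambda>b. delta b \<in> W"]) (rule up)
  then have all: "delta c \<in> W" if "c \<in> elements C" for c
    by (rule down_induct[OF that, of "\<lambda>b. delta b \<in> W"]) (rule down)
  show "vecs minuscule_module \<subseteq> W"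
  proof
    fix x assume x: "x \<in> vecs minuscule_module"
    have "x = (\<Sum>c\<in>elements C. (\<lambda>b. x c * delta c b))"
    proof
      fix c
      have "(\<Sum>c\<in>elements C. (\<lambda>b. x c * delta c b)) c = (\<Sum>d\<in>elements C. x d * delta d c)"
        by (simp add: sum_apply)
      also have "\<dots> = x c" using x finite_elements by (simp add: delta_def if_distrib cong: if_cong)
      finally show "x c = (\<Sum>c\<in>elements C. (\<lambda>b. x c * delta c b)) c" ..
    qed
    also have "\<dots> \<in> W" by (rule subspace_sum[OF sub]) (rule subspace_scale[OF sub all])
    finally show "x \<in> W" .
  qed
  show "W \<subseteq> vecs minuscule_module" using W by (simp add: is_submodule_def)
qed

text \<open>A function with minimal support in the submodule is supported at one point: otherwise \<open>K_i\<close> minus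
  one of two distinct eigenvalues would shrink the support.\<close>

lemma submodule_contains_delta:
  assumes W: "is_submodule n minuscule_module W" and "x \<in> W" "x \<noteq> 0"
  shows "\<exists>b\<in>elements C. delta b \<in> W"
  using assms(2,3)
proof (induction "card {b. x b \<noteq> 0}" arbitrary: x rule: less_induct)
  case less
  interpret vector_space "\<lambda>(c :: qfield) x (b :: 'b). c * x b" by (rule function_vector_space)
  have sub: "subspace W" using W by (simp add: is_submodule_def)
  have out: "x b = 0" if "b \<notin> elements C" for b using W less.prems(1) that by (auto simp: is_submodule_def)
  then have fin: "finite {b. x b \<noteq> 0}" by (intro finite_subset[OF _ finite_elements]) auto
  obtain b where b: "x b \<noteq> 0" using less.prems(2) by (auto simp: fun_eq_iff)
  have bC: "b \<in> elements C" using b out by blast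
  show ?case
  proof (cases "\<exists>b'. b' \<noteq> b \<and> x b' \<noteq> 0")
    case True
    then obtain b' where b': "b' \<noteq> b" "x b' \<noteq> 0" by blast
    then have b'C: "b' \<in> elements C" using out by blast
    then have "wt C b \<noteq> wt C b'" using wt_inj bC b' by (auto simp: inj_on_def)
    then obtain i where i: "i \<in> {1..n}" "wt C b i \<noteq> wt C b' i"
      using weight_lattice_eqI[OF wt_lattice wt_lattice] bC b'C by blast
    \<comment> \<open>This vanishes at \<open>b\<close> but not at \<open>b'\<close>.\<close>
    define y where "y = (\<lambda>c. q powi wt C c i * x c) - (\<lambda>c. q powi wt C b i * x c)"
    have "y \<in> W" unfolding y_def
      using W less.prems(1) i(1) by (intro subspace_diff[OF sub] subspace_scale[OF sub]) (auto simp: is_submodule_def)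
    moreover have yb': "y b' \<noteq> 0" using i(2) b'(2) by (auto simp: y_def q_powi_inject)
    moreover have "card {c. y c \<noteq> 0} < card {c. x c \<noteq> 0}"
    proof (rule psubset_card_mono[OF fin])
      have "y b = 0" by (simp add: y_def)
      then show "{c. y c \<noteq> 0} \<subset> {c. x c \<noteq> 0}" using b by (auto simp: y_def)
    qed
    moreover have "y \<noteq> 0" using yb' by (metis zero_fun_apply)
    ultimately show ?thesis using less.hyps[of y] by blast
  next
    case False
    then have "x c = 0" if "c \<noteq> b" for c using that by blast
    then have "(\<lambda>c. inverse (x b) * x c) = delta b" using b by (auto simp: fun_eq_iff delta_def)
    then have "delta b \<in> W" using subspace_scale[OF sub less.prems(1), of "inverse (x b)"] by simp
    then show ?thesis using bC by blast
  qed
qed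

lemma minuscule_module_is_V: "is_V n (wt C hw) minuscule_module"
proof -
  have hw: "delta hw \<in> vecs minuscule_module" "delta hw \<noteq> 0"
    using hw_element by (auto simp: delta_def fun_eq_iff)
  have "is_irreducible n minuscule_module"
    unfolding is_irreducible_def
  proof (intro conjI allI impI)
    show "vecs minuscule_module \<noteq> {0}" using hw by blast
    fix W assume W: "is_submodule n minuscule_module W"
    interpret vector_space "\<lambda>(c :: qfield) x (b :: 'b). c * x b" by (rule function_vector_space)
    have "0 \<in> W" using W subspace_0 by (simp add: is_submodule_def)
    then show "W = {0} \<or> W = vecs minuscule_module"
      using submodule_contains_delta[OF W] minuscule_submodule_all[OF W] by blast
  qed
  moreover have "has_highest_weight n minuscule_module (wt C hw)"
    unfolding has_highest_weight_def
  proof (intro bexI conjI ballI allI impI)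
    show "delta hw \<noteq> 0" by (rule hw)
    show "E minuscule_module i (delta hw) = 0" if "i \<in> {1..n}" for i
      using shift_delta[OF _ that hw_element, of 1] et_hw[OF that] by simp
    show "delta hw \<in> weight_space n minuscule_module (wt C hw)"
      using hw by (auto simp: weight_space_def delta_def fun_eq_iff)
    show "W = vecs minuscule_module" if "is_submodule n minuscule_module W \<and> delta hw \<in> W" for W
      using minuscule_submodule_all hw_element that by blast
  qed
  ultimately show ?thesis using minuscule_uq_module by (simp add: is_V_def)
qed

end

section \<open>Weight bases of minuscule modules\<close>

text \<open>That the vectors span and do not vanish is enough for a basis, because their weights are distinct.\<close>

locale minuscule_basis = quantum_module n M + minuscule_crystal n C hw
  for n and M :: "'v::ab_group_add uq_module" and C :: "'b crystal" and hw :: 'b +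
  fixes w :: "'b \<Rightarrow> 'v"
  assumes w_weight: "b \<in> elements C \<Longrightarrow> w b \<in> wspace (wt C b)"
    and w_nonzero: "b \<in> elements C \<Longrightarrow> w b \<noteq> 0"
    and w_E: "b \<in> elements C \<Longrightarrow> i \<in> {1..n} \<Longrightarrow> E M i (w b) = opt w (et C i b)"
    and w_F: "b \<in> elements C \<Longrightarrow> i \<in> {1..n} \<Longrightarrow> F M i (w b) = opt w (ft C i b)"
    and w_span: "vecs M \<subseteq> vs.span (w ` elements C)"

text \<open>The vectors are constructed by going down from the highest weight vector along arbitrary
  paths. That the result does not depend on the path is proved by induction on the depth, where
  the difference of two candidates is a singular vector of the wrong weight.\<close>

locale minuscule_V = quantum_module n M + minuscule_crystal n C hw
  for n and M :: "'v::ab_group_add uq_module" and C :: "'b crystal" and hw :: 'b +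
  fixes v :: 'v
  assumes irreducible: "is_irreducible n M"
    and v_weight: "v \<in> wspace (wt C hw)" and v_nonzero: "v \<noteq> 0"
    and v_singular: "i \<in> {1..n} \<Longrightarrow> E M i v = 0"
begin

lemma singular_vanishes:
  assumes "x \<in> wspace mu" "mu \<in> weight_lattice n" "mu \<noteq> wt C hw" "\<And>i. i \<in> {1..n} \<Longrightarrow> E M i x = 0"
  shows "x = 0"
  using singular_weight[OF irreducible v_weight v_nonzero v_singular wt_lattice[OF hw_element] assms(1) _ assms(4,2)] assms(3) by blast

text \<open>Any choice of a final step on a path from \<open>hw\<close> to \<open>b\<close> will do.\<close>

definition last_step :: "'b \<Rightarrow> nat" where
  "last_step b = (SOME i. i \<in> {1..n} \<and> et C i b \<noteq> None)"

lemma last_step: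
  assumes "b \<in> elements C" "b \<noteq> hw"
  obtains b' where "last_step b \<in> {1..n}" "et C (last_step b) b = Some b'"
proof -
  have "\<exists>i. i \<in> {1..n} \<and> et C i b \<noteq> None" using parent[OF assms] by (metis option.distinct(1))
  from someI_ex[OF this] show ?thesis using that unfolding last_step_def by auto
qed

text \<open>The vector obtained by descending to \<open>b\<close> along the chosen path; the first argument is the depth of \<open>b\<close>,
  on which the recursion runs.\<close>

primrec level :: "nat \<Rightarrow> 'b \<Rightarrow> 'v" where
  "level 0 b = v"
| "level (Suc d) b = F M (last_step b) (level d (the (et C (last_step b) b)))"

definition basis :: "'b \<Rightarrow> 'v" where
  "basis b = level (depth b) b"

lemma basis_hw: "basis hw = v"
  by (simp add: basis_def depth_hw)

lemma basis_step:
  assumes "b \<in> elements C" "last_step b \<in> {1..n}" "et C (last_step b) b = Some b'"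
  shows "basis b = F M (last_step b) (basis b')"
  using assms depth_et by (simp add: basis_def)

lemma basis_weight: "b \<in> elements C \<Longrightarrow> basis b \<in> wspace (wt C b)"
proof (induction "depth b" arbitrary: b rule: less_induct)
  case less
  show ?case
  proof (cases "b = hw")
    case True
    then show ?thesis using v_weight by (simp add: basis_hw)
  next
    case False
    then obtain b' where b': "last_step b \<in> {1..n}" "et C (last_step b) b = Some b'"
      using last_step less.prems by blast
    have b'C: "b' \<in> elements C" "ft C (last_step b) b' = Some b" using et_ft less.prems b' by auto
    have "basis b' \<in> wspace (wt C b')" using less.hyps b'C(1) depth_et[OF less.prems b'] by simp
    then have "basis b \<in> wspace (wt C b' - simple_root n (last_step b))"
      unfolding basis_step[OF less.prems b'] by (rule wspace_F[OF _ b'(1)])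
    then show ?thesis using ft_Some[OF b'C(1) b'(1) b'C(2)] by simp
  qed
qed

lemma basis_commutator:
  assumes "b \<in> elements C" "i \<in> {1..n}" "j \<in> {1..n}"
  shows "E M i (F M j (basis b)) = F M j (E M i (basis b)) + (if i = j then smul M (of_int (wt C b i)) (basis b) else 0)"
  by (rule commutator_small[OF basis_weight[OF assms(1)] assms(2,3)]) (rule wt_small[OF assms(1,2)])

text \<open>The commutation relation in the crystal, transferred to the vectors. It presupposes the action of
  the \<open>e_i\<close> at \<open>b\<close> and of the \<open>f_j\<close> one level higher up.\<close>

lemma basis_EF_induct:
  assumes b: "b \<in> elements C"
    and E: "\<And>i. i \<in> {1..n} \<Longrightarrow> E M i (basis b) = opt basis (et C i b)"
    and F: "\<And>i j b'. i \<in> {1..n} \<Longrightarrow> j \<in> {1..n} \<Longrightarrow> et C i b = Some b' \<Longrightarrow> F M j (basis b') = opt basis (ft C j b')"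
    and ij: "i \<in> {1..n}" "j \<in> {1..n}"
  shows "E M i (F M j (basis b)) = opt basis (Option.bind (ft C j b) (et C i))"
proof -
  have FE: "F M j (E M i (basis b)) = opt basis (Option.bind (et C i b) (ft C j))"
    using E[OF ij(1)] F[OF ij] endo_0[OF endomorphisms(2)[OF ij(2)]] by (cases "et C i b") auto
  show ?thesis
  proof (cases "i = j")
    case False
    have "Option.bind (et C i b) (ft C j) = Option.bind (ft C j b) (et C i)"
      using step_commute[of "-1" 1 b i j] b ij False by simp
    then show ?thesis using FE basis_commutator[OF b ij] False by simp
  next
    case True
    show ?thesis using True FE bind_ft_et[OF b ij(1)] basis_commutator[OF b ij] wt_small[OF b ij(1)] by auto
  qed
qed

text \<open>By induction on \<open>d\<close>, the action of \<open>e_i\<close> is known up to depth \<open>d\<close> and that of \<open>f_i\<close> below depth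
  \<open>d\<close>. In the induction step, \<open>e_i\<close> at depth \<open>d + 1\<close> follows from the commutation relation; then
  the vectors \<open>f_i (basis b)\<close> and \<open>basis (f_i b)\<close> have the same images under all \<open>e_j\<close>, so their
  difference is singular and vanishes, being of a weight below the highest one.\<close>

lemma basis_E_F:
  assumes "b \<in> elements C" "i \<in> {1..n}"
  shows "E M i (basis b) = opt basis (et C i b)" "F M i (basis b) = opt basis (ft C i b)"
proof -
  have "(\<forall>b i. b \<in> elements C \<longrightarrow> depth b \<le> d \<longrightarrow> i \<in> {1..n} \<longrightarrow> E M i (basis b) = opt basis (et C i b)) \<and>
    (\<forall>b i. b \<in> elements C \<longrightarrow> depth b < d \<longrightarrow> i \<in> {1..n} \<longrightarrow> F M i (basis b) = opt basis (ft C i b))" for d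
  proof (induction d)
    case 0
    have "b = hw" if "b \<in> elements C" "depth b = 0" for b
      using parent[OF that(1)] that(2) by (metis nat.distinct(1))
    then have "E M i (basis b) = opt basis (et C i b)" if "b \<in> elements C" "depth b = 0" "i \<in> {1..n}" for b i
      using basis_hw et_hw v_singular that by (metis opt_simps(1))
    then show ?case by simp
  next
    case (Suc d)
    have E: "E M i (basis b) = opt basis (et C i b)" if "b \<in> elements C" "depth b \<le> d" "i \<in> {1..n}" for b i
      using Suc that by blast
    have F: "F M i (basis b) = opt basis (ft C i b)" if "b \<in> elements C" "depth b < d" "i \<in> {1..n}" for b i
      using Suc that by blast
    have EF: "E M i (F M j (basis b)) = opt basis (Option.bind (ft C j b) (et C i))"
      if b: "b \<in> elements C" "depth b \<le> d" and ij: "i \<in> {1..n}" "j \<in> {1..n}" for i j b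
    proof (rule basis_EF_induct[OF b(1) E[OF b] _ ij])
      fix k l b' assume k: "k \<in> {1..n}" "l \<in> {1..n}" "et C k b = Some b'"
      show "F M l (basis b') = opt basis (ft C l b')"
        by (rule F) (use et_ft[OF b(1) k(1,3)] depth_et[OF b(1) k(1,3)] b k in auto)
    qed
    have E': "E M i (basis b) = opt basis (et C i b)"
      if b: "b \<in> elements C" "depth b \<le> Suc d" and i: "i \<in> {1..n}" for b i
    proof (cases "b = hw")
      case True
      then show ?thesis using basis_hw et_hw v_singular i by simp
    next
      case False
      then obtain b' where b': "last_step b \<in> {1..n}" "et C (last_step b) b = Some b'"
        using last_step b by blast
      have b'C: "b' \<in> elements C" "ft C (last_step b) b' = Some b" using et_ft b b' by auto
      have "depth b' \<le> d" using depth_et[OF b(1) b'] b by simp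
      from EF[OF b'C(1) this i b'(1)] show ?thesis
        unfolding basis_step[OF b(1) b'] using b'C(2) by simp
    qed
    have F': "F M i (basis b) = opt basis (ft C i b)"
      if b: "b \<in> elements C" "depth b \<le> d" and i: "i \<in> {1..n}" for b i
    proof -
      define x where "x = F M i (basis b) - opt basis (ft C i b)"
      have w1: "F M i (basis b) \<in> wspace (wt C b - simple_root n i)"
        by (rule wspace_F[OF basis_weight[OF b(1)] i])
      have w2: "opt basis (ft C i b) \<in> wspace (wt C b - simple_root n i)"
      proof (cases "ft C i b")
        case (Some b')
        then show ?thesis using ft_Some[OF b(1) i Some] basis_weight[of b'] by simp
      qed (simp add: wspace_closed(1))
      have w: "x \<in> wspace (wt C b - simple_root n i)" unfolding x_def by (rule wspace_closed(3)[OF w1 w2])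
      have "E M j x = 0" if j: "j \<in> {1..n}" for j
      proof -
        have "E M j (opt basis (ft C i b)) = opt basis (Option.bind (ft C i b) (et C j))"
        proof (cases "ft C i b")
          case None
          then show ?thesis using endo_0[OF endomorphisms(1)[OF j]] by simp
        next
          case (Some b')
          have "b' \<in> elements C" "depth b' \<le> Suc d"
            using ft_et[OF b(1) i Some] depth_ft[OF b(1) i Some] b by auto
          then show ?thesis using E' j Some by simp
        qed
        then show ?thesis unfolding x_def
          using endo_diff[OF endomorphisms(1)[OF j]] w1 w2 wspace_vecs EF[OF b j i] by simp
      qed
      moreover have "wt C b - simple_root n i \<noteq> wt C hw"
      proof
        assume "wt C b - simple_root n i = wt C hw"
        then have "height n (wt C b) - 2 = height n (wt C hw)"
          using height_diff[of n "wt C b" "simple_root n i"] height_simple_root[OF i] by simp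
        then show False using height_hw[OF b(1)] by simp
      qed
      ultimately have "x = 0"
        using singular_vanishes[OF w] weight_lattice_diff[OF wt_lattice[OF b(1)] simple_root_lattice] by blast
      then show ?thesis by (simp add: x_def)
    qed
    show ?case using E' F' by (simp only: less_Suc_eq_le) blast
  qed
  from this[of "Suc (depth b)"]
  show "E M i (basis b) = opt basis (et C i b)" "F M i (basis b) = opt basis (ft C i b)"
    using assms by auto
qed

lemma basis_nonzero: "b \<in> elements C \<Longrightarrow> basis b \<noteq> 0"
proof (induction rule: down_induct)
  case hw
  then show ?case using v_nonzero by (simp add: basis_hw)
next
  case (ft i b b')
  have "E M i (basis b') = basis b"
    using basis_E_F(1)[OF ft(3,1)] ft_et(2)[OF ft(2,1,4)] by simp
  then show ?case using ft(5) endo_0[OF endomorphisms(1)[OF ft(1)]] by auto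
qed

lemma basis_spans: "vecs M \<subseteq> vs.span (basis ` elements C)"
proof -
  have sub: "basis ` elements C \<subseteq> vecs M" using basis_weight wspace_vecs by auto
  have b: "opt basis y \<in> vs.span (basis ` elements C)" if "\<And>b. y = Some b \<Longrightarrow> b \<in> elements C" for y
    using that vs.span_zero vs.span_base by (cases y) auto
  have "is_submodule n M (vs.span (basis ` elements C))"
    unfolding is_submodule_def
  proof (intro conjI ballI)
    fix i u assume i: "i \<in> {1..n}" and u: "u \<in> vs.span (basis ` elements C)"
    show "E M i u \<in> vs.span (basis ` elements C)"
      by (rule endo_span[OF endomorphisms(1)[OF i] sub _ u]) (use basis_E_F(1) et_Some i b in auto)
    show "F M i u \<in> vs.span (basis ` elements C)"
      by (rule endo_span[OF endomorphisms(2)[OF i] sub _ u]) (use basis_E_F(2) ft_Some i b in auto)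
    show "K M i u \<in> vs.span (basis ` elements C)"
      by (rule endo_span[OF endomorphisms(3)[OF i] sub _ u])
        (use wspace_K[OF basis_weight i] vs.span_scale vs.span_base in auto)
    show "Kinv M i u \<in> vs.span (basis ` elements C)"
      by (rule endo_span[OF endomorphisms(4)[OF i] sub _ u])
        (use wspace_Kinv[OF basis_weight i] vs.span_scale vs.span_base in auto)
  qed (use span_vecs[OF sub] in auto)
  moreover have "vs.span (basis ` elements C) \<noteq> {0}"
    using vs.span_base[of v "basis ` elements C"] hw_element basis_hw v_nonzero by (metis image_eqI singletonD)
  ultimately show ?thesis using irreducible unfolding is_irreducible_def by blast
qed

sublocale minuscule_basis n M C hw basis
  by unfold_locales (use basis_weight basis_nonzero basis_E_F basis_spans in auto)

end

section \<open>Residues of a lattice\<close>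

context quantum_module begin

text \<open>Submodules over the local ring; closure under subtraction follows as \<open>-1\<close> is regular.\<close>

definition regular_submodule :: "'v set \<Rightarrow> bool" where
  "regular_submodule L \<longleftrightarrow> L \<subseteq> vecs M \<and> 0 \<in> L \<and> (\<forall>u\<in>L. \<forall>v\<in>L. u + v \<in> L) \<and>
    (\<forall>c\<in>regular_at_0. \<forall>u\<in>L. smul M c u \<in> L)"

lemma regular_submodule_closed:
  assumes "regular_submodule L"
  shows "L \<subseteq> vecs M" "0 \<in> L" "u \<in> L \<Longrightarrow> v \<in> L \<Longrightarrow> u + v \<in> L"
    "c \<in> regular_at_0 \<Longrightarrow> u \<in> L \<Longrightarrow> smul M c u \<in> L" "u \<in> L \<Longrightarrow> v \<in> L \<Longrightarrow> u - v \<in> L"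
    "(\<And>x. x \<in> A \<Longrightarrow> f x \<in> L) \<Longrightarrow> (\<Sum>x\<in>A. f x) \<in> L"
proof -
  show 1: "L \<subseteq> vecs M" "0 \<in> L" "\<And>u v. u \<in> L \<Longrightarrow> v \<in> L \<Longrightarrow> u + v \<in> L"
    "\<And>u c. c \<in> regular_at_0 \<Longrightarrow> u \<in> L \<Longrightarrow> smul M c u \<in> L"
    using assms by (auto simp: regular_submodule_def)
  show "u \<in> L \<Longrightarrow> v \<in> L \<Longrightarrow> u - v \<in> L"
    using 1(3)[of u "smul M (-1) v"] 1(4)[OF regular_uminus[OF regular_1], of v] by simp
  show "(\<And>x. x \<in> A \<Longrightarrow> f x \<in> L) \<Longrightarrow> (\<Sum>x\<in>A. f x) \<in> L"
    by (induction A rule: infinite_finite_induct) (use 1 in auto)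
qed

lemma residue_eq_iff:
  assumes L: "regular_submodule L"
  shows "residue M L u = residue M L v \<longleftrightarrow> (\<exists>w\<in>L. u = v + smul M q w)"
proof
  assume "residue M L u = residue M L v"
  moreover have "u \<in> residue M L u"
    using regular_submodule_closed(2)[OF L] by (force simp: residue_def)
  ultimately show "\<exists>w\<in>L. u = v + smul M q w" by (auto simp: residue_def)
next
  assume "\<exists>w\<in>L. u = v + smul M q w"
  then obtain w where w: "w \<in> L" "u = v + smul M q w" by blast
  have "u + smul M q x = v + smul M q (w + x)" "v + smul M q x = u + smul M q (x - w)" for x
    using w by (auto simp: vs.scale_right_distrib vs.scale_right_diff_distrib)
  then show "residue M L u = residue M L v"
    using regular_submodule_closed(3,5)[OF L] w(1) unfolding residue_def by blast
qed

lemma residue_0_iff: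
  assumes L: "regular_submodule L"
  shows "residue M L u = residue M L 0 \<longleftrightarrow> (\<exists>w\<in>L. u = smul M q w)"
  by (simp add: residue_eq_iff[OF L])

lemma residue_self: "regular_submodule L \<Longrightarrow> u \<in> residue M L u"
  using regular_submodule_closed(2) by (force simp: residue_def)

lemma residue_mem:
  assumes "regular_submodule L" "x \<in> residue M L u"
  shows "residue M L x = residue M L u"
  using assms residue_eq_iff by (auto simp: residue_def)

lemma induced_residue:
  assumes L: "regular_submodule L" and T: "\<And>x. x \<in> L \<Longrightarrow> T x = T' x" "endomorphism M T'" "\<And>x. x \<in> L \<Longrightarrow> T x \<in> L"
    and u: "u \<in> L"
  shows "induced M L T (residue M L u) = residue M L (T u)"
proof -
  have "residue M L (T x) = residue M L (T u)" if "x \<in> residue M L u" for x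
  proof -
    obtain w where w: "w \<in> L" "x = u + smul M q w" using \<open>x \<in> residue M L u\<close> by (auto simp: residue_def)
    have qw: "smul M q w \<in> L" using regular_submodule_closed(4)[OF L q_regular] w by auto
    have xL: "x \<in> L" using w qw regular_submodule_closed(3)[OF L u] by auto
    have "u \<in> vecs M" "w \<in> vecs M" "smul M q w \<in> vecs M"
      using regular_submodule_closed(1)[OF L] u w(1) qw by auto
    then have "T x = T u + smul M q (T w)"
      using w(2) endo_add[OF T(2)] endo_smul[OF T(2)] T(1)[OF xL] T(1)[OF u] T(1)[OF w(1)] by simp
    then show ?thesis using residue_eq_iff[OF L] T(3)[OF w(1)] by blast
  qed
  then show ?thesis using residue_self[OF L, of u] unfolding induced_def by blast
qed

lemma lattice_regular_submodule:
  assumes "is_lattice M L"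
  shows "regular_submodule L"
proof -
  obtain X where X: "X \<subseteq> vecs M" and L: "L = {\<Sum>x\<in>T. smul M (c x) x | T c.
              finite T \<and> T \<subseteq> X \<and> (\<forall>x\<in>T. c x \<in> regular_at_0)}"
    using assms unfolding is_lattice_def by blast
  have intro: "(\<Sum>x\<in>T. smul M (c x) x) \<in> L" if "finite T" "T \<subseteq> X" "\<forall>x\<in>T. c x \<in> regular_at_0" for T c
    unfolding L using that by blast
  show ?thesis unfolding regular_submodule_def
  proof (intro conjI ballI subsetI)
    fix u assume "u \<in> L" then show "u \<in> vecs M" unfolding L using X by (auto intro!: vecs_sum)
  next
    show "0 \<in> L" using intro[of "{}"] by simp
  next
    fix u v assume "u \<in> L" "v \<in> L"
    then obtain T c T' c' where *: "finite T" "T \<subseteq> X" "\<forall>x\<in>T. c x \<in> regular_at_0" "u = (\<Sum>x\<in>T. smul M (c x) x)"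
      "finite T'" "T' \<subseteq> X" "\<forall>x\<in>T'. c' x \<in> regular_at_0" "v = (\<Sum>x\<in>T'. smul M (c' x) x)"
      unfolding L by blast
    define d where "d x = (if x \<in> T then c x else 0)" for x
    define d' where "d' x = (if x \<in> T' then c' x else 0)" for x
    have "u = (\<Sum>x\<in>T\<union>T'. smul M (d x) x)" unfolding *(4)
      by (rule sum.mono_neutral_cong_left) (use * in \<open>auto simp: d_def\<close>)
    moreover have "v = (\<Sum>x\<in>T\<union>T'. smul M (d' x) x)" unfolding *(8)
      by (rule sum.mono_neutral_cong_left) (use * in \<open>auto simp: d'_def\<close>)
    ultimately have "u + v = (\<Sum>x\<in>T\<union>T'. smul M (d x + d' x) x)"
      by (simp add: vs.scale_left_distrib sum.distrib)
    also have "\<dots> \<in> L" by (rule intro) (use * regular_0 in \<open>auto simp: d_def d'_def intro!: regular_add\<close>)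
    finally show "u + v \<in> L" .
  next
    fix e u assume e: "e \<in> regular_at_0" and "u \<in> L"
    then obtain T c where *: "finite T" "T \<subseteq> X" "\<forall>x\<in>T. c x \<in> regular_at_0" "u = (\<Sum>x\<in>T. smul M (c x) x)"
      unfolding L by blast
    then have "smul M e u = (\<Sum>x\<in>T. smul M (e * c x) x)" by (simp add: vs.scale_sum_right)
    also have "\<dots> \<in> L" by (rule intro) (use * e regular_mult in auto)
    finally show "smul M e u \<in> L" .
  qed
qed

text \<open>If a member \<open>x\<close> of a free basis were \<open>q\<close> times a member of the lattice, comparing the coefficients
  of \<open>x\<close> would make \<open>q\<close> invertible in the local ring.\<close>

lemma lattice_not_q_divisible:
  assumes "is_lattice M L" "vecs M \<noteq> {0}"
  shows "\<exists>x\<in>L. \<forall>y\<in>L. x \<noteq> smul M q y"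
proof -
  obtain X where X: "X \<subseteq> vecs M" and L: "L = {\<Sum>x\<in>T. smul M (c x) x | T c.
              finite T \<and> T \<subseteq> X \<and> (\<forall>x\<in>T. c x \<in> regular_at_0)}"
    and free: "\<And>T c. finite T \<and> T \<subseteq> X \<and> (\<forall>x\<in>T. c x \<in> regular_at_0) \<and> (\<Sum>x\<in>T. smul M (c x) x) = 0
          \<longrightarrow> (\<forall>x\<in>T. c x = 0)"
    and span: "vs.span L = vecs M"
    using assms(1) unfolding is_lattice_def by blast
  have "X \<noteq> {}"
  proof
    assume "X = {}"
    then have "L = {0}" unfolding L by auto
    then show False using span assms(2) by simp
  qed
  then obtain x where x: "x \<in> X" by blast
  have xL: "x \<in> L" unfolding L by (rule CollectI, rule exI[of _ "{x}"], rule exI[of _ "\<lambda>_. 1"]) (use x regular_1 in auto)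
  have "x \<noteq> smul M q y" if "y \<in> L" for y
  proof
    assume xy: "x = smul M q y"
    obtain T c where T: "finite T" "T \<subseteq> X" "\<forall>t\<in>T. c t \<in> regular_at_0" "y = (\<Sum>t\<in>T. smul M (c t) t)"
      using \<open>y \<in> L\<close> unfolding L by blast
    \<comment> \<open>The coefficients of \<open>q * y - x\<close>, which is zero.\<close>
    define d where "d t = (if t \<in> T then q * c t else 0) - (if t = x then 1 else 0)" for t
    have "(\<Sum>t\<in>insert x T. smul M (d t) t) = (\<Sum>t\<in>insert x T. smul M (if t \<in> T then q * c t else 0) t) - (\<Sum>t\<in>insert x T. smul M (if t = x then 1 else 0) t)"
      by (simp only: d_def vs.scale_left_diff_distrib sum_subtractf)
    also have "(\<Sum>t\<in>insert x T. smul M (if t \<in> T then q * c t else 0) t) = (\<Sum>t\<in>T. smul M (q * c t) t)"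
      by (rule sum.mono_neutral_cong_right) (use T in auto)
    also have "\<dots> = smul M q y" by (simp add: T(4) vs.scale_sum_right)
    also have "(\<Sum>t\<in>insert x T. smul M (if t = x then 1 else 0) t) = (\<Sum>t\<in>{x}. smul M 1 t)"
      by (rule sum.mono_neutral_cong_right) (use T in auto)
    finally have "(\<Sum>t\<in>insert x T. smul M (d t) t) = 0" using xy by simp
    moreover have "d t \<in> regular_at_0" for t
      using T(3) regular_0 regular_1 regular_mult[OF q_regular] regular_add[OF _ regular_uminus] unfolding d_def
      by (auto simp: diff_conv_add_uminus simp del: add_uminus_conv_diff)
    ultimately have "d x = 0" using free[of "insert x T" d] T x by blast
    then have "(if x \<in> T then q * c x else 0) = 1" by (simp add: d_def)
    then have "x \<in> T" "q * c x = rat_const 1" by (auto split: if_splits)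
    then show False using rat_const_eq_q_times[of "c x" 1] T(3) by simp
  qed
  then show ?thesis using xL by blast
qed

end

section \<open>Crystal isomorphisms\<close>

lemma crystal_iso_is_crystal:
  assumes C: "is_crystal n C" and iso: "crystal_iso n C D \<psi>"
  shows "is_crystal n D"
proof -
  have bij: "bij_betw \<psi> (elements C) (elements D)"
    and wt: "\<And>b. b \<in> elements C \<Longrightarrow> wt D (\<psi> b) = wt C b"
    and et: "\<And>i b. i \<in> {1..n} \<Longrightarrow> b \<in> elements C \<Longrightarrow> et D i (\<psi> b) = map_option \<psi> (et C i b)"
    and ft: "\<And>i b. i \<in> {1..n} \<Longrightarrow> b \<in> elements C \<Longrightarrow> ft D i (\<psi> b) = map_option \<psi> (ft C i b)"
    and ep: "\<And>i b. i \<in> {1..n} \<Longrightarrow> b \<in> elements C \<Longrightarrow> eps D i (\<psi> b) = eps C i b \<and> phi D i (\<psi> b) = phi C i b"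
    using iso unfolding crystal_iso_def by auto
  have D: "elements D = \<psi> ` elements C" using bij by (simp add: bij_betw_def)
  have inj: "\<psi> b = \<psi> c \<longleftrightarrow> b = c" if "b \<in> elements C" "c \<in> elements C" for b c
    using bij that by (auto simp: bij_betw_def inj_on_def)
  have c1: "wt C b \<in> weight_lattice n" if "b \<in> elements C" for b
    using C that unfolding is_crystal_def by blast
  have c2: "phi C i b = eps C i b + wt C b i" if "i \<in> {1..n}" "b \<in> elements C" for i b
    using C that unfolding is_crystal_def by blast
  have c3: "b' \<in> elements C \<and> wt C b' = wt C b + simple_root n i \<and>
          eps C i b' = eps C i b - 1 \<and> phi C i b' = phi C i b + 1"
    if "i \<in> {1..n}" "b \<in> elements C" "et C i b = Some b'" for i b b'
    using C that unfolding is_crystal_def by blast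
  have c4: "b' \<in> elements C \<and> wt C b' = wt C b - simple_root n i \<and>
          eps C i b' = eps C i b + 1 \<and> phi C i b' = phi C i b - 1"
    if "i \<in> {1..n}" "b \<in> elements C" "ft C i b = Some b'" for i b b'
    using C that unfolding is_crystal_def by blast
  have c5: "ft C i b = Some b' \<longleftrightarrow> et C i b' = Some b" if "i \<in> {1..n}" "b \<in> elements C" "b' \<in> elements C" for i b b'
    using C that unfolding is_crystal_def by blast
  have d3: "b' \<in> \<psi> ` elements C \<and> wt D b' = wt D (\<psi> b) + simple_root n i \<and>
        eps D i b' = eps D i (\<psi> b) - 1 \<and> phi D i b' = phi D i (\<psi> b) + 1"
    if i: "i \<in> {1..n}" and b: "b \<in> elements C" and e: "et D i (\<psi> b) = Some b'" for i b b'
  proof -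
    obtain c where c: "et C i b = Some c" "b' = \<psi> c" using e et[OF i b] by auto
    then show ?thesis using c3[OF i b c(1)] wt b ep[OF i] by auto
  qed
  have d4: "b' \<in> \<psi> ` elements C \<and> wt D b' = wt D (\<psi> b) - simple_root n i \<and>
        eps D i b' = eps D i (\<psi> b) + 1 \<and> phi D i b' = phi D i (\<psi> b) - 1"
    if i: "i \<in> {1..n}" and b: "b \<in> elements C" and e: "ft D i (\<psi> b) = Some b'" for i b b'
  proof -
    obtain c where c: "ft C i b = Some c" "b' = \<psi> c" using e ft[OF i b] by auto
    then show ?thesis using c4[OF i b c(1)] wt b ep[OF i] by auto
  qed
  have d5: "(ft D i (\<psi> b) = Some (\<psi> c)) = (et D i (\<psi> c) = Some (\<psi> b))"
    if i: "i \<in> {1..n}" and b: "b \<in> elements C" and c: "c \<in> elements C" for i b c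
  proof -
    have "ft D i (\<psi> b) = Some (\<psi> c) \<longleftrightarrow> ft C i b = Some c"
      using ft[OF i b] c4[OF i b] inj c by (cases "ft C i b") auto
    moreover have "et D i (\<psi> c) = Some (\<psi> b) \<longleftrightarrow> et C i c = Some b"
      using et[OF i c] c3[OF i c] inj b by (cases "et C i c") auto
    ultimately show ?thesis using c5[OF i b c] by simp
  qed
  have d1: "wt D (\<psi> b) \<in> weight_lattice n" if "b \<in> elements C" for b using wt c1 that by simp
  have d2: "phi D i (\<psi> b) = eps D i (\<psi> b) + wt D (\<psi> b) i" if "i \<in> {1..n}" "b \<in> elements C" for i b
    using wt c2 that ep by simp
  show ?thesis
    unfolding is_crystal_def D ball_simps(9)
    using d1 d2 d3 d4 d5 by blast
qed

context minuscule_basis begin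

lemma w_vecs: "b \<in> elements C \<Longrightarrow> w b \<in> vecs M"
  using w_weight wspace_vecs by blast

definition comb :: "('b \<Rightarrow> qfield) \<Rightarrow> 'v" where
  "comb c = (\<Sum>b\<in>elements C. smul M (c b) (w b))"

lemma comb_vecs: "comb c \<in> vecs M"
  unfolding comb_def by (intro vecs_sum vecs_closed w_vecs)

lemma comb_add: "comb c + comb d = comb (\<lambda>b. c b + d b)"
  and comb_diff: "comb c - comb d = comb (\<lambda>b. c b - d b)"
  and comb_smul: "smul M a (comb c) = comb (\<lambda>b. a * c b)"
  by (simp_all add: comb_def vs.scale_left_distrib vs.scale_left_diff_distrib sum.distrib sum_subtractf vs.scale_sum_right)

lemma comb_0: "comb (\<lambda>b. 0) = 0" by (simp add: comb_def)

lemma comb_single: "b \<in> elements C \<Longrightarrow> comb (\<lambda>b'. if b' = b then a else 0) = smul M a (w b)"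
proof -
  assume b: "b \<in> elements C"
  have "comb (\<lambda>b'. if b' = b then a else 0) = (\<Sum>b'\<in>{b}. smul M a (w b'))"
    unfolding comb_def by (rule sum.mono_neutral_cong_right) (use b finite_elements in auto)
  then show ?thesis by simp
qed

lemma comb_exists: "u \<in> vecs M \<Longrightarrow> \<exists>c. u = comb c"
proof -
  assume "u \<in> vecs M"
  then have "u \<in> vs.span (w ` elements C)" using w_span by blast
  then show ?thesis
  proof (induction rule: vs.span_induct_alt)
    case base
    show ?case by (rule exI[of _ "\<lambda>_. 0"]) (simp add: comb_0)
  next
    case (step a x y)
    then obtain b c where "b \<in> elements C" "x = w b" "y = comb c" by blast
    then have "smul M a x + y = comb (\<lambda>b'. (if b' = b then a else 0) + c b')"
      by (simp only: comb_single[symmetric] comb_add)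
    then show ?case by blast
  qed
qed

lemma comb_eq_0: "comb c = 0 \<Longrightarrow> b \<in> elements C \<Longrightarrow> c b = 0"
proof -
  assume c: "comb c = 0" "b \<in> elements C"
  have "smul M (c b) (w b) = 0"
    by (rule weight_vectors_independent[OF finite_elements wt_inj, of "\<lambda>b. smul M (c b) (w b)"])
      (use c w_weight wt_lattice wspace_closed(4) in \<open>auto simp: comb_def\<close>)
  then show "c b = 0" using w_nonzero[OF c(2)] by simp
qed

lemma comb_eq: "comb c = comb d \<Longrightarrow> b \<in> elements C \<Longrightarrow> c b = d b"
  using comb_eq_0[of "\<lambda>b. c b - d b" b] comb_diff[of c d] by simp

text \<open>Comparing the coefficients of \<open>w b\<close> in the eigenvalue equations of all \<open>K_i\<close>.\<close>

lemma comb_weight: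
  assumes "comb c \<in> wspace mu" "b \<in> elements C" "c b \<noteq> 0" "mu \<in> weight_lattice n"
  shows "mu = wt C b"
proof (rule weight_lattice_eqI[OF assms(4) wt_lattice[OF assms(2)]])
  fix i assume i: "i \<in> {1..n}"
  have "comb (\<lambda>b. q powi mu i * c b) = K M i (comb c)"
    using wspace_K[OF assms(1) i] by (simp add: comb_smul)
  also have "\<dots> = (\<Sum>b\<in>elements C. K M i (smul M (c b) (w b)))"
    unfolding comb_def by (rule endo_sum[OF endomorphisms(3)[OF i]]) (auto intro: w_vecs)
  also have "\<dots> = comb (\<lambda>b. q powi wt C b i * c b)"
    unfolding comb_def
    by (rule sum.cong) (simp_all add: endo_smul[OF endomorphisms(3)[OF i]] w_vecs wspace_K[OF w_weight i] mult.commute)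
  finally have "q powi mu i * c b = q powi wt C b i * c b" by (rule comb_eq[OF _ assms(2)])
  then show "mu i = wt C b i" using assms(3) by (simp add: q_powi_inject)
qed

lemma weight_vector:
  assumes "u \<in> wspace mu" "mu \<in> weight_lattice n" "u \<noteq> 0"
  obtains b a where "b \<in> elements C" "mu = wt C b" "u = smul M a (w b)" "a \<noteq> 0"
proof -
  obtain c where c: "u = comb c" using comb_exists wspace_vecs[OF assms(1)] by blast
  obtain b where b: "b \<in> elements C" "c b \<noteq> 0"
  proof (rule ccontr)
    assume "\<not> thesis"
    then have "\<forall>b\<in>elements C. c b = 0" using that by blast
    then have "comb c = 0" by (simp add: comb_def)
    then show False using c assms(3) by simp
  qed
  have *: "mu = wt C b'" if "b' \<in> elements C" "c b' \<noteq> 0" for b'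
    using comb_weight[of c mu b'] assms c that by simp
  have "c b' = 0" if "b' \<in> elements C" "b' \<noteq> b" for b'
    using *[OF b] *[OF that(1)] wt_inj that b(1) by (auto simp: inj_on_def)
  then have "u = comb (\<lambda>b'. if b' = b then c b else 0)"
    unfolding c comb_def by (intro sum.cong) auto
  then show ?thesis using that[of b "c b"] * b comb_single[OF b(1)] by simp
qed

lemma E_F_smul:
  assumes "b \<in> elements C" "i \<in> {1..n}"
  shows "E M i (smul M a (w b)) = smul M a (opt w (et C i b))"
    "F M i (smul M a (w b)) = smul M a (opt w (ft C i b))"
  using assms by (simp_all add: endo_smul endomorphisms w_vecs w_E w_F)

text \<open>The nonzero terms of a string decomposition have \<open>k = 0\<close>, or \<open>k = 1\<close> and \<open>x\<close> a multiple of a basis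
  vector with pairing \<open>1\<close>. In both cases \<open>e_i\<close> and \<open>f_i\<close> shift the string as the operators of Kashiwara do,
  without any factor.\<close>

lemma string_term:
  assumes i: "i \<in> {1..n}" and mu: "mu \<in> weight_lattice n" "int k \<le> mu i" and x: "x \<in> wspace mu" "E M i x = 0"
  shows "(if k = 0 then 0 else divided_F n M i (k - 1) x) = E M i (divided_F n M i k x)"
    "divided_F n M i (k + 1) x = F M i (divided_F n M i k x)"
proof -
  have z: "divided_F n M i k 0 = 0" for k
  proof -
    have "(F M i ^^ k) 0 = 0" by (induction k) (use endo_0[OF endomorphisms(2)[OF i]] in auto)
    then show ?thesis by (simp add: divided_F_def)
  qed
  have 0: "divided_F n M i 0 x = x" "divided_F n M i (Suc 0) x = F M i x" for x
    by (simp_all add: divided_F_def)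
  have "(if k = 0 then 0 else divided_F n M i (k - 1) x) = E M i (divided_F n M i k x) \<and>
    divided_F n M i (k + 1) x = F M i (divided_F n M i k x)"
  proof (cases "x = 0")
    case True
    then show ?thesis using z endo_0 endomorphisms i by simp
  next
    case False
    then obtain b a where b: "b \<in> elements C" "mu = wt C b" "x = smul M a (w b)"
      using weight_vector[OF x(1) mu(1)] by blast
    then have "k = 0 \<or> k = 1 \<and> wt C b i = 1" using mu(2) wt_small[OF b(1) i] by auto
    then show ?thesis
    proof
      assume "k = 0"
      then show ?thesis using x(2) 0 by simp
    next
      assume k: "k = 1 \<and> wt C b i = 1"
      then obtain b' where b': "ft C i b = Some b'" using ft_None[OF b(1) i] by auto
      have b'C: "b' \<in> elements C" "et C i b' = Some b" using ft_et[OF b(1) i b'] by auto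
      have "ft C i b' = None" using step_twice[of 1 b i] b(1) i b' by simp
      then have "F M i (F M i x) = 0" "E M i (F M i x) = x"
        using b b' b'C i by (simp_all add: E_F_smul)
      moreover have "divided_F n M i 2 x = smul M (inverse (q_fact n i 2)) (F M i (F M i x))"
        by (simp add: divided_F_def numeral_2_eq_2)
      ultimately show ?thesis using k 0 by (simp add: numeral_2_eq_2)
    qed
  qed
  then show "(if k = 0 then 0 else divided_F n M i (k - 1) x) = E M i (divided_F n M i k x)"
    "divided_F n M i (k + 1) x = F M i (divided_F n M i k x)" by auto
qed

lemma divided_F_vecs: "i \<in> {1..n} \<Longrightarrow> x \<in> vecs M \<Longrightarrow> divided_F n M i k x \<in> vecs M"
proof -
  assume *: "i \<in> {1..n}" "x \<in> vecs M"
  have "(F M i ^^ k) x \<in> vecs M" by (induction k) (use endo_vecs[OF endomorphisms(2)[OF *(1)]] * in auto)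
  then show ?thesis by (auto simp: divided_F_def)
qed

lemma string_sums:
  assumes i: "i \<in> {1..n}" and S: "string_decomposition n M i u S us"
  shows "(\<Sum>p\<in>S. if fst p = 0 then 0 else divided_F n M i (fst p - 1) (us p)) = E M i u"
    "(\<Sum>p\<in>S. divided_F n M i (fst p + 1) (us p)) = F M i u"
proof -
  have S': "snd p \<in> weight_lattice n" "int (fst p) \<le> snd p i" "us p \<in> wspace (snd p)" "E M i (us p) = 0" if "p \<in> S" for p
    using S that unfolding string_decomposition_def by (cases p, force)+
  have u: "u = (\<Sum>p\<in>S. divided_F n M i (fst p) (us p))"
    using S by (simp add: string_decomposition_def)
  have v: "divided_F n M i (fst p) (us p) \<in> vecs M" if "p \<in> S" for p
    using divided_F_vecs[OF i] S'(3)[OF that] wspace_vecs by blast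
  show "(\<Sum>p\<in>S. if fst p = 0 then 0 else divided_F n M i (fst p - 1) (us p)) = E M i u"
    unfolding u by (subst endo_sum[OF endomorphisms(1)[OF i]], erule v, rule sum.cong[OF refl], rule string_term(1)[OF i S'])
  show "(\<Sum>p\<in>S. divided_F n M i (fst p + 1) (us p)) = F M i u"
    unfolding u by (subst endo_sum[OF endomorphisms(2)[OF i]], erule v, rule sum.cong[OF refl], rule string_term(2)[OF i S'])
qed

text \<open>A basis vector \<open>w b\<close> either is annihilated by \<open>e_i\<close> or equals \<open>f_i (w b')\<close> with \<open>w b'\<close> annihilated
  by \<open>e_i\<close>. The pairs \<open>p b\<close> are distinct, since they determine the weight of \<open>b\<close>.\<close>

lemma string_decomposition_exists:
  assumes i: "i \<in> {1..n}" and u: "u \<in> vecs M"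
  shows "\<exists>S us. string_decomposition n M i u S us"
proof -
  obtain c where c: "u = comb c" using comb_exists[OF u] by blast
  \<comment> \<open>The position in its \<open>i\<close>-string and the weight of the top of that string; \<open>x b\<close> is the vector at the top.\<close>
  define p where "p b = (case et C i b of None \<Rightarrow> (0::nat, wt C b) | Some b' \<Rightarrow> (1, wt C b'))" for b
  define x where "x b = smul M (c b) (case et C i b of None \<Rightarrow> w b | Some b' \<Rightarrow> w b')" for b
  have p_wt: "wt C b = (\<lambda>j. snd (p b) j - int (fst (p b)) * simple_root n i j)" if "b \<in> elements C" for b
    using et_Some[OF that i] by (auto simp: p_def split: option.splits)
  have inj: "inj_on p (elements C)"
  proof (rule inj_onI)
    fix b b' assume *: "b \<in> elements C" "b' \<in> elements C" "p b = p b'"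
    have "wt C b = wt C b'" using p_wt[OF *(1)] p_wt[OF *(2)] *(3) by simp
    then show "b = b'" using wt_inj * by (auto simp: inj_on_def)
  qed
  have ok: "snd (p b) \<in> weight_lattice n \<and> int (fst (p b)) \<le> snd (p b) i \<and> x b \<in> wspace (snd (p b)) \<and> E M i (x b) = 0
     \<and> divided_F n M i (fst (p b)) (x b) = smul M (c b) (w b)" if b: "b \<in> elements C" for b
  proof (cases "et C i b")
    case None
    then have "wt C b i \<ge> 0" using et_None[OF b i] wt_small[OF b i] by auto
    then show ?thesis using None b i wt_lattice w_weight wspace_closed(4)
      by (simp add: p_def x_def E_F_smul divided_F_def)
  next
    case (Some b')
    have b': "b' \<in> elements C" "ft C i b' = Some b" using et_ft[OF b i Some] by auto
    then have "wt C b' i = 1" using ft_None[OF b'(1) i] by auto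
    moreover have "et C i b' = None" using step_twice[of "-1" b i] b i Some by simp
    ultimately show ?thesis using Some b b' i wt_lattice w_weight wspace_closed(4)
      by (simp add: p_def x_def E_F_smul divided_F_def)
  qed
  define us where "us r = x (inv_into (elements C) p r)" for r
  have us: "us (p b) = x b" if "b \<in> elements C" for b using inj that by (simp add: us_def)
  have "(\<Sum>r\<in>p ` elements C. divided_F n M i (fst r) (us r)) = (\<Sum>b\<in>elements C. divided_F n M i (fst (p b)) (x b))"
    using us by (simp add: sum.reindex[OF inj])
  also have "\<dots> = u" using ok by (simp add: c comb_def)
  finally have "string_decomposition n M i u (p ` elements C) us"
    unfolding string_decomposition_def case_prod_beta prod.collapse ball_simps(9)
    using finite_elements ok us by (intro conjI) simp_all
  then show ?thesis by blast
qed

lemma kashiwara: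
  assumes "i \<in> {1..n}" "u \<in> vecs M"
  shows "kashiwara_e n M i u = E M i u" "kashiwara_f n M i u = F M i u"
proof -
  obtain S us where S: "string_decomposition n M i u S us" using string_decomposition_exists[OF assms] by blast
  show "kashiwara_e n M i u = E M i u" unfolding kashiwara_e_def
  proof (rule the_equality)
    show "\<exists>S us. string_decomposition n M i u S us \<and>
       E M i u = (\<Sum>p\<in>S. if fst p = 0 then 0 else divided_F n M i (fst p - 1) (us p))"
      using S string_sums(1)[OF assms(1) S] by (intro exI conjI) (assumption, rule sym)
  qed (use string_sums(1)[OF assms(1)] in blast)
  show "kashiwara_f n M i u = F M i u" unfolding kashiwara_f_def
  proof (rule the_equality)
    show "\<exists>S us. string_decomposition n M i u S us \<and>
       F M i u = (\<Sum>p\<in>S. divided_F n M i (fst p + 1) (us p))"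
      using S string_sums(2)[OF assms(1) S] by (intro exI conjI) (assumption, rule sym)
  qed (use string_sums(2)[OF assms(1)] in blast)
qed

end

section \<open>The standard crystal base\<close>

context minuscule_basis begin

definition std_lattice :: "'v set" where
  "std_lattice = {comb c | c. \<forall>b\<in>elements C. c b \<in> regular_at_0}"

abbreviation res :: "'v \<Rightarrow> 'v set" where "res \<equiv> residue M std_lattice"

definition std_base :: "'v set set" where
  "std_base = (\<lambda>b. res (w b)) ` elements C"

lemma comb_std_lattice: "(\<And>b. b \<in> elements C \<Longrightarrow> c b \<in> regular_at_0) \<Longrightarrow> comb c \<in> std_lattice"
  by (auto simp: std_lattice_def)

lemma std_lattice_submodule: "regular_submodule std_lattice"
  unfolding regular_submodule_def
proof (intro conjI ballI)
  show "std_lattice \<subseteq> vecs M" using comb_vecs by (auto simp: std_lattice_def)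
  show "0 \<in> std_lattice" using comb_std_lattice[of "\<lambda>b. 0"] regular_0 comb_0 by simp
next
  fix u v assume "u \<in> std_lattice" "v \<in> std_lattice"
  then show "u + v \<in> std_lattice" unfolding std_lattice_def using comb_add regular_add by force
next
  fix c u assume "c \<in> regular_at_0" "u \<in> std_lattice"
  then show "smul M c u \<in> std_lattice" unfolding std_lattice_def using comb_smul regular_mult by force
qed

lemmas std_lattice_closed = regular_submodule_closed[OF std_lattice_submodule]

lemma w_comb: "b \<in> elements C \<Longrightarrow> w b = comb (\<lambda>b'. if b' = b then 1 else 0)"
  using comb_single[of b 1] by simp

lemma w_std_lattice: "b \<in> elements C \<Longrightarrow> w b \<in> std_lattice"
  using w_comb comb_std_lattice regular_0 regular_1 by auto

lemma w_inj: "inj_on w (elements C)"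
proof (rule inj_onI)
  fix b b' assume b: "b \<in> elements C" "b' \<in> elements C" "w b = w b'"
  then have "comb (\<lambda>x. if x = b then 1 else 0) = comb (\<lambda>x. if x = b' then 1 else 0)" using w_comb by simp
  from comb_eq[OF this b(1)] show "b = b'" by (auto split: if_splits)
qed

lemma sum_w: "(\<Sum>x\<in>w ` elements C. smul M (c x) x) = comb (\<lambda>b. c (w b))"
  by (simp add: comb_def sum.reindex[OF w_inj])

lemma sum_subset_w:
  assumes "T \<subseteq> w ` elements C"
  shows "(\<Sum>x\<in>T. smul M (c x) x) = comb (\<lambda>b. if w b \<in> T then c (w b) else 0)"
proof -
  have "(\<Sum>x\<in>T. smul M (c x) x) = (\<Sum>x\<in>w ` elements C. smul M (if x \<in> T then c x else 0) x)"
    by (rule sum.mono_neutral_cong_left) (use assms finite_elements in auto)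
  then show ?thesis by (simp add: sum_w)
qed

lemma std_lattice_is_lattice: "is_lattice M std_lattice"
  unfolding is_lattice_def
proof (intro conjI exI[of _ "w ` elements C"])
  show "w ` elements C \<subseteq> vecs M" using w_vecs by auto
  show "std_lattice = {\<Sum>x\<in>T. smul M (c x) x |T c. finite T \<and> T \<subseteq> w ` elements C \<and> (\<forall>x\<in>T. c x \<in> regular_at_0)}" (is "_ = ?R")
  proof
    show "std_lattice \<subseteq> ?R"
    proof
      fix u assume "u \<in> std_lattice"
      then obtain c where c: "u = comb c" "\<forall>b\<in>elements C. c b \<in> regular_at_0" by (auto simp: std_lattice_def)
      define d where "d x = c (inv_into (elements C) w x)" for x
      have "comb c = comb (\<lambda>b. d (w b))" unfolding comb_def d_def by (rule sum.cong) (simp_all add: w_inj)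
      then have "u = (\<Sum>x\<in>w ` elements C. smul M (d x) x)" using c sum_w by simp
      moreover have "\<forall>x\<in>w ` elements C. d x \<in> regular_at_0" using c w_inj by (simp add: d_def)
      ultimately show "u \<in> ?R" using finite_elements by blast
    qed
    show "?R \<subseteq> std_lattice"
    proof
      fix u assume "u \<in> ?R"
      then obtain T c where T: "T \<subseteq> w ` elements C" "\<forall>x\<in>T. c x \<in> regular_at_0" "u = (\<Sum>x\<in>T. smul M (c x) x)" by blast
      show "u \<in> std_lattice" unfolding T(3) sum_subset_w[OF T(1)] by (rule comb_std_lattice) (use T(2) regular_0 in auto)
    qed
  qed
  show "\<forall>T c. finite T \<and> T \<subseteq> w ` elements C \<and> (\<forall>x\<in>T. c x \<in> regular_at_0) \<and> (\<Sum>x\<in>T. smul M (c x) x) = 0 \<longrightarrow>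
          (\<forall>x\<in>T. c x = 0)"
  proof (intro allI impI ballI)
    fix T c x assume T: "finite T \<and> T \<subseteq> w ` elements C \<and> (\<forall>x\<in>T. c x \<in> regular_at_0) \<and> (\<Sum>x\<in>T. smul M (c x) x) = 0" and x: "x \<in> T"
    then obtain b where b: "b \<in> elements C" "x = w b" by blast
    have "comb (\<lambda>b. if w b \<in> T then c (w b) else 0) = 0" using T sum_subset_w[of T c] by simp
    from comb_eq_0[OF this b(1)] show "c x = 0" using b x by simp
  qed
  have "vs.span std_lattice \<subseteq> vecs M" by (rule span_vecs) (rule std_lattice_closed)
  moreover have "w ` elements C \<subseteq> std_lattice" using w_std_lattice by auto
  ultimately show "vs.span std_lattice = vecs M" using w_span vs.span_mono by blast
qed

lemma comb_q_std_lattice: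
  assumes "comb c = smul M q y" "y \<in> std_lattice" "b \<in> elements C"
  shows "\<exists>r\<in>regular_at_0. c b = q * r"
proof -
  obtain d where d: "y = comb d" "\<forall>b\<in>elements C. d b \<in> regular_at_0" using assms(2) by (auto simp: std_lattice_def)
  have "comb c = comb (\<lambda>b. q * d b)" using assms(1) d comb_smul by simp
  from comb_eq[OF this assms(3)] show ?thesis using d assms(3) by blast
qed

lemma res_w_nonzero: "b \<in> elements C \<Longrightarrow> res (w b) \<noteq> res 0"
proof
  assume b: "b \<in> elements C" "res (w b) = res 0"
  then obtain y where "y \<in> std_lattice" "w b = smul M q y" using residue_0_iff[OF std_lattice_submodule] by blast
  then obtain r where "r \<in> regular_at_0" "1 = q * r"
    using comb_q_std_lattice[OF _ _ b(1), of "\<lambda>b'. if b' = b then 1 else 0" y] w_comb[OF b(1)] by auto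
  then show False using rat_const_eq_q_times[of r 1] by simp
qed

lemma res_w_inj: "inj_on (\<lambda>b. res (w b)) (elements C)"
proof (rule inj_onI, rule ccontr)
  fix b b' assume b: "b \<in> elements C" "b' \<in> elements C" "res (w b) = res (w b')" and ne: "b \<noteq> b'"
  obtain y where y: "y \<in> std_lattice" "w b = w b' + smul M q y" using residue_eq_iff[OF std_lattice_submodule] b(3) by blast
  have "comb (\<lambda>x. (if x = b then 1 else 0) - (if x = b' then 1 else 0)) = w b - w b'"
    using w_comb[OF b(1)] w_comb[OF b(2)] comb_diff by simp
  also have "\<dots> = smul M q y" using y by simp
  finally obtain r where "r \<in> regular_at_0" "1 = q * r"
    using comb_q_std_lattice[OF _ y(1) b(1)] ne by force
  then show False using rat_const_eq_q_times[of r 1] by simp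
qed

lemma E_F_std_lattice:
  assumes "i \<in> {1..n}" "u \<in> std_lattice"
  shows "E M i u \<in> std_lattice" "F M i u \<in> std_lattice"
proof -
  obtain c where c: "u = comb c" "\<forall>b\<in>elements C. c b \<in> regular_at_0" using assms(2) by (auto simp: std_lattice_def)
  have v: "smul M (c b) (w b) \<in> vecs M" if "b \<in> elements C" for b using w_vecs that by auto
  have o: "opt w y \<in> std_lattice" if "\<And>b. y = Some b \<Longrightarrow> b \<in> elements C" for y
    using that w_std_lattice std_lattice_closed(2) by (cases y) auto
  have "E M i u = (\<Sum>b\<in>elements C. smul M (c b) (opt w (et C i b)))"
    unfolding c(1) comb_def by (subst endo_sum[OF endomorphisms(1)[OF assms(1)]], erule v, rule sum.cong[OF refl], rule E_F_smul(1)[OF _ assms(1)])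
  also have "\<dots> \<in> std_lattice" by (intro std_lattice_closed(6) std_lattice_closed(4) o) (use c et_Some assms in blast)+
  finally show "E M i u \<in> std_lattice" .
  have "F M i u = (\<Sum>b\<in>elements C. smul M (c b) (opt w (ft C i b)))"
    unfolding c(1) comb_def by (subst endo_sum[OF endomorphisms(2)[OF assms(1)]], erule v, rule sum.cong[OF refl], rule E_F_smul(2)[OF _ assms(1)])
  also have "\<dots> \<in> std_lattice" by (intro std_lattice_closed(6) std_lattice_closed(4) o) (use c ft_Some assms in blast)+
  finally show "F M i u \<in> std_lattice" .
qed

lemma kashiwara_std_lattice:
  assumes "i \<in> {1..n}" "u \<in> std_lattice"
  shows "kashiwara_e n M i u = E M i u" "kashiwara_f n M i u = F M i u"
  using kashiwara assms std_lattice_closed(1) by auto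

lemma induced_w:
  assumes "i \<in> {1..n}" "b \<in> elements C"
  shows "induced M std_lattice (kashiwara_e n M i) (res (w b)) = res (opt w (et C i b))"
    "induced M std_lattice (kashiwara_f n M i) (res (w b)) = res (opt w (ft C i b))"
proof -
  have "induced M std_lattice (kashiwara_e n M i) (res (w b)) = res (kashiwara_e n M i (w b))"
    by (rule induced_residue[OF std_lattice_submodule kashiwara_std_lattice(1)[OF assms(1)] endomorphisms(1)[OF assms(1)] _ w_std_lattice[OF assms(2)]])
      (use kashiwara_std_lattice E_F_std_lattice assms(1) in auto)
  then show "induced M std_lattice (kashiwara_e n M i) (res (w b)) = res (opt w (et C i b))"
    using kashiwara_std_lattice(1)[OF assms(1) w_std_lattice[OF assms(2)]] w_E[OF assms(2,1)] by simp
  have "induced M std_lattice (kashiwara_f n M i) (res (w b)) = res (kashiwara_f n M i (w b))"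
    by (rule induced_residue[OF std_lattice_submodule kashiwara_std_lattice(2)[OF assms(1)] endomorphisms(2)[OF assms(1)] _ w_std_lattice[OF assms(2)]])
      (use kashiwara_std_lattice E_F_std_lattice assms(1) in auto)
  then show "induced M std_lattice (kashiwara_f n M i) (res (w b)) = res (opt w (ft C i b))"
    using kashiwara_std_lattice(2)[OF assms(1) w_std_lattice[OF assms(2)]] w_F[OF assms(2,1)] by simp
qed

lemma res_opt:
  assumes "b' \<in> elements C" "\<And>b. y = Some b \<Longrightarrow> b \<in> elements C"
  shows "res (opt w y) = res (w b') \<longleftrightarrow> y = Some b'"
proof (cases y)
  case None
  then show ?thesis using res_w_nonzero[OF assms(1)] by auto
next
  case (Some b)
  then show ?thesis using res_w_inj assms by (auto simp: inj_on_def)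
qed

lemma res_opt_cases: "(\<And>b. y = Some b \<Longrightarrow> b \<in> elements C) \<Longrightarrow> res (opt w y) \<in> insert (res 0) std_base"
  by (cases y) (auto simp: std_base_def)

text \<open>Both independence and spanning are read off coefficientwise from the decomposition of the local
  ring into constants and multiples of \<open>q\<close>.\<close>

lemma std_base_residue_basis: "is_residue_basis M std_lattice std_base"
  unfolding is_residue_basis_def
proof (intro conjI)
  show "std_base \<subseteq> residue M std_lattice ` std_lattice" using w_std_lattice by (auto simp: std_base_def)
  show "\<forall>S c u. finite S \<and> S \<subseteq> std_base \<and> (\<forall>\<beta>\<in>S. u \<beta> \<in> \<beta>) \<and>
       res (\<Sum>\<beta>\<in>S. smul M (rat_const (c \<beta>)) (u \<beta>)) = res 0 \<longrightarrow> (\<forall>\<beta>\<in>S. c \<beta> = 0)"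
  proof (intro allI impI ballI)
    fix S c u \<beta>
    assume S: "finite S \<and> S \<subseteq> std_base \<and> (\<forall>\<beta>\<in>S. u \<beta> \<in> \<beta>) \<and>
       res (\<Sum>\<beta>\<in>S. smul M (rat_const (c \<beta>)) (u \<beta>)) = res 0" and \<beta>: "\<beta> \<in> S"
    define A where "A = {b \<in> elements C. res (w b) \<in> S}"
    have bij: "bij_betw (\<lambda>b. res (w b)) A S"
      unfolding bij_betw_def
    proof
      show "inj_on (\<lambda>b. res (w b)) A" by (rule inj_on_subset[OF res_w_inj]) (auto simp: A_def)
      show "(\<lambda>b. res (w b)) ` A = S" using S by (auto simp: A_def std_base_def)
    qed
    have "\<exists>y\<in>std_lattice. u (res (w b)) = w b + smul M q y" if "b \<in> A" for b
    proof -
      have "u (res (w b)) \<in> res (w b)" using S that by (simp add: A_def)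
      then show ?thesis using residue_eq_iff[OF std_lattice_submodule] residue_mem[OF std_lattice_submodule] by blast
    qed
    then have "\<forall>b\<in>A. \<exists>y. y \<in> std_lattice \<and> u (res (w b)) = w b + smul M q y" by blast
    from bchoice[OF this] obtain y where y0: "\<forall>b\<in>A. y b \<in> std_lattice \<and> u (res (w b)) = w b + smul M q (y b)" ..
    have y: "y b \<in> std_lattice" "u (res (w b)) = w b + smul M q (y b)" if "b \<in> A" for b
      using bspec[OF y0 that] by auto
    define d where "d b = rat_const (c (res (w b)))" for b
    obtain z where z: "z \<in> std_lattice" "(\<Sum>\<beta>\<in>S. smul M (rat_const (c \<beta>)) (u \<beta>)) = smul M q z"
      using S residue_0_iff[OF std_lattice_submodule, of "\<Sum>\<beta>\<in>S. smul M (rat_const (c \<beta>)) (u \<beta>)"] by auto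
    have "(\<Sum>\<beta>\<in>S. smul M (rat_const (c \<beta>)) (u \<beta>)) = (\<Sum>b\<in>A. smul M (d b) (u (res (w b))))"
      unfolding d_def by (rule sum.reindex_bij_betw[OF bij, symmetric])
    also have "\<dots> = (\<Sum>b\<in>A. smul M (d b) (w b)) + (\<Sum>b\<in>A. smul M (d b) (smul M q (y b)))"
      using y by (simp add: vs.scale_right_distrib sum.distrib)
    also have "(\<Sum>b\<in>A. smul M (d b) (smul M q (y b))) = smul M q (\<Sum>b\<in>A. smul M (d b) (y b))"
      by (simp add: vs.scale_sum_right mult.commute)
    also have "(\<Sum>b\<in>A. smul M (d b) (w b)) = comb (\<lambda>b. if b \<in> A then d b else 0)"
      unfolding comb_def by (rule sum.mono_neutral_cong_left) (use finite_elements in \<open>auto simp: A_def\<close>)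
    finally have "comb (\<lambda>b. if b \<in> A then d b else 0) = smul M q (z - (\<Sum>b\<in>A. smul M (d b) (y b)))"
      using z(2) by (simp add: vs.scale_right_diff_distrib algebra_simps)
    moreover have "z - (\<Sum>b\<in>A. smul M (d b) (y b)) \<in> std_lattice"
      by (intro std_lattice_closed(5) std_lattice_closed(6) std_lattice_closed(4) z) (use y rat_const_regular in \<open>auto simp: d_def\<close>)
    moreover obtain b where b: "b \<in> A" "\<beta> = res (w b)" using bij \<beta> by (auto simp: bij_betw_def)
    moreover have "b \<in> elements C" using b by (simp add: A_def)
    ultimately obtain r where "r \<in> regular_at_0" "d b = q * r"
      using comb_q_std_lattice[of "\<lambda>b. if b \<in> A then d b else 0" "z - (\<Sum>b\<in>A. smul M (d b) (y b))" b] by auto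
    then show "c \<beta> = 0" using rat_const_eq_q_times b(2) by (simp add: d_def)
  qed
  show "\<forall>x\<in>std_lattice. \<exists>S c u. finite S \<and> S \<subseteq> std_base \<and> (\<forall>b\<in>S. u b \<in> b) \<and>
       res x = res (\<Sum>b\<in>S. smul M (rat_const (c b)) (u b))"
  proof
    fix x assume "x \<in> std_lattice"
    then obtain c where c: "x = comb c" "\<forall>b\<in>elements C. c b \<in> regular_at_0" by (auto simp: std_lattice_def)
    have "\<forall>b\<in>elements C. \<exists>ar. snd ar \<in> regular_at_0 \<and> c b = rat_const (fst ar) + q * snd ar"
    proof
      fix b assume "b \<in> elements C"
      then have "c b \<in> regular_at_0" using c(2) by simp
      then obtain a r where "r \<in> regular_at_0" "c b = rat_const a + q * r" by (rule regular_residue)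
      then show "\<exists>ar. snd ar \<in> regular_at_0 \<and> c b = rat_const (fst ar) + q * snd ar"
        by (intro exI[of _ "(a, r)"]) simp
    qed
    from bchoice[OF this] obtain ar0 where ar0: "\<forall>b\<in>elements C. snd (ar0 b) \<in> regular_at_0 \<and> c b = rat_const (fst (ar0 b)) + q * snd (ar0 b)" ..
    define a where "a b = fst (ar0 b)" for b
    define r where "r b = snd (ar0 b)" for b
    have ar: "r b \<in> regular_at_0 \<and> c b = rat_const (a b) + q * r b" if "b \<in> elements C" for b
      using ar0 that by (simp add: a_def r_def)
    define g where "g = inv_into (elements C) (\<lambda>b. res (w b))"
    have g: "g (res (w b)) = b" if "b \<in> elements C" for b
      unfolding g_def by (rule inv_into_f_f[OF res_w_inj that])
    have "(\<Sum>\<beta>\<in>std_base. smul M (rat_const (a (g \<beta>))) (w (g \<beta>))) = comb (\<lambda>b. rat_const (a b))"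
      unfolding std_base_def comb_def by (simp add: sum.reindex[OF res_w_inj] g)
    moreover have "x = comb (\<lambda>b. rat_const (a b)) + smul M q (comb r)"
      unfolding c(1) comb_smul comb_add unfolding comb_def by (rule sum.cong) (use ar in auto)
    moreover have "comb r \<in> std_lattice" by (rule comb_std_lattice) (use ar in auto)
    ultimately have "res x = res (\<Sum>\<beta>\<in>std_base. smul M (rat_const (a (g \<beta>))) (w (g \<beta>)))"
      using residue_eq_iff[OF std_lattice_submodule] by auto
    moreover have "\<forall>\<beta>\<in>std_base. w (g \<beta>) \<in> \<beta>" using g residue_self[OF std_lattice_submodule] by (auto simp: std_base_def)
    moreover have "finite std_base" using finite_elements by (simp add: std_base_def)
    ultimately show "\<exists>S c u. finite S \<and> S \<subseteq> std_base \<and> (\<forall>b\<in>S. u b \<in> b) \<and>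
       res x = res (\<Sum>b\<in>S. smul M (rat_const (c b)) (u b))"
      by (intro exI[of _ std_base] exI[of _ "\<lambda>\<beta>. a (g \<beta>)"] exI[of _ "\<lambda>\<beta>. w (g \<beta>)"]) simp
  qed
qed

lemma standard_crystal_base: "is_crystal_base n M std_lattice std_base"
  unfolding is_crystal_base_def
proof (intro conjI)
  show "is_lattice M std_lattice" by (rule std_lattice_is_lattice)
  show "is_residue_basis M std_lattice std_base" by (rule std_base_residue_basis)
  show "\<forall>u\<in>std_lattice. \<exists>S c. finite S \<and> S \<subseteq> weight_lattice n \<and>
       (\<forall>lam\<in>S. c lam \<in> std_lattice \<inter> wspace lam) \<and> u = (\<Sum>lam\<in>S. c lam)"
  proof
    fix u assume "u \<in> std_lattice"
    then obtain c where c: "u = comb c" "\<forall>b\<in>elements C. c b \<in> regular_at_0" by (auto simp: std_lattice_def)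
    define g where "g = inv_into (elements C) (wt C)"
    have g: "g (wt C b) = b" if "b \<in> elements C" for b
      unfolding g_def by (rule inv_into_f_f[OF wt_inj that])
    have "u = (\<Sum>lam\<in>wt C ` elements C. smul M (c (g lam)) (w (g lam)))"
      unfolding c(1) comb_def by (simp add: sum.reindex[OF wt_inj] g)
    moreover have "\<forall>lam\<in>wt C ` elements C. smul M (c (g lam)) (w (g lam)) \<in> std_lattice \<inter> wspace lam"
      using g c(2) w_std_lattice std_lattice_closed(4) wspace_closed(4) w_weight by auto
    ultimately show "\<exists>S c. finite S \<and> S \<subseteq> weight_lattice n \<and>
       (\<forall>lam\<in>S. c lam \<in> std_lattice \<inter> wspace lam) \<and> u = (\<Sum>lam\<in>S. c lam)"
      using finite_elements wt_lattice by (intro exI[of _ "wt C ` elements C"] exI[of _ "\<lambda>lam. smul M (c (g lam)) (w (g lam))"]) auto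
  qed
  show "\<forall>b\<in>std_base. \<exists>lam\<in>weight_lattice n. b \<in> residue M std_lattice ` (std_lattice \<inter> wspace lam)"
    using w_std_lattice w_weight wt_lattice unfolding std_base_def by blast
  show "\<forall>i\<in>{1..n}. \<forall>u\<in>std_lattice. kashiwara_e n M i u \<in> std_lattice \<and> kashiwara_f n M i u \<in> std_lattice"
    using kashiwara_std_lattice E_F_std_lattice by auto
  show "\<forall>i\<in>{1..n}. \<forall>b\<in>std_base.
       induced M std_lattice (kashiwara_e n M i) b \<in> insert (residue M std_lattice 0) std_base \<and>
       induced M std_lattice (kashiwara_f n M i) b \<in> insert (residue M std_lattice 0) std_base"
  proof (intro ballI)
    fix i \<beta> assume i: "i \<in> {1..n}" and "\<beta> \<in> std_base"
    then obtain b where b: "b \<in> elements C" "\<beta> = res (w b)" by (auto simp: std_base_def)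
    have "res (opt w (et C i b)) \<in> insert (res 0) std_base" "res (opt w (ft C i b)) \<in> insert (res 0) std_base"
      by (rule res_opt_cases, use et_Some[OF b(1) i] ft_Some[OF b(1) i] in blast)+
    then show "induced M std_lattice (kashiwara_e n M i) \<beta> \<in> insert (residue M std_lattice 0) std_base \<and>
       induced M std_lattice (kashiwara_f n M i) \<beta> \<in> insert (residue M std_lattice 0) std_base"
      unfolding b(2) induced_w[OF i b(1)] ..
  qed
  show "\<forall>i\<in>{1..n}. \<forall>b\<in>std_base. \<forall>b'\<in>std_base.
       b' = induced M std_lattice (kashiwara_f n M i) b \<longleftrightarrow> b = induced M std_lattice (kashiwara_e n M i) b'"
  proof (intro ballI)
    fix i \<beta> \<beta>' assume i: "i \<in> {1..n}" and "\<beta> \<in> std_base" "\<beta>' \<in> std_base"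
    then obtain b b' where b: "b \<in> elements C" "\<beta> = res (w b)" "b' \<in> elements C" "\<beta>' = res (w b')" by (auto simp: std_base_def)
    have "ft C i b = Some b' \<longleftrightarrow> et C i b' = Some b" using ft_et[OF b(1) i] et_ft[OF b(3) i] by blast
    moreover have "res (w b') = res (opt w (ft C i b)) \<longleftrightarrow> ft C i b = Some b'"
      by (subst eq_commute, rule res_opt[OF b(3)]) (use ft_Some[OF b(1) i] in blast)
    moreover have "res (w b) = res (opt w (et C i b')) \<longleftrightarrow> et C i b' = Some b"
      by (subst eq_commute, rule res_opt[OF b(1)]) (use et_Some[OF b(3) i] in blast)
    ultimately show "\<beta>' = induced M std_lattice (kashiwara_f n M i) \<beta> \<longleftrightarrow> \<beta> = induced M std_lattice (kashiwara_e n M i) \<beta>'"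
      unfolding b(2,4) induced_w[OF i b(1)] induced_w[OF i b(3)] by (simp only:)
  qed
qed

lemma residue_operators:
  assumes "i \<in> {1..n}" "b \<in> elements C"
  shows "residue_e n M std_lattice i (res (w b)) = map_option (\<lambda>b. res (w b)) (et C i b)"
    "residue_f n M std_lattice i (res (w b)) = map_option (\<lambda>b. res (w b)) (ft C i b)"
proof -
  have *: "nonzero_residue M std_lattice (res (opt w y)) = map_option (\<lambda>b. res (w b)) y"
    if "\<And>b. y = Some b \<Longrightarrow> b \<in> elements C" for y
    using that res_w_nonzero by (cases y) (auto simp: nonzero_residue_def)
  show "residue_e n M std_lattice i (res (w b)) = map_option (\<lambda>b. res (w b)) (et C i b)"
    unfolding residue_e_def induced_w[OF assms] by (rule *) (use et_Some[OF assms(2,1)] in blast)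
  show "residue_f n M std_lattice i (res (w b)) = map_option (\<lambda>b. res (w b)) (ft C i b)"
    unfolding residue_f_def induced_w[OF assms] by (rule *) (use ft_Some[OF assms(2,1)] in blast)
qed

text \<open>If \<open>y\<close> is congruent to \<open>w b\<close>, its coefficient at \<open>w b\<close> is \<open>1\<close> modulo \<open>q\<close> and in particular nonzero, which
  fixes the weight of \<open>y\<close>.\<close>

lemma residue_weight:
  assumes "b \<in> elements C"
  shows "(THE lam. lam \<in> weight_lattice n \<and> res (w b) \<in> res ` (std_lattice \<inter> wspace lam)) = wt C b"
proof (rule the_equality)
  show "wt C b \<in> weight_lattice n \<and> res (w b) \<in> res ` (std_lattice \<inter> wspace (wt C b))"
    using wt_lattice w_std_lattice w_weight assms by blast
  fix lam assume "lam \<in> weight_lattice n \<and> res (w b) \<in> res ` (std_lattice \<inter> wspace lam)"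
  then obtain y where y: "lam \<in> weight_lattice n" "y \<in> std_lattice" "y \<in> wspace lam" "res y = res (w b)" by auto
  obtain c where c: "y = comb c" using y(2) by (auto simp: std_lattice_def)
  obtain z where z: "z \<in> std_lattice" "y = w b + smul M q z" using y(4) residue_eq_iff[OF std_lattice_submodule] by blast
  have "comb (\<lambda>x. c x - (if x = b then 1 else 0)) = y - w b"
    using w_comb[OF assms] comb_diff c by simp
  also have "\<dots> = smul M q z" using z by simp
  finally obtain r where r: "r \<in> regular_at_0" "c b - 1 = q * r"
    using comb_q_std_lattice[OF _ z(1) assms] by force
  have "c b \<noteq> 0"
  proof
    assume "c b = 0"
    then have "rat_const (-1) = q * r" using r(2) by simp
    from rat_const_eq_q_times[OF r(1) this] show False by simp
  qed
  then show "lam = wt C b" using comb_weight[OF _ assms _ y(1)] y(3) c by blast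
qed

lemma standard_crystal_iso:
  "crystal_iso n C (base_crystal n M std_lattice std_base) (\<lambda>b. res (w b))"
proof -
  have eps_max: "int (max_iter (residue_e n M std_lattice i) (res (w b))) = eps C i b"
    and phi_max: "int (max_iter (residue_f n M std_lattice i) (res (w b))) = phi C i b"
    if i: "i \<in> {1..n}" and b: "b \<in> elements C" for i b
  proof -
    note ops = residue_operators[OF i]
    have "int (max_iter (residue_e n M std_lattice i) (res (w b))) = (if et C i b = None then 0 else 1)"
      by (subst max_iter_at_most_one) (use ops b et_Some[OF b i] step_twice[of "-1" b i] i in auto)
    then show "int (max_iter (residue_e n M std_lattice i) (res (w b))) = eps C i b"
      using eps[OF b i] et_None[OF b i] by simp
    have "int (max_iter (residue_f n M std_lattice i) (res (w b))) = (if ft C i b = None then 0 else 1)"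
      by (subst max_iter_at_most_one) (use ops b ft_Some[OF b i] step_twice[of 1 b i] i in auto)
    then show "int (max_iter (residue_f n M std_lattice i) (res (w b))) = phi C i b"
      using phi[OF b i] ft_None[OF b i] by simp
  qed
  show ?thesis unfolding crystal_iso_def base_crystal_def
    using res_w_inj residue_weight residue_operators eps_max phi_max by (auto simp: bij_betw_def std_base_def)
qed

lemma standard_crystal_isomorphic: "crystal_isomorphic n C (base_crystal n M std_lattice std_base)"
  unfolding crystal_isomorphic_def
  using crystal standard_crystal_iso crystal_iso_is_crystal by blast

section \<open>Uniqueness of the crystal base\<close>

lemma scaled:
  assumes "a \<noteq> 0"
  shows "minuscule_basis n M C hw (\<lambda>b. smul M a (w b))"
proof
  fix b assume b: "b \<in> elements C"
  show "smul M a (w b) \<in> wspace (wt C b)" using w_weight[OF b] wspace_closed(4) by blast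
  show "smul M a (w b) \<noteq> 0" using w_nonzero[OF b] assms by simp
  fix i assume i: "i \<in> {1..n}"
  show "E M i (smul M a (w b)) = opt (\<lambda>b. smul M a (w b)) (et C i b)"
    unfolding E_F_smul[OF b i] by (cases "et C i b") auto
  show "F M i (smul M a (w b)) = opt (\<lambda>b. smul M a (w b)) (ft C i b)"
    unfolding E_F_smul[OF b i] by (cases "ft C i b") auto
next
  have "w b \<in> vs.span ((\<lambda>b. smul M a (w b)) ` elements C)" if "b \<in> elements C" for b
  proof -
    have "smul M (inverse a) (smul M a (w b)) \<in> vs.span ((\<lambda>b. smul M a (w b)) ` elements C)"
      by (rule vs.span_scale[OF vs.span_base]) (use that in blast)
    then show ?thesis using assms by simp
  qed
  then have "vs.span (w ` elements C) \<subseteq> vs.span ((\<lambda>b. smul M a (w b)) ` elements C)"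
    by (intro vs.span_minimal) auto
  then show "vecs M \<subseteq> vs.span ((\<lambda>b. smul M a (w b)) ` elements C)" using w_span by blast
qed

end

context minuscule_basis begin

context
  fixes L B
  assumes base: "is_crystal_base n M L B"
begin

lemma base_lattice: "is_lattice M L" and base_residues: "is_residue_basis M L B"
  and base_weights: "\<forall>u\<in>L. \<exists>S c. finite S \<and> S \<subseteq> weight_lattice n \<and>
       (\<forall>lam\<in>S. c lam \<in> L \<inter> wspace lam) \<and> u = (\<Sum>lam\<in>S. c lam)"
  and base_residue_weights: "\<forall>\<beta>\<in>B. \<exists>lam\<in>weight_lattice n. \<beta> \<in> residue M L ` (L \<inter> wspace lam)"
  and base_kashiwara_ball: "\<forall>i\<in>{1..n}. \<forall>u\<in>L. kashiwara_e n M i u \<in> L \<and> kashiwara_f n M i u \<in> L"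
  and base_induced_ball: "\<forall>i\<in>{1..n}. \<forall>\<beta>\<in>B.
       induced M L (kashiwara_e n M i) \<beta> \<in> insert (residue M L 0) B \<and>
       induced M L (kashiwara_f n M i) \<beta> \<in> insert (residue M L 0) B"
  using base unfolding is_crystal_base_def by - (elim conjE, assumption)+

lemma base_kashiwara: "i \<in> {1..n} \<Longrightarrow> u \<in> L \<Longrightarrow> kashiwara_e n M i u \<in> L \<and> kashiwara_f n M i u \<in> L"
  by (rule bspec[OF bspec[OF base_kashiwara_ball]])

lemma base_induced: "i \<in> {1..n} \<Longrightarrow> \<beta> \<in> B \<Longrightarrow>
       induced M L (kashiwara_e n M i) \<beta> \<in> insert (residue M L 0) B \<and>
       induced M L (kashiwara_f n M i) \<beta> \<in> insert (residue M L 0) B"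
  by (rule bspec[OF bspec[OF base_induced_ball]])

lemma base_submodule: "regular_submodule L"
  by (rule lattice_regular_submodule[OF base_lattice])

lemmas base_closed = regular_submodule_closed[OF base_submodule]

lemma base_independent:
  assumes "finite S" "S \<subseteq> B" "\<And>b. b \<in> S \<Longrightarrow> u b \<in> b"
    "residue M L (\<Sum>b\<in>S. smul M (rat_const (c b)) (u b)) = residue M L 0" "b \<in> S"
  shows "c b = 0"
proof -
  have *: "\<forall>S c u. finite S \<and> S \<subseteq> B \<and> (\<forall>b\<in>S. u b \<in> b) \<and>
       residue M L (\<Sum>b\<in>S. smul M (rat_const (c b)) (u b)) = residue M L 0 \<longrightarrow> (\<forall>b\<in>S. c b = 0)"
    using base_residues unfolding is_residue_basis_def by (elim conjE)
  have "\<forall>b\<in>S. c b = 0"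
    by (rule *[THEN spec, THEN spec, THEN spec, THEN mp, of S u c]) (use assms in simp)
  then show ?thesis using assms(5) by blast
qed

lemma base_nonzero: "residue M L 0 \<notin> B"
proof
  assume "residue M L 0 \<in> B"
  then have "(\<lambda>_. 1) (residue M L 0) = (0 :: rat)"
    by (intro base_independent[of "{residue M L 0}" "\<lambda>_. 0"]) (auto simp: residue_self[OF base_submodule])
  then show False by simp
qed

lemma base_nonempty: "B \<noteq> {}"
proof
  assume B: "B = {}"
  have "w hw \<in> vecs M" "w hw \<noteq> 0" using w_vecs w_nonzero hw_element by auto
  then have "vecs M \<noteq> {0}" by auto
  from lattice_not_q_divisible[OF base_lattice this]
  obtain x where x: "x \<in> L" "\<forall>y\<in>L. x \<noteq> smul M q y" by blast
  have "\<exists>S c u. finite S \<and> S \<subseteq> B \<and> (\<forall>b\<in>S. u b \<in> b) \<and>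
       residue M L x = residue M L (\<Sum>b\<in>S. smul M (rat_const (c b)) (u b))"
    using base_residues unfolding is_residue_basis_def by (elim conjE) (erule bspec[OF _ x(1)])
  then have "residue M L x = residue M L 0" using B by auto
  then show False using x residue_0_iff[OF base_submodule] by blast
qed

text \<open>Members of a crystal base are classes of weight vectors, and weight spaces are lines.\<close>

lemma base_weight_vector:
  assumes "\<beta> \<in> B"
  obtains b a where "b \<in> elements C" "a \<noteq> 0" "smul M a (w b) \<in> L" "\<beta> = residue M L (smul M a (w b))"
proof -
  obtain lam y where y: "lam \<in> weight_lattice n" "y \<in> L" "y \<in> wspace lam" "\<beta> = residue M L y"
    using bspec[OF base_residue_weights assms] by blast
  have "y \<noteq> 0" using base_nonzero assms y(4) by auto
  from weight_vector[OF y(3,1) this] obtain b a where "b \<in> elements C" "y = smul M a (w b)" "a \<noteq> 0" .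
  then show ?thesis using that y(2,4) by simp
qed

lemma base_operators:
  assumes "i \<in> {1..n}" "u \<in> L"
  shows "kashiwara_e n M i u = E M i u" "kashiwara_f n M i u = F M i u" "E M i u \<in> L" "F M i u \<in> L"
proof -
  have "u \<in> vecs M" using base_closed(1) assms(2) by blast
  from kashiwara[OF assms(1) this]
  show "kashiwara_e n M i u = E M i u" "kashiwara_f n M i u = F M i u" by auto
  then show "E M i u \<in> L" "F M i u \<in> L" using base_kashiwara[OF assms] by auto
qed

lemma base_induced_operators:
  assumes i: "i \<in> {1..n}" and u: "u \<in> L" "residue M L u \<in> B"
  shows "residue M L (E M i u) \<in> insert (residue M L 0) B" "residue M L (F M i u) \<in> insert (residue M L 0) B"
proof -
  have "induced M L (kashiwara_e n M i) (residue M L u) = residue M L (kashiwara_e n M i u)"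
    by (rule induced_residue[OF base_submodule base_operators(1)[OF i] endomorphisms(1)[OF i] _ u(1)])
      (use base_kashiwara[OF i] in auto)
  then show "residue M L (E M i u) \<in> insert (residue M L 0) B"
    using base_induced[OF i u(2)] base_operators(1)[OF i u(1)] by simp
  have "induced M L (kashiwara_f n M i) (residue M L u) = residue M L (kashiwara_f n M i u)"
    by (rule induced_residue[OF base_submodule base_operators(2)[OF i] endomorphisms(2)[OF i] _ u(1)])
      (use base_kashiwara[OF i] in auto)
  then show "residue M L (F M i u) \<in> insert (residue M L 0) B"
    using base_induced[OF i u(2)] base_operators(2)[OF i u(1)] by simp
qed

text \<open>The image of the class is nonzero, because the opposite operator maps it back.\<close>

lemma base_move:
  assumes i: "i \<in> {1..n}" and b: "b \<in> elements C" "b' \<in> elements C"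
    and P: "w b \<in> L" "residue M L (w b) \<in> B"
    and T: "T = E M i \<and> T' = F M i \<or> T = F M i \<and> T' = E M i" "T (w b) = w b'" "T' (w b') = w b"
  shows "w b' \<in> L" "residue M L (w b') \<in> B"
proof -
  have "T (w b) \<in> L" using T(1) base_operators(3,4)[OF i P(1)] by (elim disjE conjE) (simp_all only:)
  then show L: "w b' \<in> L" unfolding T(2) .
  have "residue M L (w b') \<noteq> residue M L 0"
  proof
    assume "residue M L (w b') = residue M L 0"
    then obtain z where z: "z \<in> L" "w b' = smul M q z" using residue_0_iff[OF base_submodule] by auto
    have "endomorphism M T'" using T(1) endomorphisms(1,2)[OF i] by auto
    then have "w b = smul M q (T' z)" using T(3) z endo_smul[of T' z q] base_closed(1) by auto
    moreover have "T' z \<in> L" using T(1) base_operators(3,4)[OF i z(1)] by auto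
    ultimately have "residue M L (w b) = residue M L 0" using residue_0_iff[OF base_submodule] by blast
    then show False using base_nonzero P(2) by simp
  qed
  moreover have "residue M L (T (w b)) \<in> insert (residue M L 0) B"
    using T(1) base_induced_operators[OF i P] by (elim disjE conjE) (simp_all only:)
  ultimately show "residue M L (w b') \<in> B" unfolding T(2) by blast
qed

text \<open>From \<open>b0\<close> all classes of the \<open>w b\<close> are reached by the operators. A multiple \<open>d\<close> of \<open>w b\<close> in \<open>L\<close> with \<open>d\<close>
  not regular would make \<open>w b\<close> divisible by \<open>q\<close> in \<open>L\<close>; so the weight components of \<open>L\<close> are those of the
  standard lattice. Two members of \<open>B\<close> of the same weight are proportional, hence equal by
  independence.\<close>

lemma base_is_standard:
  assumes b0: "b0 \<in> elements C" "w b0 \<in> L" "residue M L (w b0) \<in> B"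
  shows "L = std_lattice" "B = std_base"
proof -
  define P where "P b \<longleftrightarrow> w b \<in> L \<and> residue M L (w b) \<in> B" for b
  have up: "P b'" if "i \<in> {1..n}" "b \<in> elements C" "b' \<in> elements C" "et C i b = Some b'" "P b" for i b b'
    using base_move[OF that(1-3), of "E M i" "F M i"] that w_E[OF that(2,1)] w_F[OF that(3,1)] et_ft(2)[OF that(2,1,4)]
    by (simp add: P_def)
  have down: "P b'" if "i \<in> {1..n}" "b \<in> elements C" "b' \<in> elements C" "ft C i b = Some b'" "P b" for i b b'
    using base_move[OF that(1-3), of "F M i" "E M i"] that w_F[OF that(2,1)] w_E[OF that(3,1)] ft_et(2)[OF that(2,1,4)]
    by (simp add: P_def)
  have "P b0" using b0 by (simp add: P_def)
  from up_induct[of b0 P, OF b0(1) this up] have hw: "P hw" .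
  have all: "P b" if "b \<in> elements C" for b
    using down_induct[of b P, OF that hw down] .
  have wL: "w b \<in> L" and wB: "residue M L (w b) \<in> B" if "b \<in> elements C" for b
    using all[OF that] by (auto simp: P_def)
  have reg: "d \<in> regular_at_0" if b: "b \<in> elements C" and d: "smul M d (w b) \<in> L" for b d
  proof (rule ccontr)
    assume "d \<notin> regular_at_0"
    then obtain r where r: "r \<in> regular_at_0" "d * (q * r) = 1" by (rule regular_or_inverse)
    have "smul M q (smul M r (smul M d (w b))) = smul M (d * (q * r)) (w b)" by (simp add: algebra_simps)
    then have "w b = smul M q (smul M r (smul M d (w b)))" using r(2) by simp
    moreover have "smul M r (smul M d (w b)) \<in> L" using base_closed(4)[OF r(1) d] .
    ultimately have "residue M L (w b) = residue M L 0" using residue_0_iff[OF base_submodule] by blast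
    then show False using wB[OF b] base_nonzero by simp
  qed
  show L: "L = std_lattice"
  proof
    show "std_lattice \<subseteq> L"
    proof
      fix u assume "u \<in> std_lattice"
      then obtain c where c: "u = comb c" "\<forall>b\<in>elements C. c b \<in> regular_at_0" by (auto simp: std_lattice_def)
      show "u \<in> L" unfolding c(1) comb_def
        by (rule base_closed(6)) (rule base_closed(4)[OF bspec[OF c(2)] wL])
    qed
    show "L \<subseteq> std_lattice"
    proof
      fix u assume "u \<in> L"
      then obtain S c where S: "S \<subseteq> weight_lattice n" "\<forall>lam\<in>S. c lam \<in> L \<inter> wspace lam" "u = (\<Sum>lam\<in>S. c lam)"
        using bspec[OF base_weights] by blast
      have "c lam \<in> std_lattice" if lam: "lam \<in> S" for lam
      proof (cases "c lam = 0")
        case False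
        have "c lam \<in> wspace lam" "lam \<in> weight_lattice n" using S lam by auto
        from weight_vector[OF this False] obtain b a where ba: "b \<in> elements C" "c lam = smul M a (w b)" by blast
        then have "a \<in> regular_at_0" using reg S(2) lam by auto
        then show ?thesis unfolding ba(2) using std_lattice_closed(4) w_std_lattice[OF ba(1)] by blast
      qed (simp add: std_lattice_closed(2))
      then show "u \<in> std_lattice" unfolding S(3) by (rule std_lattice_closed(6))
    qed
  qed
  show "B = std_base"
  proof
    show "std_base \<subseteq> B" using wB by (auto simp: std_base_def L)
    show "B \<subseteq> std_base"
    proof
      fix \<beta> assume \<beta>: "\<beta> \<in> B"
      then obtain b a where b: "b \<in> elements C" "a \<noteq> 0" "smul M a (w b) \<in> L" "\<beta> = residue M L (smul M a (w b))"
        by (rule base_weight_vector)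
      obtain e r where er: "r \<in> regular_at_0" "a = rat_const e + q * r"
        using regular_residue[OF reg[OF b(1,3)]] by blast
      define \<gamma> where "\<gamma> = residue M L (w b)"
      have "\<beta> = \<gamma>"
      proof (rule ccontr)
        assume ne: "\<beta> \<noteq> \<gamma>"
        \<comment> \<open>With \<open>a\<close> congruent to \<open>e\<close>, the class \<open>\<beta>\<close> is \<open>e\<close> times \<open>\<gamma>\<close>, against independence.\<close>
        define c where "c x = (if x = \<beta> then 1 else - e)" for x
        define u where "u x = (if x = \<beta> then smul M a (w b) else w b)" for x
        have "(\<Sum>x\<in>{\<beta>, \<gamma>}. smul M (rat_const (c x)) (u x)) = smul M a (w b) - smul M (rat_const e) (w b)"
          using ne by (simp add: c_def u_def)
        also have "\<dots> = smul M q (smul M r (w b))" by (simp add: er(2) vs.scale_left_distrib)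
        finally have "residue M L (\<Sum>x\<in>{\<beta>, \<gamma>}. smul M (rat_const (c x)) (u x)) = residue M L 0"
          using residue_0_iff[OF base_submodule] base_closed(4)[OF er(1) wL[OF b(1)]] by blast
        moreover have "u x \<in> x" if "x \<in> {\<beta>, \<gamma>}" for x
          using that residue_self[OF base_submodule] b(4) ne by (auto simp: u_def \<gamma>_def)
        moreover have "{\<beta>, \<gamma>} \<subseteq> B" using \<beta> wB[OF b(1)] by (simp add: \<gamma>_def)
        ultimately have "c \<beta> = 0" using base_independent[of "{\<beta>, \<gamma>}" u c \<beta>] by simp
        then show False by (simp add: c_def)
      qed
      then show "\<beta> \<in> std_base" using b(1) by (simp add: \<gamma>_def std_base_def L)
    qed
  qed
qed

end

text \<open>Some multiple of a basis vector represents a member of \<open>B\<close>; rescaling the basis by that factor makes the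
  crystal base the standard one.\<close>

lemma crystal_base_isomorphic:
  assumes base: "is_crystal_base n M L B"
  shows "crystal_isomorphic n C (base_crystal n M L B)"
proof -
  obtain \<beta> where "\<beta> \<in> B" using base_nonempty[OF base] by blast
  then obtain b a where b: "b \<in> elements C" "a \<noteq> 0" "smul M a (w b) \<in> L" "residue M L (smul M a (w b)) \<in> B"
    using base_weight_vector[OF base, of \<beta>] by blast
  interpret scaled: minuscule_basis n M C hw "\<lambda>b. smul M a (w b)" by (rule scaled[OF b(2)])
  have "L = scaled.std_lattice" "B = scaled.std_base"
    using scaled.base_is_standard[OF base b(1,3,4)] by auto
  then show ?thesis using scaled.standard_crystal_isomorphic by simp
qed

end

theorem minuscule_crystal_bases:
  fixes M :: "'v::ab_group_add uq_module"
  assumes C: "minuscule_crystal n C hw" and V: "is_V n (wt C hw) M"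
  shows "(\<exists>L B. is_crystal_base n M L B) \<and>
     (\<forall>L B. is_crystal_base n M L B \<longrightarrow> crystal_isomorphic n C (base_crystal n M L B))"
proof -
  interpret minuscule_crystal n C hw by (rule C)
  interpret quantum_module n M by unfold_locales (use V in \<open>simp add: is_V_def\<close>)
  obtain v where v: "v \<in> weight_space n M (wt C hw)" "v \<noteq> 0" "\<And>i. i \<in> {1..n} \<Longrightarrow> E M i v = 0"
    using V unfolding is_V_def has_highest_weight_def by blast
  interpret minuscule_V n M C hw v
    by unfold_locales (use V v in \<open>auto simp: is_V_def\<close>)
  show ?thesis using standard_crystal_base crystal_base_isomorphic by blast
qed

section \<open>Self-conjugate diagrams\<close>

text \<open>Diagrams are the sets of boxes that are closed under going up and to the left; this form avoids the row
  lengths.\<close>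

lemma young_diagram_iff:
  "Y \<in> young_diagrams n \<longleftrightarrow> Y \<subseteq> {1..n} \<times> {1..n} \<and>
    (\<forall>r s r' s'. (r, s) \<in> Y \<longrightarrow> 1 \<le> r' \<longrightarrow> r' \<le> r \<longrightarrow> 1 \<le> s' \<longrightarrow> s' \<le> s \<longrightarrow> (r', s') \<in> Y)"
    (is "_ \<longleftrightarrow> ?R")
proof
  assume "Y \<in> young_diagrams n"
  then obtain lam where lam: "Y = {(r, s). r \<in> {1..n} \<and> 1 \<le> s \<and> s \<le> lam r}"
    "\<And>r. r \<in> {1..n} \<Longrightarrow> lam r \<le> n" "\<And>r r'. r \<in> {1..n} \<Longrightarrow> r' \<in> {1..n} \<Longrightarrow> r \<le> r' \<Longrightarrow> lam r' \<le> lam r"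
    unfolding young_diagrams_def by blast
  show ?R
  proof (intro conjI allI impI)
    show "Y \<subseteq> {1..n} \<times> {1..n}" using lam(2) by (fastforce simp: lam(1))
    fix r s r' s' assume *: "(r, s) \<in> Y" "1 \<le> r'" "r' \<le> r" "1 \<le> s'" "s' \<le> s"
    then have "lam r \<le> lam r'" by (intro lam(3)) (auto simp: lam(1))
    then show "(r', s') \<in> Y" using * by (auto simp: lam(1))
  qed
next
  assume R: ?R
  define lam where "lam r = card {s. (r, s) \<in> Y}" for r
  have fin: "finite {s. (r, s) \<in> Y}" for r
    by (rule finite_subset[of _ "{1..n}"]) (use R in auto)
  have row: "(r, s) \<in> Y \<longleftrightarrow> 1 \<le> s \<and> s \<le> lam r" for r s
  proof
    assume rs: "(r, s) \<in> Y"
    have "{1..s} \<subseteq> {s. (r, s) \<in> Y}"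
    proof
      fix t assume "t \<in> {1..s}"
      then show "t \<in> {s. (r, s) \<in> Y}" using R rs by auto
    qed
    then have "card {1..s} \<le> lam r" unfolding lam_def by (rule card_mono[OF fin])
    then show "1 \<le> s \<and> s \<le> lam r" using R rs by auto
  next
    assume s: "1 \<le> s \<and> s \<le> lam r"
    show "(r, s) \<in> Y"
    proof (rule ccontr)
      assume n: "(r, s) \<notin> Y"
      have "{s. (r, s) \<in> Y} \<subseteq> {1..<s}"
      proof
        fix t assume "t \<in> {s. (r, s) \<in> Y}"
        then have t: "(r, t) \<in> Y" by simp
        then have "1 \<le> t" "1 \<le> r" using R by auto
        moreover have "\<not> s \<le> t" using R t n s \<open>1 \<le> r\<close> by blast
        ultimately show "t \<in> {1..<s}" by simp
      qed
      then have "lam r \<le> card {1..<s}" unfolding lam_def by (intro card_mono) auto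
      then show False using s by (simp, linarith)
    qed
  qed
  have "lam r \<le> n" for r
  proof -
    have "{s. (r, s) \<in> Y} \<subseteq> {1..n}" using R by auto
    then have "lam r \<le> card {1..n}" unfolding lam_def by (intro card_mono) auto
    then show ?thesis by simp
  qed
  moreover have "lam r' \<le> lam r" if "r \<in> {1..n}" "r' \<in> {1..n}" "r \<le> r'" for r r'
    unfolding lam_def by (rule card_mono[OF fin]) (use R that row in auto)
  moreover have "Y = {(r, s). r \<in> {1..n} \<and> 1 \<le> s \<and> s \<le> lam r}"
    using row R by auto
  ultimately show "Y \<in> young_diagrams n" unfolding young_diagrams_def by blast
qed

lemma young_box: "Y \<in> young_diagrams n \<Longrightarrow> (r, s) \<in> Y \<Longrightarrow> 1 \<le> r \<and> r \<le> n \<and> 1 \<le> s \<and> s \<le> n"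
  by (auto simp: young_diagram_iff)

lemma young_down: "Y \<in> young_diagrams n \<Longrightarrow> (r, s) \<in> Y \<Longrightarrow> 1 \<le> r' \<Longrightarrow> r' \<le> r \<Longrightarrow> 1 \<le> s' \<Longrightarrow> s' \<le> s \<Longrightarrow> (r', s') \<in> Y"
  by (simp add: young_diagram_iff)

lemma self_conjugate_iff:
  "Y \<in> self_conjugate_diagrams n \<longleftrightarrow> Y \<in> young_diagrams n \<and> (\<forall>r s. (r, s) \<in> Y \<longleftrightarrow> (s, r) \<in> Y)"
  by (auto simp: self_conjugate_diagrams_def conjugate_def)

definition count_above :: "nat set \<Rightarrow> nat \<Rightarrow> nat" where
  "count_above A c = card {a \<in> A. c < a}"

text \<open>The self-conjugate diagram whose principal hooks have arm lengths \<open>a - 1\<close> for \<open>a\<close> in \<open>A\<close>. Its diagonals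
  with number \<open>c\<close> above and below the main one have \<open>count_above A c\<close> boxes.\<close>

definition hook_diagram :: "nat set \<Rightarrow> diagram" where
  "hook_diagram A = {(r, s). 1 \<le> r \<and> 1 \<le> s \<and> min r s \<le> count_above A (max r s - min r s)}"

lemma count_above_step:
  assumes "finite A"
  shows "count_above A c = count_above A (Suc c) + (if Suc c \<in> A then 1 else 0)"
proof -
  have "{a \<in> A. c < a} = {a \<in> A. Suc c < a} \<union> (if Suc c \<in> A then {Suc c} else {})"
    by (auto intro: Suc_lessI)
  then show ?thesis using assms by (simp add: count_above_def)
qed

lemma count_above_le:
  assumes "A \<subseteq> {1..n}"
  shows "count_above A c \<le> n - c"
proof -
  have "count_above A c \<le> card {Suc c..n}" unfolding count_above_def by (intro card_mono) (use assms in auto)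
  then show ?thesis by simp
qed

lemma count_above_mono: "finite A \<Longrightarrow> c \<le> d \<Longrightarrow> count_above A d \<le> count_above A c"
  unfolding count_above_def by (rule card_mono) auto

lemma count_above_diff: "finite A \<Longrightarrow> count_above A c \<le> count_above A (c + d) + d"
proof (induction d)
  case (Suc d)
  then show ?case using count_above_step[of A "c + d"] by (simp split: if_splits)
qed simp

text \<open>Moving up or left changes \<open>min r s\<close> and the number of the diagonal. When the latter grows by \<open>d\<close>, the former
  drops by at least \<open>d\<close>, while the length of the diagonal drops by at most \<open>d\<close>.\<close>

lemma hook_diagram_self_conjugate:
  assumes A: "A \<subseteq> {1..n}"
  shows "hook_diagram A \<in> self_conjugate_diagrams n"
proof -
  have fin: "finite A" using A finite_subset by blast
  have box: "max r s \<le> n" if "(r, s) \<in> hook_diagram A" for r s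
    using that count_above_le[OF A, of "max r s - min r s"] unfolding hook_diagram_def by simp linarith
  have down: "(r', s') \<in> hook_diagram A" if "(r, s) \<in> hook_diagram A" "1 \<le> r'" "r' \<le> r" "1 \<le> s'" "s' \<le> s" for r s r' s'
  proof -
    define c where "c = max r s - min r s"
    define c' where "c' = max r' s' - min r' s'"
    have m: "min r s \<le> count_above A c" using that(1) by (simp add: hook_diagram_def c_def)
    have "min r' s' \<le> count_above A c'"
    proof (cases "c' \<le> c")
      case True
      then have "count_above A c \<le> count_above A c'" using count_above_mono[OF fin] by simp
      then show ?thesis using m that by auto
    next
      case False
      then have "count_above A c \<le> count_above A c' + (c' - c)" using count_above_diff[OF fin, of c "c' - c"] by simp
      then show ?thesis using m that False unfolding c_def c'_def by linarith
    qed
    then show ?thesis using that by (simp add: hook_diagram_def c'_def)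
  qed
  have "hook_diagram A \<subseteq> {1..n} \<times> {1..n}"
    using box by (fastforce simp: hook_diagram_def)
  then have "hook_diagram A \<in> young_diagrams n" unfolding young_diagram_iff using down by blast
  then show ?thesis unfolding self_conjugate_iff by (auto simp: hook_diagram_def min.commute max.commute)
qed

text \<open>Diagonals are numbered from the main one to the right. In a self-conjugate diagram those on the
  other side are their mirror images.\<close>

definition diagonal :: "diagram \<Rightarrow> nat \<Rightarrow> nat" where
  "diagonal Y c = card {d. (d, d + c) \<in> Y}"

lemma finite_diagonal: "Y \<in> young_diagrams n \<Longrightarrow> finite {d. (d, d + c) \<in> Y}"
  by (rule finite_subset[of _ "{1..n}"]) (auto dest: young_box)

lemma diagonal_iff:
  assumes Y: "Y \<in> young_diagrams n"
  shows "(d, d + c) \<in> Y \<longleftrightarrow> 1 \<le> d \<and> d \<le> diagonal Y c"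
proof
  assume d: "(d, d + c) \<in> Y"
  have "{1..d} \<subseteq> {d. (d, d + c) \<in> Y}" using young_down[OF Y d] by auto
  then have "card {1..d} \<le> diagonal Y c" unfolding diagonal_def by (rule card_mono[OF finite_diagonal[OF Y]])
  then show "1 \<le> d \<and> d \<le> diagonal Y c" using young_box[OF Y d] by simp
next
  assume d: "1 \<le> d \<and> d \<le> diagonal Y c"
  show "(d, d + c) \<in> Y"
  proof (rule ccontr)
    assume n: "(d, d + c) \<notin> Y"
    have "{d. (d, d + c) \<in> Y} \<subseteq> {1..<d}"
    proof
      fix t assume t: "t \<in> {d. (d, d + c) \<in> Y}"
      then have "1 \<le> t" using young_box[OF Y] by blast
      moreover have "\<not> d \<le> t" using young_down[OF Y, of t "t + c" d "d + c"] t n d by auto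
      ultimately show "t \<in> {1..<d}" by simp
    qed
    then have "diagonal Y c \<le> card {1..<d}" unfolding diagonal_def by (intro card_mono) auto
    then show False using d by (simp, linarith)
  qed
qed

lemma diagonal_hook_diagram: "diagonal (hook_diagram A) c = count_above A c"
proof -
  have "{d. (d, d + c) \<in> hook_diagram A} = {1..count_above A c}" by (auto simp: hook_diagram_def)
  then show ?thesis by (simp add: diagonal_def)
qed

lemma self_conjugate_eqI:
  assumes "Y \<in> self_conjugate_diagrams n" "Y' \<in> self_conjugate_diagrams n" "\<And>c. diagonal Y c = diagonal Y' c"
  shows "Y = Y'"
proof -
  have y: "Y \<in> young_diagrams n" "Y' \<in> young_diagrams n" using assms by (auto simp: self_conjugate_iff)
  have *: "(r, s) \<in> Y \<longleftrightarrow> (r, s) \<in> Y'" if "r \<le> s" for r s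
    using diagonal_iff[OF y(1), of r "s - r"] diagonal_iff[OF y(2), of r "s - r"] assms(3) that by simp
  have "(r, s) \<in> Y \<longleftrightarrow> (r, s) \<in> Y'" for r s
    using *[of r s] *[of s r] assms(1,2) unfolding self_conjugate_iff by (meson linear)
  then show ?thesis by auto
qed

text \<open>The \<open>c\<close>-th diagonal of a diagram is at least as long as the next one and exceeds it by at most one. The set
  \<open>A\<close> records where it is longer.\<close>

lemma hook_diagram_surj:
  assumes Y: "Y \<in> self_conjugate_diagrams n"
  obtains A where "A \<subseteq> {1..n}" "Y = hook_diagram A"
proof -
  have y: "Y \<in> young_diagrams n" using Y by (auto simp: self_conjugate_iff)
  define A where "A = {a \<in> {1..n}. diagonal Y a < diagonal Y (a - 1)}"
  have A: "A \<subseteq> {1..n}" and fin: "finite A" by (auto simp: A_def)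
  have zero: "diagonal Y c = 0" if "c \<ge> n" for c
  proof -
    have "{d. (d, d + c) \<in> Y} = {}" using young_box[OF y] that by force
    then show ?thesis by (simp add: diagonal_def)
  qed
  have step: "diagonal Y c = diagonal Y (Suc c) + (if Suc c \<in> A then 1 else 0)" if "c < n" for c
  proof -
    have "diagonal Y (Suc c) \<le> diagonal Y c"
    proof (cases "diagonal Y (Suc c) = 0")
      case False
      then have "(diagonal Y (Suc c), diagonal Y (Suc c) + Suc c) \<in> Y" unfolding diagonal_iff[OF y] by simp
      then have "(diagonal Y (Suc c), diagonal Y (Suc c) + c) \<in> Y" by (rule young_down[OF y]) (use False in auto)
      then show ?thesis using diagonal_iff[OF y] by simp
    qed simp
    moreover have "diagonal Y c \<le> Suc (diagonal Y (Suc c))"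
    proof (cases "diagonal Y c \<le> 1")
      case False
      define d where "d = diagonal Y c"
      have "(d, d + c) \<in> Y" using diagonal_iff[OF y] False by (simp add: d_def)
      then have "(d - 1, d - 1 + Suc c) \<in> Y" by (rule young_down[OF y]) (use False in \<open>auto simp: d_def\<close>)
      then have "d - 1 \<le> diagonal Y (Suc c)" using diagonal_iff[OF y, of "d - 1" "Suc c"] by blast
      then show ?thesis unfolding d_def by linarith
    qed simp
    ultimately show ?thesis using that by (auto simp: A_def)
  qed
  \<comment> \<open>Descending from \<open>c = n\<close>, where both sides are zero.\<close>
  have "count_above A c = diagonal Y c" if "c \<le> n" for c
    using that
  proof (induction rule: inc_induct)
    case base
    then show ?case using zero[of n] count_above_le[OF A, of n] by simp
  next
    case (step c)
    then show ?case using count_above_step[OF fin, of c] \<open>\<And>c. c < n \<Longrightarrow> _\<close>[of c] by simp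
  qed
  then have "diagonal Y c = diagonal (hook_diagram A) c" for c
    using zero[of c] count_above_le[OF A, of c] by (cases "c \<le> n") (auto simp: diagonal_hook_diagram)
  then have "Y = hook_diagram A" using self_conjugate_eqI[OF Y hook_diagram_self_conjugate[OF A]] by blast
  then show ?thesis using that A by blast
qed


section \<open>Adding and removing boxes\<close>

definition diagram_step :: "nat \<Rightarrow> nat \<Rightarrow> diagram \<Rightarrow> diagram \<Rightarrow> bool" where
  "diagram_step n k Y Y' \<longleftrightarrow> (if k = n then adds_one n n Y Y' else adds_two n k (2 * n - k) Y Y')"

lemma diagram_ef_step:
  "diagram_f n k Y = the_diagram n (\<lambda>Y'. diagram_step n k Y Y')"
  "diagram_e n k Y = the_diagram n (\<lambda>Y'. diagram_step n k Y' Y)"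
  by (simp_all add: diagram_f_def diagram_e_def diagram_step_def add_one_def add_two_def remove_one_def remove_two_def)

lemma the_diagram_Some:
  assumes "\<And>Y1 Y2. Y1 \<in> young_diagrams n \<Longrightarrow> Y2 \<in> young_diagrams n \<Longrightarrow> P Y1 \<Longrightarrow> P Y2 \<Longrightarrow> Y1 = Y2"
  shows "the_diagram n P = Some Y \<longleftrightarrow> Y \<in> young_diagrams n \<and> P Y"
proof
  assume *: "the_diagram n P = Some Y"
  then have ex: "\<exists>Y\<in>young_diagrams n. P Y" by (auto simp: the_diagram_def split: if_splits)
  then have "\<exists>!Y. Y \<in> young_diagrams n \<and> P Y" using assms by blast
  from theI'[OF this] * ex show "Y \<in> young_diagrams n \<and> P Y" by (simp add: the_diagram_def)
next
  assume Y: "Y \<in> young_diagrams n \<and> P Y"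
  have "(THE Y. Y \<in> young_diagrams n \<and> P Y) = Y" by (rule the_equality) (use assms Y in blast)+
  then show "the_diagram n P = Some Y" using Y by (auto simp: the_diagram_def)
qed

lemma box_degree_iff:
  assumes "r \<le> n" "k \<le> n"
  shows "box_degree n (r, s) = k \<longleftrightarrow> r = s + (n - k)"
    "box_degree n (r, s) = 2 * n - k \<longleftrightarrow> s = r + (n - k)"
  using assms by (auto simp: box_degree_def)

text \<open>The definition of the operators asks for a Young diagram only. That the two boxes are mirror images comes
  from the shape: if one of them were nearer to the corner than the mirror image of the other, then a box
  of its diagonal would be missing in a diagram containing a later one.\<close>

lemma step_boxes:
  assumes k: "k \<in> {1..n}" and Y: "Y \<in> young_diagrams n" "Y' \<in> young_diagrams n"
    and sc: "Y \<in> self_conjugate_diagrams n \<or> Y' \<in> self_conjugate_diagrams n"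
    and step: "diagram_step n k Y Y'"
  obtains r where "(r, r + (n - k)) \<notin> Y" "(r + (n - k), r) \<notin> Y" "Y' = insert (r, r + (n - k)) (insert (r + (n - k), r) Y)"
proof (cases "k = n")
  case True
  then obtain b where b: "b \<notin> Y" "box_degree n b = n" "Y' = insert b Y"
    using step by (auto simp: diagram_step_def adds_one_def)
  obtain r s where rs: "b = (r, s)" by (cases b)
  have "r \<le> n" using young_box[OF Y(2), of r s] b(3) rs by simp
  then have "r = s" using b(2) rs box_degree_iff(1)[of r n n s] by simp
  then show ?thesis using that[of r] b rs True by simp
next
  case False
  define m where "m = n - k"
  have m: "m > 0" using False k by (simp add: m_def)
  obtain b c where bc: "b \<notin> Y" "c \<notin> Y" "box_degree n b = k" "box_degree n c = 2 * n - k" "Y' = insert b (insert c Y)"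
    using step False by (auto simp: diagram_step_def adds_two_def)
  obtain b1 t where b: "b = (b1, t)" by (cases b)
  obtain r c2 where c: "c = (r, c2)" by (cases c)
  have box: "b1 \<le> n" "r \<le> n" "1 \<le> t" "1 \<le> r"
    using young_box[OF Y(2), of b1 t] young_box[OF Y(2), of r c2] bc(5) b c by auto
  have b1: "b1 = t + m" and c2: "c2 = r + m"
    using box_degree_iff[OF box(1), of k t] box_degree_iff[OF box(2), of k c2] bc(3,4) b c k by (auto simp: m_def)
  have nY: "(t + m, t) \<notin> Y" "(r, r + m) \<notin> Y" using bc b c b1 c2 by auto
  have Y': "x \<in> Y' \<longleftrightarrow> x = (t + m, t) \<or> x = (r, r + m) \<or> x \<in> Y" for x using bc b c b1 c2 by auto
  have "t = r"
  proof (rule ccontr)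
    assume ne: "t \<noteq> r"
    show False
    proof (cases "Y \<in> self_conjugate_diagrams n")
      case True
      then have sym: "(x, y) \<in> Y \<longleftrightarrow> (y, x) \<in> Y" for x y by (auto simp: self_conjugate_iff)
      show False
      proof (cases "t < r")
        case True
        have "(t, t + m) \<in> Y'" by (rule young_down[OF Y(2), of r "r + m"]) (use True box Y' in auto)
        then have "(t, t + m) \<in> Y" using Y' m ne by auto
        then show False using sym nY by blast
      next
        case False
        have "(r + m, r) \<in> Y'" by (rule young_down[OF Y(2), of "t + m" t]) (use False box Y' in auto)
        then have "(r + m, r) \<in> Y" using Y' m ne by auto
        then show False using sym nY by blast
      qed
    next
      case False
      then have sym: "(x, y) \<in> Y' \<longleftrightarrow> (y, x) \<in> Y'" for x y using sc by (auto simp: self_conjugate_iff)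
      show False
      proof (cases "t < r")
        case True
        have "(r + m, r) \<in> Y'" using sym Y' by blast
        then have "(r + m, r) \<in> Y" using Y' m ne by auto
        then have "(t + m, t) \<in> Y" by (rule young_down[OF Y(1)]) (use True box in auto)
        then show False using nY by blast
      next
        case False
        have "(t, t + m) \<in> Y'" using sym Y' by blast
        then have "(t, t + m) \<in> Y" using Y' m ne by auto
        then have "(r, r + m) \<in> Y" by (rule young_down[OF Y(1)]) (use False box in auto)
        then show False using nY by blast
      qed
    qed
  qed
  then show ?thesis using that[of r] nY bc(5) b c b1 c2 by (auto simp: m_def insert_commute)
qed

lemma step_self_conjugate:
  assumes k: "k \<in> {1..n}" and Y: "Y \<in> young_diagrams n" "Y' \<in> young_diagrams n"
    and sc: "Y \<in> self_conjugate_diagrams n \<or> Y' \<in> self_conjugate_diagrams n"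
    and step: "diagram_step n k Y Y'"
  shows "Y \<in> self_conjugate_diagrams n" "Y' \<in> self_conjugate_diagrams n"
    "diagonal Y' c = diagonal Y c + (if c = n - k then 1 else 0)"
proof -
  obtain r where r: "(r, r + (n - k)) \<notin> Y" "(r + (n - k), r) \<notin> Y" "Y' = insert (r, r + (n - k)) (insert (r + (n - k), r) Y)"
    using step_boxes[OF assms] .
  have new: "(x, y) \<in> Y' \<longleftrightarrow> (x, y) \<in> Y \<or> x = r \<and> y = r + (n - k) \<or> x = r + (n - k) \<and> y = r" for x y
    using r(3) by auto
  have down: "\<forall>x y. (x, y) \<in> Y \<longleftrightarrow> (y, x) \<in> Y" if sym: "\<forall>x y. (x, y) \<in> Y' \<longleftrightarrow> (y, x) \<in> Y'"
  proof -
    have "(y, x) \<in> Y" if "(x, y) \<in> Y" for x y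
    proof -
      have "(y, x) \<in> Y'" using that sym new by blast
      then show ?thesis using new[of y x] r(1,2) that by metis
    qed
    then show ?thesis by blast
  qed
  have up: "\<forall>x y. (x, y) \<in> Y' \<longleftrightarrow> (y, x) \<in> Y'" if sym: "\<forall>x y. (x, y) \<in> Y \<longleftrightarrow> (y, x) \<in> Y"
    unfolding new using sym by blast
  show "Y \<in> self_conjugate_diagrams n" "Y' \<in> self_conjugate_diagrams n"
    using sc Y up down unfolding self_conjugate_iff by blast+
  have "{d. (d, d + c) \<in> Y'} = (if c = n - k then insert r {d. (d, d + c) \<in> Y} else {d. (d, d + c) \<in> Y})"
    using r(3) by auto
  then show "diagonal Y' c = diagonal Y c + (if c = n - k then 1 else 0)"
    using r(1) finite_diagonal[OF Y(1), of c] by (cases "c = n - k") (simp_all add: diagonal_def)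
qed

text \<open>The new boxes are the first ones missing on the two diagonals with number \<open>n - k\<close>.\<close>

lemma step_intro:
  assumes k: "k \<in> {1..n}" and Y: "Y \<in> self_conjugate_diagrams n" "Y' \<in> self_conjugate_diagrams n"
    and D: "\<And>c. diagonal Y' c = diagonal Y c + (if c = n - k then 1 else 0)"
  shows "diagram_step n k Y Y'"
proof -
  define m where "m = n - k"
  define r where "r = Suc (diagonal Y m)"
  have y: "Y \<in> young_diagrams n" "Y' \<in> young_diagrams n" using Y by (auto simp: self_conjugate_iff)
  have up: "(a, b) \<in> Y' \<longleftrightarrow> (a, b) \<in> Y \<or> a = r \<and> b = r + m" if "a \<le> b" for a b
    using diagonal_iff[OF y(1), of a "b - a"] diagonal_iff[OF y(2), of a "b - a"] D[of "b - a"] that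
    by (auto simp: m_def r_def)
  have sym: "(a, b) \<in> Y \<longleftrightarrow> (b, a) \<in> Y" "(a, b) \<in> Y' \<longleftrightarrow> (b, a) \<in> Y'" for a b
    using Y unfolding self_conjugate_iff by blast+
  have all: "(a, b) \<in> Y' \<longleftrightarrow> (a, b) \<in> Y \<or> a = r \<and> b = r + m \<or> a = r + m \<and> b = r" for a b
  proof (cases "a \<le> b")
    case True
    then show ?thesis using up[OF True] by auto
  next
    case False
    then have "b \<le> a" by simp
    from up[OF this] show ?thesis using sym False by auto
  qed
  have Y': "Y' = insert (r, r + m) (insert (r + m, r) Y)"
    using all by auto
  have n: "(r, r + m) \<notin> Y" using diagonal_iff[OF y(1), of r m] by (simp add: r_def)
  then have n': "(r + m, r) \<notin> Y" using sym by blast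
  have deg: "box_degree n (r, r + m) = 2 * n - k" "box_degree n (r + m, r) = k"
    using k by (auto simp: box_degree_def m_def)
  show ?thesis
  proof (cases "k = n")
    case True
    then show ?thesis using Y' n deg by (auto simp: diagram_step_def adds_one_def m_def)
  next
    case False
    then have "m > 0" using k by (simp add: m_def)
    then have ne: "(r + m, r) \<noteq> (r, r + m)" by simp
    have "Y' = insert (r + m, r) (insert (r, r + m) Y)" unfolding Y' by (rule insert_commute)
    with n' n ne deg(2,1) have "adds_two n k (2 * n - k) Y Y'"
      unfolding adds_two_def by (intro exI[of _ "(r + m, r)"] exI[of _ "(r, r + m)"] conjI)
    then show ?thesis using False by (simp add: diagram_step_def)
  qed
qed

lemma diagram_f_Some:
  assumes k: "k \<in> {1..n}" and Y: "Y \<in> self_conjugate_diagrams n"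
  shows "diagram_f n k Y = Some Y' \<longleftrightarrow> Y' \<in> self_conjugate_diagrams n \<and>
    (\<forall>c. diagonal Y' c = diagonal Y c + (if c = n - k then 1 else 0))"
proof -
  have y: "Y \<in> young_diagrams n" using Y by (simp add: self_conjugate_iff)
  have *: "Y1 \<in> self_conjugate_diagrams n \<and> (\<forall>c. diagonal Y1 c = diagonal Y c + (if c = n - k then 1 else 0))"
    if "Y1 \<in> young_diagrams n" "diagram_step n k Y Y1" for Y1
    using step_self_conjugate(2,3)[OF k y that(1) disjI1[OF Y] that(2)] by blast
  have "diagram_f n k Y = Some Y' \<longleftrightarrow> Y' \<in> young_diagrams n \<and> diagram_step n k Y Y'"
    unfolding diagram_ef_step
  proof (rule the_diagram_Some)
    fix Y1 Y2 assume Y12: "Y1 \<in> young_diagrams n" "Y2 \<in> young_diagrams n" "diagram_step n k Y Y1" "diagram_step n k Y Y2"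
    have "diagonal Y1 c = diagonal Y2 c" for c
      using conjunct2[OF *[OF Y12(1,3)], THEN spec, of c] conjunct2[OF *[OF Y12(2,4)], THEN spec, of c] by linarith
    then show "Y1 = Y2" using self_conjugate_eqI *[OF Y12(1,3)] *[OF Y12(2,4)] by blast
  qed
  then show ?thesis using * step_intro[OF k Y] self_conjugate_iff by blast
qed

lemma diagram_e_Some:
  assumes k: "k \<in> {1..n}" and Y: "Y \<in> self_conjugate_diagrams n"
  shows "diagram_e n k Y = Some Y' \<longleftrightarrow> Y' \<in> self_conjugate_diagrams n \<and>
    (\<forall>c. diagonal Y c = diagonal Y' c + (if c = n - k then 1 else 0))"
proof -
  have y: "Y \<in> young_diagrams n" using Y by (simp add: self_conjugate_iff)
  have *: "Y1 \<in> self_conjugate_diagrams n \<and> (\<forall>c. diagonal Y c = diagonal Y1 c + (if c = n - k then 1 else 0))"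
    if "Y1 \<in> young_diagrams n" "diagram_step n k Y1 Y" for Y1
    using step_self_conjugate(1,3)[OF k that(1) y disjI2[OF Y] that(2)] by blast
  have "diagram_e n k Y = Some Y' \<longleftrightarrow> Y' \<in> young_diagrams n \<and> diagram_step n k Y' Y"
    unfolding diagram_ef_step
  proof (rule the_diagram_Some)
    fix Y1 Y2 assume Y12: "Y1 \<in> young_diagrams n" "Y2 \<in> young_diagrams n" "diagram_step n k Y1 Y" "diagram_step n k Y2 Y"
    have "diagonal Y1 c = diagonal Y2 c" for c
      using conjunct2[OF *[OF Y12(1,3)], THEN spec, of c] conjunct2[OF *[OF Y12(2,4)], THEN spec, of c] by linarith
    then show "Y1 = Y2" using self_conjugate_eqI *[OF Y12(1,3)] *[OF Y12(2,4)] by blast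
  qed
  then show ?thesis using * step_intro[OF k _ Y] self_conjugate_iff by blast
qed

lemma count_above_shift:
  assumes "finite A" "Suc m \<notin> A" "m = 0 \<or> m \<in> A"
  shows "count_above (insert (Suc m) (A - {m})) c = count_above A c + (if c = m then 1 else 0)"
proof -
  have "{a \<in> insert (Suc m) (A - {m}). c < a} = ({a \<in> A. c < a} - {m}) \<union> (if c \<le> m then {Suc m} else {})"
    by auto
  moreover have "card ({a \<in> A. c < a} - {m}) = count_above A c - (if c < m then 1 else 0)"
    using assms by (auto simp: count_above_def)
  moreover have "count_above A c > 0" if "c < m"
    using assms that unfolding count_above_def by (auto simp: card_gt_0_iff)
  ultimately show ?thesis using assms by (auto simp: count_above_def)
qed

lemma count_above_increment:
  assumes "finite A" "finite A'" and D: "\<And>c. count_above A' c = count_above A c + (if c = m then 1 else 0)"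
  shows "Suc m \<notin> A \<and> Suc m \<in> A'" "m = 0 \<or> m \<in> A \<and> m \<notin> A'"
proof -
  show "Suc m \<notin> A \<and> Suc m \<in> A'"
    using count_above_step[OF assms(1), of m] count_above_step[OF assms(2), of m] D[of m] D[of "Suc m"]
    by (auto split: if_splits)
  show "m = 0 \<or> m \<in> A \<and> m \<notin> A'"
  proof (cases m)
    case (Suc l)
    then show ?thesis
      using count_above_step[OF assms(1), of l] count_above_step[OF assms(2), of l] D[of l] D[of "Suc l"]
      by (simp split: if_splits)
  qed simp
qed

text \<open>In terms of \<open>A\<close>, lengthening the diagonal \<open>n - k\<close> by one means that a proper step after it appears and,
  unless it is the main diagonal, the proper step before it disappears.\<close>

lemma diagram_f_defined:
  assumes k: "k \<in> {1..n}" and A: "A \<subseteq> {1..n}"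
  shows "diagram_f n k (hook_diagram A) \<noteq> None \<longleftrightarrow> Suc (n - k) \<notin> A \<and> (k = n \<or> n - k \<in> A)"
proof -
  define m where "m = n - k"
  have fin: "finite A" using A finite_subset by blast
  have m0: "k = n \<longleftrightarrow> m = 0" using k by (auto simp: m_def)
  show ?thesis unfolding m_def[symmetric] m0
  proof
    assume "diagram_f n k (hook_diagram A) \<noteq> None"
    then obtain Y' where Y': "Y' \<in> self_conjugate_diagrams n" "\<And>c. diagonal Y' c = count_above A c + (if c = m then 1 else 0)"
      using diagram_f_Some[OF k hook_diagram_self_conjugate[OF A]] by (auto simp: diagonal_hook_diagram m_def)
    obtain A' where A': "A' \<subseteq> {1..n}" "Y' = hook_diagram A'" using hook_diagram_surj[OF Y'(1)] .
    have fin': "finite A'" using A' finite_subset by blast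
    have D: "count_above A' c = count_above A c + (if c = m then 1 else 0)" for c using Y'(2) A'(2) by (simp add: diagonal_hook_diagram)
    from count_above_increment[OF fin fin' D] show "Suc m \<notin> A \<and> (m = 0 \<or> m \<in> A)" by blast
  next
    assume *: "Suc m \<notin> A \<and> (m = 0 \<or> m \<in> A)"
    define A' where "A' = insert (Suc m) (A - {m})"
    have A': "A' \<subseteq> {1..n}" using A k by (auto simp: A'_def m_def)
    have "diagram_f n k (hook_diagram A) = Some (hook_diagram A')"
      unfolding diagram_f_Some[OF k hook_diagram_self_conjugate[OF A]]
      using hook_diagram_self_conjugate[OF A'] count_above_shift[OF fin, of m] * by (simp add: diagonal_hook_diagram A'_def m_def)
    then show "diagram_f n k (hook_diagram A) \<noteq> None" by simp
  qed
qed

lemma diagram_e_defined: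
  assumes k: "k \<in> {1..n}" and A: "A \<subseteq> {1..n}"
  shows "diagram_e n k (hook_diagram A) \<noteq> None \<longleftrightarrow> Suc (n - k) \<in> A \<and> (k = n \<or> n - k \<notin> A)"
proof -
  define m where "m = n - k"
  have fin: "finite A" using A finite_subset by blast
  have m0: "k = n \<longleftrightarrow> m = 0" using k by (auto simp: m_def)
  show ?thesis unfolding m_def[symmetric] m0
  proof
    assume "diagram_e n k (hook_diagram A) \<noteq> None"
    then obtain Y' where Y': "Y' \<in> self_conjugate_diagrams n" "\<And>c. count_above A c = diagonal Y' c + (if c = m then 1 else 0)"
      using diagram_e_Some[OF k hook_diagram_self_conjugate[OF A]] by (auto simp: diagonal_hook_diagram m_def)
    obtain A' where A': "A' \<subseteq> {1..n}" "Y' = hook_diagram A'" using hook_diagram_surj[OF Y'(1)] .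
    have fin': "finite A'" using A' finite_subset by blast
    have D: "count_above A c = count_above A' c + (if c = m then 1 else 0)" for c using Y'(2) A'(2) by (simp add: diagonal_hook_diagram)
    from count_above_increment[OF fin' fin D] show "Suc m \<in> A \<and> (m = 0 \<or> m \<notin> A)" by blast
  next
    assume *: "Suc m \<in> A \<and> (m = 0 \<or> m \<notin> A)"
    define A' where "A' = (A - {Suc m}) \<union> (if m = 0 then {} else {m})"
    have A': "A' \<subseteq> {1..n}" using A k by (auto simp: A'_def m_def)
    have fin': "finite A'" using A' finite_subset by blast
    have "A = insert (Suc m) (A' - {m})" using * A by (auto simp: A'_def)
    then have "count_above A c = count_above A' c + (if c = m then 1 else 0)" for c
      using count_above_shift[OF fin', of m c] by (auto simp: A'_def split: if_splits)
    then have "diagram_e n k (hook_diagram A) = Some (hook_diagram A')"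
      unfolding diagram_e_Some[OF k hook_diagram_self_conjugate[OF A]]
      using hook_diagram_self_conjugate[OF A'] by (simp add: diagonal_hook_diagram m_def)
    then show "diagram_e n k (hook_diagram A) \<noteq> None" by simp
  qed
qed


section \<open>The diagram crystal is minuscule\<close>

lemma diagonal_card:
  assumes Y: "Y \<in> self_conjugate_diagrams n" and i: "i \<in> {1..n}"
  shows "card {b \<in> Y. box_degree n b = i} = diagonal Y (n - i)"
proof -
  have y: "Y \<in> young_diagrams n" and sym: "\<And>r s. (r, s) \<in> Y \<longleftrightarrow> (s, r) \<in> Y" using Y by (auto simp: self_conjugate_iff)
  have "{b \<in> Y. box_degree n b = i} = (\<lambda>d. (d + (n - i), d)) ` {d. (d, d + (n - i)) \<in> Y}"
  proof (intro equalityI subsetI)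
    fix b assume b: "b \<in> {b \<in> Y. box_degree n b = i}"
    obtain r s where rs: "b = (r, s)" by (cases b)
    have "r = s + (n - i)" using b rs young_box[OF y, of r s] box_degree_iff(1)[of r n i s] i by auto
    then show "b \<in> (\<lambda>d. (d + (n - i), d)) ` {d. (d, d + (n - i)) \<in> Y}" using b rs sym by auto
  next
    fix b assume "b \<in> (\<lambda>d. (d + (n - i), d)) ` {d. (d, d + (n - i)) \<in> Y}"
    then obtain d where d: "b = (d + (n - i), d)" "(d, d + (n - i)) \<in> Y" by auto
    then have "b \<in> Y" using sym by blast
    moreover have "box_degree n b = i" using d(1) i by (auto simp: box_degree_def)
    ultimately show "b \<in> {b \<in> Y. box_degree n b = i}" by simp
  qed
  then show ?thesis by (simp add: card_image inj_on_def diagonal_def)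
qed

lemma diagram_wt_diagonal:
  assumes "Y \<in> self_conjugate_diagrams n"
  shows "diagram_wt n Y j = fundamental_weight n j - (\<Sum>i = 1..n. int (diagonal Y (n - i)) * simple_root n i j)"
  unfolding diagram_wt_def using diagonal_card[OF assms] by simp

lemma diagram_wt_step:
  assumes Y: "Y \<in> self_conjugate_diagrams n" "Y' \<in> self_conjugate_diagrams n" and k: "k \<in> {1..n}"
    and D: "\<And>c. diagonal Y' c = diagonal Y c + (if c = n - k then 1 else 0)"
  shows "diagram_wt n Y' = diagram_wt n Y - simple_root n k"
proof
  fix j
  have "(\<Sum>i = 1..n. int (diagonal Y' (n - i)) * simple_root n i j)
      = (\<Sum>i = 1..n. int (diagonal Y (n - i)) * simple_root n i j + (if i = k then simple_root n i j else 0))"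
  proof (rule sum.cong[OF refl])
    fix i assume "i \<in> {1..n}"
    then have "n - i = n - k \<longleftrightarrow> i = k" using k by auto
    then show "int (diagonal Y' (n - i)) * simple_root n i j
      = int (diagonal Y (n - i)) * simple_root n i j + (if i = k then simple_root n i j else 0)"
      unfolding D by (simp add: algebra_simps)
  qed
  also have "\<dots> = (\<Sum>i = 1..n. int (diagonal Y (n - i)) * simple_root n i j) + simple_root n k j"
    using k by (simp add: sum.distrib)
  finally show "diagram_wt n Y' j = (diagram_wt n Y - simple_root n k) j"
    unfolding diagram_wt_diagonal[OF Y(1)] diagram_wt_diagonal[OF Y(2)] minus_apply by simp
qed

text \<open>The pairing with a coroot is a second difference of diagonal lengths, hence a difference of two
  indicators of \<open>A\<close>; the boundary case \<open>j = n\<close> has the doubled Cartan integer instead.\<close>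

lemma diagram_wt_hook_diagram:
  assumes A: "A \<subseteq> {1..n}" and j: "j \<in> {1..n}"
  shows "diagram_wt n (hook_diagram A) j =
    (if j = n then 1 - 2 * of_bool (1 \<in> A) else of_bool (n - j \<in> A) - of_bool (Suc (n - j) \<in> A))"
proof -
  define m where "m = n - j"
  define D where "D c = int (count_above A c)" for c
  have fin: "finite A" using A finite_subset by blast
  have Dn: "D n = 0" using count_above_le[OF A, of n] by (simp add: D_def)
  have step: "D c = D (Suc c) + of_bool (Suc c \<in> A)" for c
    using count_above_step[OF fin, of c] by (simp add: D_def)
  have "(\<Sum>i = 1..n. int (diagonal (hook_diagram A) (n - i)) * simple_root n i j) = (\<Sum>i = 1..n. D (n - i) * cartan n j i)"
    using j by (intro sum.cong) (auto simp: diagonal_hook_diagram D_def simple_root_def)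
  also have "\<dots> = D (n - j) * cartan n j j + (if j = 1 then 0 else D (n - (j - 1)) * cartan n j (j - 1))
      + (if j = n then 0 else D (n - (j + 1)) * cartan n j (j + 1))"
    by (rule sum_neighbours[OF j]) (auto simp: cartan_def)
  also have "\<dots> = 2 * D m - (if j = n then 2 else 1) * D (Suc m) - (if j = n then 0 else D (m - 1))"
  proof -
    have "(if j = 1 then 0 else D (n - (j - 1)) * cartan n j (j - 1)) = - ((if j = n then 2 else 1) * D (Suc m))"
    proof (cases "j = 1")
      case True
      then have "Suc m = n" using j by (simp add: m_def)
      then show ?thesis using True Dn by simp
    next
      case False
      then have "n - (j - 1) = Suc m" using j by (auto simp: m_def)
      moreover have "cartan n j (j - 1) = - (if j = n then 2 else 1)" using False j by (auto simp: cartan_def)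
      ultimately show ?thesis using False by simp
    qed
    moreover have "(if j = n then 0 else D (n - (j + 1)) * cartan n j (j + 1)) = - (if j = n then 0 else D (m - 1))"
      by (auto simp: cartan_def m_def)
    ultimately show ?thesis by (simp add: m_def)
  qed
  finally have "diagram_wt n (hook_diagram A) j = fundamental_weight n j - (2 * D m - (if j = n then 2 else 1) * D (Suc m) - (if j = n then 0 else D (m - 1)))"
    using diagram_wt_diagonal[OF hook_diagram_self_conjugate[OF A]] by simp
  also have "\<dots> = (if j = n then 1 - 2 * of_bool (1 \<in> A) else of_bool (n - j \<in> A) - of_bool (Suc (n - j) \<in> A))"
  proof (cases "j = n")
    case True
    then show ?thesis using step[of 0] by (simp add: m_def fundamental_weight_def)
  next
    case False
    then have "Suc (m - 1) = m" using j by (auto simp: m_def)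
    then show ?thesis using False step[of m] step[of "m - 1"] by (simp add: fundamental_weight_def m_def)
  qed
  finally show ?thesis .
qed

lemma diagram_wt_lattice:
  assumes "n \<ge> 1" "Y \<in> self_conjugate_diagrams n"
  shows "diagram_wt n Y \<in> weight_lattice n"
  using assms unfolding weight_lattice_def
  by (auto simp: diagram_wt_diagonal fundamental_weight_def simple_root_def)

text \<open>The pairing with \<open>h_n\<close> shows whether \<open>1\<close> belongs to \<open>A\<close>, and the pairing with \<open>h_j\<close> then decides about
  \<open>n - j + 1\<close> once \<open>n - j\<close> is known; so weights are distinct. For nonempty \<open>A\<close>, its least element can be lowered by
  one, or removed if it is \<open>1\<close>, so the empty diagram is the only one annihilated by all \<open>e_k\<close>.\<close>

lemma diagram_minuscule:
  assumes n: "n \<ge> 1"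
  shows "minuscule_crystal n (diagram_crystal n) {}"
proof -
  let ?C = "diagram_crystal n" and ?S = "self_conjugate_diagrams n"
  have sel: "elements ?C = ?S" "wt ?C = diagram_wt n"
    "et ?C = diagram_e n" "ft ?C = diagram_f n"
    "eps ?C = (\<lambda>k Y. int (max_iter (diagram_e n k) Y))"
    "phi ?C = (\<lambda>k Y. int (max_iter (diagram_f n k) Y))"
    by (simp_all add: diagram_crystal_def)
  have empty: "hook_diagram {} = {}" by (auto simp: hook_diagram_def count_above_def)
  have e_None: "diagram_e n i Y = None \<longleftrightarrow> diagram_wt n Y i \<noteq> -1"
    and f_None: "diagram_f n i Y = None \<longleftrightarrow> diagram_wt n Y i \<noteq> 1"
    and small: "diagram_wt n Y i \<in> {-1, 0, 1}"
    if Y: "Y \<in> ?S" and i: "i \<in> {1..n}" for Y i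
  proof -
    obtain A where A: "A \<subseteq> {1..n}" "Y = hook_diagram A" using hook_diagram_surj[OF Y] .
    show "diagram_e n i Y = None \<longleftrightarrow> diagram_wt n Y i \<noteq> -1"
      using diagram_e_defined[OF i A(1)] diagram_wt_hook_diagram[OF A(1) i] A(2) by (auto simp: of_bool_def split: if_splits)
    show "diagram_f n i Y = None \<longleftrightarrow> diagram_wt n Y i \<noteq> 1"
      using diagram_f_defined[OF i A(1)] diagram_wt_hook_diagram[OF A(1) i] A(2) by (auto simp: of_bool_def split: if_splits)
    show "diagram_wt n Y i \<in> {-1, 0, 1}"
      using diagram_wt_hook_diagram[OF A(1) i] A(2) by (auto simp: of_bool_def)
  qed
  have f_Some: "Y' \<in> ?S \<and> diagram_wt n Y' = diagram_wt n Y - simple_root n i"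
    if Y: "Y \<in> ?S" and i: "i \<in> {1..n}" and f: "diagram_f n i Y = Some Y'" for Y Y' i
    using diagram_wt_step[OF Y _ i] f unfolding diagram_f_Some[OF i Y] by blast
  have e_Some: "Y' \<in> ?S \<and> diagram_wt n Y' = diagram_wt n Y + simple_root n i"
    if Y: "Y \<in> ?S" and i: "i \<in> {1..n}" and e: "diagram_e n i Y = Some Y'" for Y Y' i
  proof -
    have Y': "Y' \<in> ?S" "\<And>c. diagonal Y c = diagonal Y' c + (if c = n - i then 1 else 0)"
      using e unfolding diagram_e_Some[OF i Y] by blast+
    show ?thesis using Y'(1) diagram_wt_step[OF Y'(1) Y i Y'(2)] by simp
  qed
  have root: "simple_root n i i = 2" if "i \<in> {1..n}" for i using that by (simp add: simple_root_def)
  show ?thesis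
  proof
    show "finite (elements ?C)"
    proof -
      have "elements ?C \<subseteq> Pow ({1..n} \<times> {1..n})"
        unfolding sel
      proof
        fix Y assume "Y \<in> ?S"
        then have "Y \<in> young_diagrams n" by (simp add: self_conjugate_iff)
        then show "Y \<in> Pow ({1..n} \<times> {1..n})" by (simp add: young_diagram_iff)
      qed
      then show ?thesis by (rule finite_subset) simp
    qed
    show "{} \<in> elements ?C"
      using hook_diagram_self_conjugate[of "{}" n] empty by (simp add: sel)
    show "inj_on (wt ?C) (elements ?C)"
      unfolding sel
    proof (rule inj_onI)
      fix Y Y' assume Y: "Y \<in> ?S" "Y' \<in> ?S"
        and eq: "diagram_wt n Y = diagram_wt n Y'"
      obtain A where A: "A \<subseteq> {1..n}" "Y = hook_diagram A" using hook_diagram_surj[OF Y(1)] .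
      obtain A' where A': "A' \<subseteq> {1..n}" "Y' = hook_diagram A'" using hook_diagram_surj[OF Y(2)] .
      have "a < n \<longrightarrow> (Suc a \<in> A \<longleftrightarrow> Suc a \<in> A')" for a
      proof (induction a)
        case 0
        show ?case using diagram_wt_hook_diagram[OF A(1), of n] diagram_wt_hook_diagram[OF A'(1), of n] n eq A(2) A'(2)
          by (auto simp: of_bool_def split: if_splits)
      next
        case (Suc a)
        show ?case
        proof
          assume a: "Suc a < n"
          have j: "n - Suc a \<in> {1..n}" "n - Suc a \<noteq> n" "n - (n - Suc a) = Suc a" using a by auto
          show "Suc (Suc a) \<in> A \<longleftrightarrow> Suc (Suc a) \<in> A'"
            using diagram_wt_hook_diagram[OF A(1) j(1)] diagram_wt_hook_diagram[OF A'(1) j(1)] eq A(2) A'(2) Suc a j(2,3)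
            by (auto simp: of_bool_def split: if_splits)
        qed
      qed
      then have "a \<in> A \<longleftrightarrow> a \<in> A'" for a
        using A(1) A'(1) by (cases a) (auto simp: Suc_le_eq)
      then show "Y = Y'" using A(2) A'(2) by (metis subsetI subset_antisym)
    qed
    fix Y assume "Y \<in> elements ?C"
    then have Y: "Y \<in> ?S" by (simp add: sel)
    show "wt ?C Y \<in> weight_lattice n" using diagram_wt_lattice[OF n Y] by (simp add: sel)
    show "\<exists>i\<in>{1..n}. wt ?C Y i = -1" if ne: "Y \<noteq> {}"
    proof -
      obtain A where A: "A \<subseteq> {1..n}" "Y = hook_diagram A" using hook_diagram_surj[OF Y] .
      then have "A \<noteq> {}" "finite A" using ne empty finite_subset by auto
      define a where "a = Min A"
      have a: "a \<in> A" "\<And>x. x \<in> A \<Longrightarrow> a \<le> x" using \<open>A \<noteq> {}\<close> \<open>finite A\<close> by (auto simp: a_def)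
      define i where "i = n - (a - 1)"
      have aa: "1 \<le> a" "a \<le> n" using a(1) A(1) by auto
      then have i: "i \<in> {1..n}" "n - i = a - 1" by (auto simp: i_def)
      have "a - 1 \<notin> A" using a(2)[of "a - 1"] aa by auto
      moreover have "i = n \<longleftrightarrow> a = 1" using aa by (auto simp: i_def)
      ultimately have "diagram_wt n Y i = -1"
        using diagram_wt_hook_diagram[OF A(1) i(1)] A(2) a(1) aa i(2) by auto
      then show ?thesis using i(1) by (auto simp: sel)
    qed
    fix i assume i: "i \<in> {1..n}"
    show "wt ?C Y i \<in> {-1, 0, 1}" using small[OF Y i] by (simp add: sel)
    show "et ?C i Y = None \<longleftrightarrow> wt ?C Y i \<noteq> -1"
      using e_None[OF Y i] by (simp add: sel)
    show "ft ?C i Y = None \<longleftrightarrow> wt ?C Y i \<noteq> 1"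
      using f_None[OF Y i] by (simp add: sel)
    show "Y' \<in> elements ?C \<and> wt ?C Y' = wt ?C Y + simple_root n i"
      if "et ?C i Y = Some Y'" for Y'
      using e_Some[OF Y i] that by (simp add: sel)
    show "Y' \<in> elements ?C \<and> wt ?C Y' = wt ?C Y - simple_root n i"
      if "ft ?C i Y = Some Y'" for Y'
      using f_Some[OF Y i] that by (simp add: sel)
    have "diagram_e n i Y' = None" if "diagram_e n i Y = Some Y'" for Y'
      using e_Some[OF Y i that] e_None[OF Y i] e_None[of Y' i] i that root[OF i] by auto
    from max_iter_at_most_one[of "diagram_e n i", OF this]
    show "eps ?C i Y = (if wt ?C Y i = -1 then 1 else 0)" using e_None[OF Y i] by (simp add: sel)
    have "diagram_f n i Y' = None" if "diagram_f n i Y = Some Y'" for Y'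
      using f_Some[OF Y i that] f_None[OF Y i] f_None[of Y' i] i that root[OF i] by auto
    from max_iter_at_most_one[of "diagram_f n i", OF this]
    show "phi ?C i Y = (if wt ?C Y i = 1 then 1 else 0)" using f_None[OF Y i] by (simp add: sel)
  qed
qed

theorem theorem9p3:
  fixes n :: nat
  assumes "n \<ge> 1"
  shows
    "(\<exists>M :: (diagram \<Rightarrow> qfield) uq_module. is_V n (fundamental_weight n) M) \<and>
     (\<forall>M :: 'v::ab_group_add uq_module. is_V n (fundamental_weight n) M \<longrightarrow>
        (\<exists>L B. is_crystal_base n M L B) \<and>
        (\<forall>L B. is_crystal_base n M L B \<longrightarrow>
           crystal_isomorphic n (diagram_crystal n) (base_crystal n M L B)))"
proof -
  interpret minuscule_crystal n "diagram_crystal n" "{}"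
    by (rule diagram_minuscule[OF assms])
  have wt: "wt (diagram_crystal n) {} = fundamental_weight n"
    by (auto simp: diagram_crystal_def diagram_wt_def fundamental_weight_def)
  show ?thesis
    using minuscule_module_is_V minuscule_crystal_bases[OF minuscule_crystal_axioms]
    unfolding wt by blast
qed

end
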